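(* The minimum fair bisection problem restricted to recursive trees is NP-hard: given a recursive tree on $2n$ nodes in which every label in $\{1,\dots,n\}$ is carried by exactly two nodes, finding a fair bisection of the nodes that minimises the number of edges in the cut is NP-hard.
   Context: A tree on $2n$ nodes whose nodes are labelled by $\{1,\dots,n\}$, each label being used exactly twice, is called recursive here if the two nodes with label $1$ (the roots) are joined by an edge and, for each node, the labels strictly decrease along the path from that node to its closest root (the root edge is thus the only edge joining equally labelled nodes). A bisection of the node set into two parts is fair if neither part contains two nodes with the same label (so each part contains exactly one node of each label). The cut of a bisection is the set of edges having one endpoint in each part. *)

theory Defs
  imports "HOL-Computational_Algebra.Polynomial"
begin

section \<open>Turing machines\<close>

text \<open>
  Multi-tape Turing machines with two-way infinite tapes. States and symbols are natural
  numbers; only finitely many of them matter, since a machine is a finite set of transitions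
  (state, symbols read, next state, (symbol to write, head move) for each tape).
  The blank is 0, and the input bits False and True are the symbols 1 and 2.
\<close>

datatype move = MoveLeft | Stay | MoveRight

type_synonym tape = "(int \<Rightarrow> nat) \<times> int"
type_synonym config = "nat \<times> tape list"
type_synonym tm = "(nat \<times> nat list \<times> nat \<times> (nat \<times> move) list) set"

definition wf_tm :: "nat \<Rightarrow> tm \<Rightarrow> bool" where
  "wf_tm k M \<longleftrightarrow> 0 < k \<and> finite M \<and>
     (\<forall>(q, rs, q', as) \<in> M. length rs = k \<and> length as = k)"

definition deterministic :: "tm \<Rightarrow> bool" where
  "deterministic M \<longleftrightarrow>
     (\<forall>q rs q1 as1 q2 as2. (q, rs, q1, as1) \<in> M \<and> (q, rs, q2, as2) \<in> M
        \<longrightarrow> q1 = q2 \<and> as1 = as2)"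

fun move_head :: "move \<Rightarrow> int \<Rightarrow> int" where
  "move_head MoveLeft i = i - 1"
| "move_head Stay i = i"
| "move_head MoveRight i = i + 1"

fun read_tape :: "tape \<Rightarrow> nat" where
  "read_tape (t, i) = t i"

fun act_tape :: "nat \<times> move \<Rightarrow> tape \<Rightarrow> tape" where
  "act_tape (s, d) (t, i) = (t(i := s), move_head d i)"

definition tm_step :: "tm \<Rightarrow> config \<Rightarrow> config \<Rightarrow> bool" where
  "tm_step M c c' \<longleftrightarrow>
     (\<exists>as. (fst c, map read_tape (snd c), fst c', as) \<in> M \<and> snd c' = map2 act_tape as (snd c))"

definition halted :: "tm \<Rightarrow> config \<Rightarrow> bool" where
  "halted M c \<longleftrightarrow> (\<forall>c'. \<not> tm_step M c c')"

definition tape_word :: "bool list \<Rightarrow> int \<Rightarrow> nat" where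
  "tape_word x i =
     (if 0 \<le> i \<and> i < int (length x) then (if x ! nat i then 2 else 1) else 0)"

definition init_config :: "nat \<Rightarrow> bool list \<Rightarrow> config" where
  "init_config k x = (0, (tape_word x, 0) # replicate (k - 1) (\<lambda>_. 0, 0))"

section \<open>NP-hardness\<close>

text \<open>
  A language is in NP if it is decided by a nondeterministic machine all of whose
  computations are polynomially bounded; acceptance means halting in state 1.
\<close>

definition in_NP :: "bool list set \<Rightarrow> bool" where
  "in_NP L \<longleftrightarrow>
     (\<exists>k M (p :: nat poly). wf_tm k M \<and>
        (\<forall>x m c. (tm_step M ^^ m) (init_config k x) c \<longrightarrow> m \<le> poly p (length x)) \<and>
        (\<forall>x. x \<in> L \<longleftrightarrow>
           (\<exists>m c. (tm_step M ^^ m) (init_config k x) c \<and> halted M c \<and> fst c = 1)))"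

definition poly_time_computable :: "(bool list \<Rightarrow> bool list) \<Rightarrow> bool" where
  "poly_time_computable f \<longleftrightarrow>
     (\<exists>k M (p :: nat poly). wf_tm k M \<and> deterministic M \<and>
        (\<forall>x. \<exists>m c. m \<le> poly p (length x) \<and> (tm_step M ^^ m) (init_config k x) c \<and>
               halted M c \<and> fst (hd (snd c)) = tape_word (f x)))"

definition poly_reducible :: "bool list set \<Rightarrow> bool list set \<Rightarrow> bool" where
  "poly_reducible A B \<longleftrightarrow> (\<exists>f. poly_time_computable f \<and> (\<forall>x. x \<in> A \<longleftrightarrow> f x \<in> B))"

definition NP_hard :: "bool list set \<Rightarrow> bool" where
  "NP_hard B \<longleftrightarrow> (\<forall>A. in_NP A \<longrightarrow> poly_reducible A B)"

section \<open>Minimisation problems\<close>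

record ('i, 's) minimisation_problem =
  instances :: "'i set"
  feasible :: "'i \<Rightarrow> 's set"
  cost :: "'i \<Rightarrow> 's \<Rightarrow> nat"

text \<open>
  Numbers are written in unary. All numbers occurring below are bounded by the size of the
  graph, so up to polynomial time this is equivalent to binary (and hardness for unary input
  implies hardness for binary input).
\<close>

definition encode_nat :: "nat \<Rightarrow> bool list" where
  "encode_nat n = replicate n True @ [False]"

definition encode_list :: "('a \<Rightarrow> bool list) \<Rightarrow> 'a list \<Rightarrow> bool list" where
  "encode_list enc xs = encode_nat (length xs) @ concat (map enc xs)"

definition threshold_language ::
    "('i \<Rightarrow> bool list) \<Rightarrow> ('i, 's) minimisation_problem \<Rightarrow> bool list set" where
  "threshold_language enc P =
     {enc i @ encode_nat k | i k. i \<in> instances P \<and> (\<exists>s \<in> feasible P i. cost P i s \<le> k)}"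

text \<open>
  As usual, NP-hardness of a minimisation problem means NP-hardness of deciding, given an
  instance and a threshold, whether the minimum is at most the threshold.
\<close>

definition NP_hard_minimisation ::
    "('i \<Rightarrow> bool list) \<Rightarrow> ('i, 's) minimisation_problem \<Rightarrow> bool" where
  "NP_hard_minimisation enc P \<longleftrightarrow> NP_hard (threshold_language enc P)"

section \<open>Recursive trees and fair bisections\<close>

definition simple_graph :: "'v set \<Rightarrow> 'v set set \<Rightarrow> bool" where
  "simple_graph V E \<longleftrightarrow> finite V \<and> (\<forall>e \<in> E. \<exists>u \<in> V. \<exists>v \<in> V. u \<noteq> v \<and> e = {u, v})"

definition graph_path :: "'v set \<Rightarrow> 'v set set \<Rightarrow> 'v list \<Rightarrow> bool" where
  "graph_path V E p \<longleftrightarrow>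
     p \<noteq> [] \<and> distinct p \<and> set p \<subseteq> V \<and> successively (\<lambda>u v. {u, v} \<in> E) p"

definition graph_connected :: "'v set \<Rightarrow> 'v set set \<Rightarrow> bool" where
  "graph_connected V E \<longleftrightarrow>
     V \<noteq> {} \<and> (\<forall>u \<in> V. \<forall>v \<in> V. \<exists>p. graph_path V E p \<and> hd p = u \<and> last p = v)"

definition graph_cycle :: "'v set \<Rightarrow> 'v set set \<Rightarrow> 'v list \<Rightarrow> bool" where
  "graph_cycle V E p \<longleftrightarrow> graph_path V E p \<and> 3 \<le> length p \<and> {last p, hd p} \<in> E"

definition graph_tree :: "'v set \<Rightarrow> 'v set set \<Rightarrow> bool" where
  "graph_tree V E \<longleftrightarrow>
     simple_graph V E \<and> graph_connected V E \<and> (\<forall>p. \<not> graph_cycle V E p)"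

text \<open>
  The closest root to a node is the end of a shortest path from the node to a root
  (a node with label 1); as the graph is a tree, it determines the path.
\<close>

definition path_to_closest_root ::
    "'v set \<Rightarrow> 'v set set \<Rightarrow> ('v \<Rightarrow> nat) \<Rightarrow> 'v list \<Rightarrow> bool" where
  "path_to_closest_root V E lab p \<longleftrightarrow>
     graph_path V E p \<and> lab (last p) = 1 \<and>
     (\<forall>q. graph_path V E q \<and> hd q = hd p \<and> lab (last q) = 1 \<longrightarrow> length p \<le> length q)"

definition recursive_tree ::
    "nat \<Rightarrow> 'v set \<Rightarrow> 'v set set \<Rightarrow> ('v \<Rightarrow> nat) \<Rightarrow> bool" where
  "recursive_tree n V E lab \<longleftrightarrow>
     graph_tree V E \<and> card V = 2 * n \<and> lab ` V \<subseteq> {1..n} \<and>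
     (\<forall>i \<in> {1..n}. card {v \<in> V. lab v = i} = 2) \<and>
     {v \<in> V. lab v = 1} \<in> E \<and>
     (\<forall>p. path_to_closest_root V E lab p \<longrightarrow> sorted_wrt (>) (map lab p))"

definition fair_bisection :: "'v set \<Rightarrow> ('v \<Rightarrow> nat) \<Rightarrow> 'v set \<times> 'v set \<Rightarrow> bool" where
  "fair_bisection V lab = (\<lambda>(A, B).
     A \<union> B = V \<and> A \<inter> B = {} \<and> inj_on lab A \<and> inj_on lab B)"

definition cut_edges :: "'v set set \<Rightarrow> 'v set \<times> 'v set \<Rightarrow> 'v set set" where
  "cut_edges E = (\<lambda>(A, B). {e \<in> E. e \<inter> A \<noteq> {} \<and> e \<inter> B \<noteq> {}})"

text \<open>
  A concrete labelled graph: the nodes are the positions of the list of labels, and the edges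
  are listed.
\<close>

type_synonym labelled_graph = "nat list \<times> (nat \<times> nat) list"

definition nodes :: "labelled_graph \<Rightarrow> nat set" where
  "nodes g = {..<length (fst g)}"

definition label :: "labelled_graph \<Rightarrow> nat \<Rightarrow> nat" where
  "label g v = fst g ! v"

definition edges :: "labelled_graph \<Rightarrow> nat set set" where
  "edges g = (\<lambda>(u, v). {u, v}) ` set (snd g)"

definition no_repeated_edge :: "labelled_graph \<Rightarrow> bool" where
  "no_repeated_edge g \<longleftrightarrow> distinct (map (\<lambda>(u, v). {u, v}) (snd g))"

definition encode_graph :: "labelled_graph \<Rightarrow> bool list" where
  "encode_graph g =
     encode_list encode_nat (fst g) @
     encode_list (\<lambda>(u, v). encode_nat u @ encode_nat v) (snd g)"

definition min_fair_bisection_recursive_trees ::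
    "(labelled_graph, nat set \<times> nat set) minimisation_problem" where
  "min_fair_bisection_recursive_trees =
     \<lparr> instances = {g. no_repeated_edge g \<and>
                      (\<exists>n. recursive_tree n (nodes g) (edges g) (label g))},
       feasible = (\<lambda>g. {S. fair_bisection (nodes g) (label g) S}),
       cost = (\<lambda>g S. card (cut_edges (edges g) S)) \<rparr>"

text \<open>The encoding loses no information, also when followed by a threshold.\<close>

lemma encode_nat_append_inject:
  "encode_nat m @ xs = encode_nat n @ ys \<longleftrightarrow> m = n \<and> xs = ys"
proof (induction m arbitrary: n)
  case 0
  then show ?case by (cases n) (auto simp: encode_nat_def)
next
  case (Suc m)
  then show ?case by (cases n) (auto simp: encode_nat_def)
qed

lemma encode_list_append_inject:
  assumes enc: "\<And>a b us vs. enc a @ us = enc b @ vs \<longleftrightarrow> a = b \<and> us = vs"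
  shows "encode_list enc as @ xs = encode_list enc bs @ ys \<longleftrightarrow> as = bs \<and> xs = ys"
proof -
  have "length as = length bs \<Longrightarrow>
      concat (map enc as) @ xs = concat (map enc bs) @ ys \<longleftrightarrow> as = bs \<and> xs = ys"
    by (induction as bs rule: list_induct2) (auto simp: enc)
  then show ?thesis
    by (auto simp: encode_list_def encode_nat_append_inject)
qed

lemma encode_graph_append_inject:
  "encode_graph g @ xs = encode_graph h @ ys \<longleftrightarrow> g = h \<and> xs = ys"
proof -
  have pair: "(case a of (u, v) \<Rightarrow> encode_nat u @ encode_nat v) @ us =
      (case b of (u, v) \<Rightarrow> encode_nat u @ encode_nat v) @ vs \<longleftrightarrow> a = b \<and> us = vs" for a b us vs
    by (cases a; cases b) (auto simp: encode_nat_append_inject)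
  show ?thesis
    by (cases g; cases h)
      (auto simp: encode_graph_def encode_list_append_inject[OF encode_nat_append_inject]
        encode_list_append_inject[OF pair])
qed

end

theory Submission
  imports Defs
begin

text \<open>
  In a fair bisection each label decides which of its two nodes lies on the side of node 0, so
  it is a Boolean variable. A label whose nodes both hang below node 0 always costs 1 and is a
  free variable, while a label whose nodes hang below the nodes \<open>u\<close> and \<open>v\<close> costs at least 1
  if \<open>u\<close> and \<open>v\<close> lie on the same side and can be chosen at no cost otherwise. Recursive trees
  thus express the minimum number of violated constraints \<open>u \<noteq> v\<close> between literals, and three
  such constraints express that three literals are not all equal, hence 3-clauses. The clauses
  come from the tableau of a nondeterministic machine, whose tapes are written relative to
  their heads, so that a step is a choice of one of finitely many rules and a shift. A
  deterministic machine prints the tree by nested loops over counters of polynomial size.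
\<close>

section \<open>Recursive trees from parent functions\<close>

text \<open>A label has only two nodes, each with one parent edge, so it can state one constraint
  about earlier nodes; but a node may have any number of children, which lets one variable occur in
  many clauses. Inequalities between literals are invariant under negating everything, hence the
  constants: node 0 is true by convention, node 1 is false. Among three Boolean values exactly one
  pair agrees if they are not all equal, and all three pairs agree otherwise. With m variables and q
  clauses the unavoidable cost is 1 + m for the root label and the variables, and 3 per clause: 1
  for its variable \<open>d\<close> and 1 for each of its two triples. The threshold 1 + m + 3q is
  exactly this minimum. The encoding shapes the second half: list lengths are printed ahead of the
  lists, and the nodes of a gadget are numbered by the index of its clause. These numbers must be
  arithmetic expressions in the input length and the loop counters, so loop bounds depend on the
  input length alone, and both branches of a test list equally many clauses.\<close>

locale parent_tree =
  fixes N :: nat and par :: "nat \<Rightarrow> nat"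
  assumes N_pos: "0 < N"
    and par_1: "par 1 = 0"
    and par_div2: "\<And>u. 2 \<le> u \<Longrightarrow> u < 2 * N \<Longrightarrow> par u div 2 < u div 2"
begin

text \<open>Label i + 1 is carried by the nodes 2i and 2i + 1, so \<open>par_div2\<close> says that
  labels strictly decrease towards the root edge {1, 0}; node 0 has no parent edge.\<close>

definition E where "E = (\<lambda>u. {u, par u}) ` {1..<2 * N}"

lemma par_less: "1 \<le> u \<Longrightarrow> u < 2 * N \<Longrightarrow> par u < u"
proof (cases "u = 1")
  case False
  assume "1 \<le> u" "u < 2 * N"
  with False par_div2[of u] have "par u div 2 < u div 2" by simp
  then show ?thesis by (meson div_le_mono linorder_not_less)
qed (use par_1 in simp)

text \<open>Since parents are smaller, an edge belongs to its larger end. This turns adjacency into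
  an equation for \<open>par\<close> in the arguments about cycles and paths.\<close>

lemma edge_iff: "v < u \<Longrightarrow> {u, v} \<in> E \<longleftrightarrow> 1 \<le> u \<and> u < 2 * N \<and> v = par u"
  using par_less by (force simp: E_def doubleton_eq_iff)

lemma inj_on_edge: "inj_on (\<lambda>u. {u, par u}) {1..<2 * N}"
proof (rule inj_onI)
  fix u v assume "u \<in> {1..<2 * N}" "v \<in> {1..<2 * N}" "{u, par u} = {v, par v}"
  with par_less[of u] par_less[of v] show "u = v" by (auto simp: doubleton_eq_iff)
qed

lemma simple: "simple_graph {..<2 * N} E"
proof -
  have "\<exists>a\<in>{..<2 * N}. \<exists>b\<in>{..<2 * N}. a \<noteq> b \<and> {u, par u} = {a, b}"
    if "u \<in> {1..<2 * N}" for u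
    using that par_less[of u] by (intro bexI[of _ u] bexI[of _ "par u"]) auto
  then show ?thesis by (auto simp: simple_graph_def E_def)
qed

lemma path_Cons:
  assumes "graph_path {..<n} E p" "{n, hd p} \<in> E"
  shows "graph_path {..<Suc n} E (n # p)"
  using assms by (cases p) (auto simp: graph_path_def)

lemma path_snoc:
  assumes "graph_path {..<n} E p" "{n, last p} \<in> E"
  shows "graph_path {..<Suc n} E (p @ [n])"
  using assms by (auto simp: graph_path_def successively_append_iff insert_commute)

lemma path_mono: "graph_path {..<n} E p \<Longrightarrow> graph_path {..<Suc n} E p"
  by (force simp: graph_path_def)

lemma prefix_connected:
  "1 \<le> n \<Longrightarrow> n \<le> 2 * N \<Longrightarrow> graph_connected {..<n} E"
proof (induction n)
  case (Suc n)
  show ?case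
  proof (cases "n = 0")
    case True
    then have "graph_path {..<Suc n} E [0]" by (simp add: graph_path_def)
    then show ?thesis using True unfolding graph_connected_def
      by (metis empty_iff last.simps lessThan_Suc lessThan_0 list.sel(1) singletonD insert_not_empty)
  next
    case False
    then have conn: "\<exists>p. graph_path {..<n} E p \<and> hd p = u \<and> last p = v"
      if "u < n" "v < n" for u v
      using Suc that by (simp add: graph_connected_def)
    have less: "par n < n" and edge: "{n, par n} \<in> E"
      using False Suc.prems par_less[of n] edge_iff[of "par n" n] by auto
    have "\<exists>p. graph_path {..<Suc n} E p \<and> hd p = u \<and> last p = v"
      if uv: "u < Suc n" "v < Suc n" for u v
    proof -
      consider "u < n" "v < n" | "u = n" "v < n" | "u < n" "v = n" | "u = n" "v = n"
        using uv by linarith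
      then show ?thesis
      proof cases
        case 1
        then show ?thesis using conn path_mono by blast
      next
        case 2
        then obtain p where "graph_path {..<n} E p" "hd p = par n" "last p = v"
          using conn less by blast
        then show ?thesis using 2 path_Cons[of n p] edge
          by (intro exI[of _ "n # p"]) (auto simp: graph_path_def)
      next
        case 3
        then obtain p where "graph_path {..<n} E p" "last p = par n" "hd p = u"
          using conn less by blast
        then show ?thesis using 3 path_snoc[of n p] edge
          by (intro exI[of _ "p @ [n]"]) (auto simp: graph_path_def)
      next
        case 4
        then show ?thesis by (intro exI[of _ "[n]"]) (auto simp: graph_path_def)
      qed
    qed
    then show ?thesis by (auto simp: graph_connected_def)
  qed
qed simp

text \<open>The largest node of a cycle would have two distinct smaller neighbours.\<close>

lemma acyclic: "\<not> graph_cycle {..<2 * N} E p"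
proof
  assume c: "graph_cycle {..<2 * N} E p"
  then have len: "3 \<le> length p" and dist: "distinct p" and closing: "{last p, hd p} \<in> E"
    and succ: "\<And>i. Suc i < length p \<Longrightarrow> {p ! i, p ! Suc i} \<in> E"
    by (auto simp: graph_cycle_def graph_path_def successively_conv_nth)
  define m where "m = Max (set p)"
  have ne: "set p \<noteq> {}" using len by auto
  then have "m \<in> set p" by (simp add: m_def)
  then obtain i where i: "i < length p" "p ! i = m" by (metis in_set_conv_nth)
  have small: "p ! j < m" if "j < length p" "j \<noteq> i" for j
  proof -
    have "p ! j \<le> m" using that by (simp add: m_def)
    moreover have "p ! j \<noteq> m" using dist that i nth_eq_iff_index_eq by metis
    ultimately show ?thesis by simp
  qed
  have adj: "p ! j = par m" if "j < length p" "j \<noteq> i" "{m, p ! j} \<in> E" for j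
    using edge_iff[of "p ! j" m] small[OF that(1,2)] that(3) by simp
  \<comment> \<open>Cyclic predecessor and successor of the position of the maximum; they differ
    because a cycle has at least three nodes.\<close>
  define a where "a = (if i = 0 then length p - 1 else i - 1)"
  define b where "b = (if Suc i = length p then 0 else Suc i)"
  have hd: "hd p = p ! 0" and last: "last p = p ! (length p - 1)"
    using len hd_conv_nth[of p] last_conv_nth[of p] by fastforce+
  have "{m, p ! a} \<in> E"
    using closing succ[of "i - 1"] i hd last by (auto simp: a_def insert_commute)
  moreover have "{m, p ! b} \<in> E"
  proof (cases "Suc i = length p")
    case True
    then have "m = last p" using i last by (metis diff_Suc_1)
    then show ?thesis using closing hd True by (simp add: b_def)
  qed (use succ[of i] i in \<open>simp add: b_def\<close>)
  moreover have "a < length p" "b < length p" "a \<noteq> i" "b \<noteq> i" "a \<noteq> b"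
    using i len by (auto simp: a_def b_def)
  ultimately show False using adj dist nth_eq_iff_index_eq by metis
qed

lemma card_label: "i \<in> {1..N} \<Longrightarrow> {v \<in> {..<2 * N}. v div 2 + 1 = i} = {2 * (i - 1), 2 * (i - 1) + 1}"
  by auto

text \<open>The second conjunct strengthens the induction: the path follows parents. It cannot go
  from u to a child v, because v \<ge> 2 is not the end of the path, which then continues by
  induction with \<open>par v\<close> = u, a repetition.\<close>

lemma decreasing_path:
  assumes "distinct p" "set p \<subseteq> {..<2 * N}" "successively (\<lambda>u v. {u, v} \<in> E) p"
    "p \<noteq> []" "last p < 2" "\<And>v. v \<in> set (butlast p) \<Longrightarrow> 2 \<le> v"
  shows "sorted_wrt (>) (map (\<lambda>u. u div 2 + 1) p) \<and>
    (tl p \<noteq> [] \<longrightarrow> hd (tl p) = par (hd p))"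
  using assms
proof (induction p)
  case (Cons u p)
  show ?case
  proof (cases p)
    case (Cons v q)
    have u: "2 \<le> u" "u < 2 * N" and v: "v < 2 * N" and "u \<noteq> v" and e: "{u, v} \<in> E"
      using Cons.prems Cons by auto
    have IH: "sorted_wrt (>) (map (\<lambda>u. u div 2 + 1) p)" "tl p \<noteq> [] \<Longrightarrow> hd (tl p) = par (hd p)"
      using Cons.IH Cons.prems Cons by auto
    have vpar: "v = par u"
    proof (rule ccontr)
      assume ne: "v \<noteq> par u"
      then have uv: "u < v" using edge_iff[of v u] \<open>u \<noteq> v\<close> e by (metis linorder_neqE_nat)
      then have upar: "u = par v" using edge_iff[of u v] e by (simp add: insert_commute)
      have "2 \<le> v" using u uv by simp
      then have "q \<noteq> []" using Cons.prems Cons by auto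
      then have "hd q = u" using IH(2) Cons upar by simp
      then show False using \<open>q \<noteq> []\<close> Cons.prems Cons by auto
    qed
    have "v div 2 < u div 2" using par_div2 u vpar by simp
    then show ?thesis using IH(1) Cons vpar by auto
  qed simp
qed simp

lemma recursive_tree: "recursive_tree N {..<2 * N} E (\<lambda>u. u div 2 + 1)"
proof -
  have "graph_tree {..<2 * N} E"
    using simple prefix_connected[of "2 * N"] acyclic N_pos by (simp add: graph_tree_def)
  moreover have "card {v \<in> {..<2 * N}. v div 2 + 1 = i} = 2" if "i \<in> {1..N}" for i
    unfolding card_label[OF that] by simp
  moreover have "{v \<in> {..<2 * N}. v div 2 + 1 = 1} \<in> E"
  proof -
    have "{v \<in> {..<2 * N}. v div 2 + 1 = 1} = {1, 0}" using card_label[of 1] N_pos by auto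
    then show ?thesis using edge_iff[of 0 1] N_pos par_1 by simp
  qed
  moreover have "sorted_wrt (>) (map (\<lambda>u. u div 2 + 1) p)"
    if p: "path_to_closest_root {..<2 * N} E (\<lambda>u. u div 2 + 1) p" for p
  proof (rule conjunct1[OF decreasing_path])
    show "distinct p" "set p \<subseteq> {..<2 * N}" "successively (\<lambda>u v. {u, v} \<in> E) p" "p \<noteq> []" "last p < 2"
      using p by (auto simp: path_to_closest_root_def graph_path_def)
    fix v assume v: "v \<in> set (butlast p)"
    show "2 \<le> v"
    proof (rule ccontr)
      assume "\<not> 2 \<le> v"
      \<comment> \<open>A node below 2 is a root, so cutting the path there gives a shorter path to
        a root.\<close>
      from v obtain p1 p2 where "butlast p = p1 @ v # p2" by (meson split_list)
      then have "p = p1 @ v # p2 @ [last p]"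
        using append_butlast_last_id[of p] \<open>p \<noteq> []\<close> by simp
      then obtain r where eq: "p = p1 @ v # r" "r \<noteq> []" by blast
      have "graph_path {..<2 * N} E (p1 @ [v])"
        using p unfolding path_to_closest_root_def graph_path_def eq(1)
        by (auto simp: successively_append_iff)
      moreover have "hd (p1 @ [v]) = hd p" using eq(1) by (cases p1) auto
      moreover have "last (p1 @ [v]) div 2 + 1 = 1" using \<open>\<not> 2 \<le> v\<close> by simp
      ultimately have "length p \<le> length (p1 @ [v])"
        using p unfolding path_to_closest_root_def by blast
      moreover have "length p > length (p1 @ [v])" using eq by simp
      ultimately show False by simp
    qed
  qed
  ultimately show ?thesis by (auto simp: recursive_tree_def)
qed

section \<open>Cut size as the number of polarity changes along parent edges\<close>

definition "polarity_cost \<alpha> = card {u \<in> {1..<2 * N}. \<alpha> u \<noteq> (\<alpha> (par u) :: bool)}"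

lemma cut_cost:
  assumes "A \<union> B = {..<2 * N}" "A \<inter> B = {}"
    and \<alpha>: "\<And>u. u < 2 * N \<Longrightarrow> \<alpha> u \<longleftrightarrow> (u \<in> A \<longleftrightarrow> 0 \<in> A)"
  shows "card (cut_edges E (A, B)) = polarity_cost \<alpha>"
proof -
  have "{u, par u} \<inter> A \<noteq> {} \<and> {u, par u} \<inter> B \<noteq> {} \<longleftrightarrow> \<alpha> u \<noteq> \<alpha> (par u)"
    if u: "u \<in> {1..<2 * N}" for u
  proof -
    have 1: "u < 2 * N" "par u < 2 * N" using u par_less[of u] by auto
    moreover have "w \<in> B \<longleftrightarrow> w \<notin> A" if "w < 2 * N" for w using assms(1,2) that by blast
    ultimately show ?thesis using \<alpha>[OF 1(1)] \<alpha>[OF 1(2)] by auto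
  qed
  then have "{u \<in> {1..<2 * N}. {u, par u} \<inter> A \<noteq> {} \<and> {u, par u} \<inter> B \<noteq> {}} =
      {u \<in> {1..<2 * N}. \<alpha> u \<noteq> \<alpha> (par u)}" by blast
  moreover have "cut_edges E (A, B) =
      (\<lambda>u. {u, par u}) ` {u \<in> {1..<2 * N}. {u, par u} \<inter> A \<noteq> {} \<and> {u, par u} \<inter> B \<noteq> {}}"
    unfolding cut_edges_def E_def by blast
  ultimately have "cut_edges E (A, B) = (\<lambda>u. {u, par u}) ` {u \<in> {1..<2 * N}. \<alpha> u \<noteq> \<alpha> (par u)}"
    by simp
  moreover have "inj_on (\<lambda>u. {u, par u}) {u \<in> {1..<2 * N}. \<alpha> u \<noteq> \<alpha> (par u)}"
    by (rule inj_on_subset[OF inj_on_edge]) auto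
  ultimately show ?thesis by (simp add: card_image polarity_cost_def)
qed

lemma fair_polarity:
  assumes "fair_bisection {..<2 * N} (\<lambda>u. u div 2 + 1) (A, B)" and "w < N"
  shows "2 * w + 1 \<in> A \<longleftrightarrow> 2 * w \<notin> A"
proof -
  have "A \<union> B = {..<2 * N}" and inj: "inj_on (\<lambda>u. u div 2 + 1) A" "inj_on (\<lambda>u. u div 2 + 1) B"
    using assms(1) by (auto simp: fair_bisection_def)
  then have mem: "2 * w \<in> A \<or> 2 * w \<in> B" "2 * w + 1 \<in> A \<or> 2 * w + 1 \<in> B"
    using assms(2) by (auto simp: set_eq_iff)
  show ?thesis
    using mem inj_onD[OF inj(1), of "2 * w" "2 * w + 1"] inj_onD[OF inj(2), of "2 * w" "2 * w + 1"]
      assms(1) by (auto simp: fair_bisection_def)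
qed

text \<open>Read \<open>\<alpha> u\<close> as: u lies on the side of node 0. Fairness says exactly
  that the two nodes of a label get opposite values, and \<open>\<alpha> 0\<close> fixes which side
  counts as true.\<close>

lemma min_cut_iff:
  "(\<exists>S. fair_bisection {..<2 * N} (\<lambda>u. u div 2 + 1) S \<and> card (cut_edges E S) \<le> k) \<longleftrightarrow>
   (\<exists>\<alpha>. \<alpha> 0 \<and> (\<forall>w<N. \<alpha> (2 * w + 1) = (\<not> \<alpha> (2 * w))) \<and> polarity_cost \<alpha> \<le> k)"
proof
  assume "\<exists>S. fair_bisection {..<2 * N} (\<lambda>u. u div 2 + 1) S \<and> card (cut_edges E S) \<le> k"
  then obtain A B where S: "fair_bisection {..<2 * N} (\<lambda>u. u div 2 + 1) (A, B)"
    "card (cut_edges E (A, B)) \<le> k" by auto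
  let ?\<alpha> = "\<lambda>u. u \<in> A \<longleftrightarrow> 0 \<in> A"
  have "polarity_cost ?\<alpha> \<le> k"
    using S cut_cost[of A B ?\<alpha>] by (simp add: fair_bisection_def)
  then show "\<exists>\<alpha>. \<alpha> 0 \<and> (\<forall>w<N. \<alpha> (2 * w + 1) = (\<not> \<alpha> (2 * w))) \<and> polarity_cost \<alpha> \<le> k"
    using fair_polarity[OF S(1)] by (intro exI[of _ ?\<alpha>]) auto
next
  assume "\<exists>\<alpha>. \<alpha> 0 \<and> (\<forall>w<N. \<alpha> (2 * w + 1) = (\<not> \<alpha> (2 * w))) \<and> polarity_cost \<alpha> \<le> k"
  then obtain \<alpha> where \<alpha>: "\<alpha> 0" "\<And>w. w < N \<Longrightarrow> \<alpha> (2 * w + 1) = (\<not> \<alpha> (2 * w))"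
    "polarity_cost \<alpha> \<le> k" by blast
  let ?A = "{u. u < 2 * N \<and> \<alpha> u}" and ?B = "{u. u < 2 * N \<and> \<not> \<alpha> u}"
  have same: "u = v" if "u < 2 * N" "v < 2 * N" "u div 2 = v div 2" "\<alpha> u = \<alpha> v" for u v
  proof (rule ccontr)
    assume "u \<noteq> v"
    with that(3) have "u = 2 * (u div 2) + 1 \<and> v = 2 * (u div 2) \<or> v = 2 * (u div 2) + 1 \<and> u = 2 * (u div 2)"
      by presburger
    moreover have "u div 2 < N" using that(1) by simp
    ultimately show False using \<alpha>(2)[of "u div 2"] that(4) by metis
  qed
  have "fair_bisection {..<2 * N} (\<lambda>u. u div 2 + 1) (?A, ?B)"
    unfolding fair_bisection_def inj_on_def using same by auto
  moreover have "card (cut_edges E (?A, ?B)) = polarity_cost \<alpha>"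
    by (rule cut_cost) (use \<alpha>(1) in auto)
  ultimately show "\<exists>S. fair_bisection {..<2 * N} (\<lambda>u. u div 2 + 1) S \<and> card (cut_edges E S) \<le> k"
    using \<alpha>(3) by (intro exI[of _ "(?A, ?B)"]) simp
qed

end

section \<open>Clauses as trees\<close>

type_synonym clause = "nat \<times> nat \<times> nat"

text \<open>
  Literals are nodes of the tree: 0 is true, 1 is false, and for \<open>w \<ge> 1\<close> the nodes \<open>2 * w\<close> and
  \<open>2 * w + 1\<close> are a variable and its negation.
\<close>

definition satisfiable :: "nat \<Rightarrow> clause list \<Rightarrow> bool" where
  "satisfiable m cls \<longleftrightarrow> (\<exists>\<beta>. \<beta> 0 \<and> (\<forall>w\<le>m. \<beta> (2 * w + 1) = (\<not> \<beta> (2 * w))) \<and>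
     (\<forall>(a, b, c) \<in> set cls. \<beta> a \<or> \<beta> b \<or> \<beta> c))"

text \<open>
  A clause \<open>a \<or> b \<or> c\<close> holds iff for some \<open>d\<close> neither \<open>a, b, d\<close> nor \<open>\<not> d, c, False\<close> are all equal.
  Each of the six pairs below is the pair of parents of the two nodes of a fresh label. As
  these two nodes lie on different sides, the cheaper choice cuts no edge if the parents lie
  on different sides, and one edge otherwise. So each of the two triples costs at least 1.
\<close>

fun gadget :: "nat \<Rightarrow> clause \<Rightarrow> nat list" where
  "gadget d (a, b, c) = [a, b, b, d, a, d, Suc d, c, c, 1, Suc d, 1]"

text \<open>Node layout: the roots, then m labels for the variables and one label \<open>d\<close>
  per clause, all hanging below node 0, then 12 consecutive nodes per clause with the parents listed
  by \<open>gadget\<close>. All variables precede all gadgets, so the parents in a gadget have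
  smaller labels.\<close>

definition clause_parent :: "nat \<Rightarrow> clause list \<Rightarrow> nat \<Rightarrow> nat" where
  "clause_parent m cls u =
     (let i = u - (2 + 2 * (m + length cls)) in
      if u < 2 + 2 * (m + length cls) then 0
      else gadget (2 * (m + i div 12 + 1)) (cls ! (i div 12)) ! (i mod 12))"

text \<open>The 7 labels of a clause are its variable \<open>d\<close> and six pairs; the leading 1
  is the root label.\<close>

definition num_labels :: "nat \<Rightarrow> clause list \<Rightarrow> nat" where
  "num_labels m cls = 1 + m + 7 * length cls"

definition bounded_clauses :: "nat \<Rightarrow> clause list \<Rightarrow> bool" where
  "bounded_clauses m cls \<longleftrightarrow>
     (\<forall>(a, b, c) \<in> set cls. a < 2 * (m + 1) \<and> b < 2 * (m + 1) \<and> c < 2 * (m + 1))"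

lemma length_gadget [simp]: "length (gadget d t) = 12"
  by (cases t) simp

lemma clause_parent_gadget:
  "r < 12 \<Longrightarrow> clause_parent m cls (2 + 2 * (m + length cls) + (12 * k + r)) =
     gadget (2 * (m + k + 1)) (cls ! k) ! r"
  by (simp add: clause_parent_def Let_def)

lemma all_less_12:
  "(\<forall>r<(12::nat). P r) \<longleftrightarrow> P 0 \<and> P 1 \<and> P 2 \<and> P 3 \<and> P 4 \<and> P 5 \<and> P 6 \<and> P 7 \<and> P 8 \<and> P 9 \<and> P 10 \<and> P 11"
  by (simp add: numeral_eq_Suc All_less_Suc2)

lemma gadget_bound:
  assumes "bounded_clauses m cls" "k < length cls" "r < 12"
  shows "gadget (2 * (m + k + 1)) (cls ! k) ! r < 2 + 2 * (m + length cls)"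
proof -
  obtain a b c where t: "cls ! k = (a, b, c)" by (cases "cls ! k") auto
  have "(a, b, c) \<in> set cls" using assms(2) t nth_mem by metis
  then have bd: "a < 2 * (m + 1)" "b < 2 * (m + 1)" "c < 2 * (m + 1)"
    using assms(1) by (auto simp: bounded_clauses_def)
  have "\<forall>r<12. gadget (2 * (m + k + 1)) (cls ! k) ! r < 2 + 2 * (m + length cls)"
    unfolding all_less_12 using assms(2) bd t by simp
  then show ?thesis using assms(3) by blast
qed

lemma clause_parent_bound:
  assumes "bounded_clauses m cls" "u < 2 * num_labels m cls"
  shows "clause_parent m cls u < 2 + 2 * (m + length cls)"
proof (cases "u < 2 + 2 * (m + length cls)")
  case False
  define i where "i = u - (2 + 2 * (m + length cls))"
  have "i < 12 * length cls" using False assms(2) by (simp add: i_def num_labels_def)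
  then have "i div 12 < length cls" "i mod 12 < 12" by (auto simp: less_mult_imp_div_less mult.commute)
  from gadget_bound[OF assms(1) this]
  show ?thesis using False by (simp add: clause_parent_def Let_def i_def)
qed (simp add: clause_parent_def)

lemma parent_tree_clauses:
  assumes "bounded_clauses m cls"
  shows "parent_tree (num_labels m cls) (clause_parent m cls)"
proof
  fix u assume u: "2 \<le> u" "u < 2 * num_labels m cls"
  show "clause_parent m cls u div 2 < u div 2"
  proof (cases "u < 2 + 2 * (m + length cls)")
    case False
    then have "1 + m + length cls \<le> u div 2" by simp
    moreover have "clause_parent m cls u div 2 < 1 + m + length cls"
      using clause_parent_bound[OF assms u(2)] by simp
    ultimately show ?thesis by simp
  qed (use u in \<open>simp add: clause_parent_def\<close>)
qed (simp_all add: num_labels_def clause_parent_def)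

section \<open>The cost of a polarity, split into variables and clauses\<close>

definition clause_cost :: "nat \<Rightarrow> clause list \<Rightarrow> (nat \<Rightarrow> bool) \<Rightarrow> nat \<Rightarrow> nat" where
  "clause_cost m cls \<alpha> k = (\<Sum>r<12. of_bool (\<alpha> (2 + 2 * (m + length cls) + (12 * k + r)) \<noteq>
      \<alpha> (gadget (2 * (m + k + 1)) (cls ! k) ! r)))"

lemma sum_pairs: "(\<Sum>u<2 * n. f u) = (\<Sum>w<n. f (2 * w) + f (2 * w + 1 :: nat) :: nat)"
  by (induction n) auto

lemma sum_shift:
  fixes f :: "nat \<Rightarrow> nat"
  shows "(\<Sum>i\<in>{a..<a + n}. f i) = (\<Sum>i<n. f (a + i))"
  by (induction n) auto

lemma sum_groups:
  fixes f :: "nat \<Rightarrow> nat"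
  shows "(\<Sum>i<k * n. f i) = (\<Sum>j<k. \<Sum>r<n. f (n * j + r))"
proof (induction k)
  case (Suc k)
  have "(\<Sum>i<k * n + n. f i) = (\<Sum>i<k * n. f i) + (\<Sum>i\<in>{k * n..<k * n + n}. f i)"
    using sum.atLeastLessThan_concat[of 0 "k * n" "k * n + n" f] by (simp add: lessThan_atLeast0)
  then show ?case using Suc by (simp add: sum_shift) (simp add: mult.commute add.commute)
qed simp

text \<open>A parent edge to node 0 is cut iff the child is false, so each label below node 0
  contributes exactly 1 for every choice, and so does the root label.\<close>

lemma polarity_cost_clauses:
  assumes "bounded_clauses m cls" and "\<alpha> 0"
    and neg: "\<And>w. w < num_labels m cls \<Longrightarrow> \<alpha> (2 * w + 1) = (\<not> \<alpha> (2 * w))"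
  shows "parent_tree.polarity_cost (num_labels m cls) (clause_parent m cls) \<alpha> =
    1 + (m + length cls) + (\<Sum>k<length cls. clause_cost m cls \<alpha> k)"
proof -
  interpret parent_tree "num_labels m cls" "clause_parent m cls"
    by (rule parent_tree_clauses[OF assms(1)])
  let ?M = "m + length cls" and ?N = "num_labels m cls"
  let ?f = "\<lambda>u. of_bool (\<alpha> u \<noteq> \<alpha> (clause_parent m cls u)) :: nat"
  have "polarity_cost \<alpha> = sum ?f {1..<2 * ?N}"
    by (simp add: polarity_cost_def sum.If_cases of_bool_def Int_def conj_commute)
  also have "\<dots> = sum ?f {1..<2 + 2 * ?M} + sum ?f {2 + 2 * ?M..<2 * ?N}"
    by (rule sum.atLeastLessThan_concat[symmetric]) (auto simp: num_labels_def)
  also have "sum ?f {1..<2 + 2 * ?M} = (\<Sum>u<2 * (1 + ?M). of_bool (\<not> \<alpha> u))"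
  proof -
    have "sum ?f {1..<2 + 2 * ?M} = (\<Sum>u\<in>{1..<2 + 2 * ?M}. of_bool (\<not> \<alpha> u))"
      using \<open>\<alpha> 0\<close> by (intro sum.cong) (auto simp: clause_parent_def)
    \<comment> \<open>Node 0 is true and adds 0; it completes the root label to a pair.\<close>
    also have "\<dots> = (\<Sum>u\<in>{0..<2 + 2 * ?M}. of_bool (\<not> \<alpha> u))"
      using \<open>\<alpha> 0\<close> sum.atLeast_Suc_lessThan[of 0 "2 + 2 * ?M" "\<lambda>u. of_bool (\<not> \<alpha> u) :: nat"] by simp
    finally show ?thesis by (simp add: lessThan_atLeast0)
  qed
  also have "\<dots> = (\<Sum>w<1 + ?M. 1)"
    unfolding sum_pairs by (rule sum.cong) (use neg in \<open>auto simp: num_labels_def\<close>)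
  also have "sum ?f {2 + 2 * ?M..<2 * ?N} = (\<Sum>i<length cls * 12. ?f (2 + 2 * ?M + i))"
  proof -
    have "2 * ?N = 2 + 2 * ?M + length cls * 12" by (simp add: num_labels_def)
    then show ?thesis by (simp only: sum_shift)
  qed
  also have "\<dots> = (\<Sum>k<length cls. clause_cost m cls \<alpha> k)"
    unfolding sum_groups clause_cost_def
    by (intro sum.cong refl) (simp only: lessThan_iff clause_parent_gadget)
  finally show ?thesis by simp
qed

lemma sum_12: "(\<Sum>r<(12::nat). f r :: nat) =
   (f 0 + f 1) + (f 2 + f 3) + (f 4 + f 5) + (f 6 + f 7) + (f 8 + f 9) + (f 10 + f 11)"
  by (simp add: numeral_eq_Suc)

text \<open>Here \<open>s r\<close> is the polarity of the even node of the r-th pair. If its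
  parents have the values u and v, the label costs [s \<noteq> u] + [s = v], which is 1 if u = v,
  and 0 or 2 otherwise. Written out, the bounds below become finite case distinctions.\<close>

lemma clause_cost_eq:
  assumes k: "k < length cls" "cls ! k = (a, b, c)" and "\<alpha> 0"
    and neg: "\<And>w. w < num_labels m cls \<Longrightarrow> \<alpha> (2 * w + 1) = (\<not> \<alpha> (2 * w))"
    and s_def: "s = (\<lambda>r. \<alpha> (2 * (1 + m + length cls + 6 * k + r)))" and d_def: "d = \<alpha> (2 * (m + k + 1))"
  shows "clause_cost m cls \<alpha> k =
    (of_bool (s 0 \<noteq> \<alpha> a) + of_bool (s 0 = \<alpha> b)) + (of_bool (s 1 \<noteq> \<alpha> b) + of_bool (s 1 = d)) +
    (of_bool (s 2 \<noteq> \<alpha> a) + of_bool (s 2 = d)) + (of_bool (s 3 = d) + of_bool (s 3 = \<alpha> c)) +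
    (of_bool (s 4 \<noteq> \<alpha> c) + of_bool (\<not> s 4)) + (of_bool (s 5 = d) + of_bool (\<not> s 5))"
proof -
  have 1: "\<not> \<alpha> (Suc 0)" using neg[of 0] \<open>\<alpha> 0\<close> by (simp add: num_labels_def)
  have d: "\<alpha> (Suc (2 * (m + k + 1))) = (\<not> d)"
    using neg[of "m + k + 1"] k by (simp add: num_labels_def d_def)
  have e: "\<alpha> (2 + 2 * (m + length cls) + (12 * k + 2 * r)) = s r" for r
  proof -
    have "2 + 2 * (m + length cls) + (12 * k + 2 * r) = 2 * (1 + m + length cls + 6 * k + r)" by simp
    then show ?thesis unfolding s_def by (rule arg_cong)
  qed
  have o: "\<alpha> (2 + 2 * (m + length cls) + (12 * k + (2 * r + 1))) = (\<not> s r)" if "r < 6" for r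
  proof -
    have "2 + 2 * (m + length cls) + (12 * k + (2 * r + 1)) = 2 * (1 + m + length cls + 6 * k + r) + 1"
      by simp
    then have "\<alpha> (2 + 2 * (m + length cls) + (12 * k + (2 * r + 1))) =
        \<alpha> (2 * (1 + m + length cls + 6 * k + r) + 1)" by (rule arg_cong)
    also have "\<dots> = (\<not> s r)"
      unfolding s_def by (rule neg) (use k that in \<open>simp add: num_labels_def\<close>)
    finally show ?thesis .
  qed
  note eo = e[of 0] e[of 1] e[of 2] e[of 3] e[of 4] e[of 5]
    o[of 0, simplified] o[of 1, simplified] o[of 2, simplified] o[of 3, simplified]
    o[of 4, simplified] o[of 5, simplified]
  show ?thesis
    unfolding clause_cost_def sum_12 k(2)
    using eo 1 d by (simp add: d_def)
qed

text \<open>Every triple has an agreeing pair and costs at least 1. If a, b, c are all false, then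
  for false d the triple a, b, d is constant, and for true d the triple \<not> d, c, False is; a
  constant triple has three agreeing pairs.\<close>

lemma clause_cost_lower:
  assumes "k < length cls" "cls ! k = (a, b, c)" and "\<alpha> 0"
    and "\<And>w. w < num_labels m cls \<Longrightarrow> \<alpha> (2 * w + 1) = (\<not> \<alpha> (2 * w))"
  shows "2 + of_bool (\<not> (\<alpha> a \<or> \<alpha> b \<or> \<alpha> c)) \<le> clause_cost m cls \<alpha> k"
proof -
  define s where "s = (\<lambda>r. \<alpha> (2 * (1 + m + length cls + 6 * k + r)))"
  define d where "d = \<alpha> (2 * (m + k + 1))"
  have "2 + of_bool (\<not> (\<alpha> a \<or> \<alpha> b \<or> \<alpha> c)) \<le>
    (of_bool (s 0 \<noteq> \<alpha> a) + of_bool (s 0 = \<alpha> b)) + (of_bool (s 1 \<noteq> \<alpha> b) + of_bool (s 1 = d)) +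
    (of_bool (s 2 \<noteq> \<alpha> a) + of_bool (s 2 = d)) + (of_bool (s 3 = d) + of_bool (s 3 = \<alpha> c)) +
    (of_bool (s 4 \<noteq> \<alpha> c) + of_bool (\<not> s 4)) + (of_bool (s 5 = d) + of_bool (\<not> s 5) :: nat)"
    by (cases "\<alpha> a"; cases "\<alpha> b"; cases "\<alpha> c"; cases d; simp add: of_bool_def)
  also have "\<dots> = clause_cost m cls \<alpha> k"
    by (rule clause_cost_eq[symmetric]) (use assms s_def d_def in auto)
  finally show ?thesis .
qed

text \<open>The variable \<open>d\<close> is chosen to make both triples mixed; then the even node
  of each pair copies its parent, which costs nothing where the two parents differ.\<close>

lemma extend_assignment:
  assumes bd: "bounded_clauses m cls" and "\<beta> 0"
    and neg: "\<And>w. w \<le> m \<Longrightarrow> \<beta> (2 * w + 1) = (\<not> \<beta> (2 * w))"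
    and sat: "\<And>a b c. (a, b, c) \<in> set cls \<Longrightarrow> \<beta> a \<or> \<beta> b \<or> \<beta> c"
  obtains \<alpha> where "\<alpha> 0" "\<And>w. \<alpha> (2 * w + 1) = (\<not> \<alpha> (2 * w))"
    "\<And>k. k < length cls \<Longrightarrow> clause_cost m cls \<alpha> k = 2"
proof -
  \<comment> \<open>If c holds, the second triple is mixed for either d, and d = \<not> a separates
    the first one. If c fails, d must be false, and then a \<or> b makes the first triple
    mixed.\<close>
  define dval where "dval = (\<lambda>(a, b :: nat, c). \<beta> c \<and> \<not> \<beta> a)"
  define \<gamma> where "\<gamma> u = (if u div 2 \<le> m then \<beta> u else (dval (cls ! (u div 2 - m - 1)) \<longleftrightarrow> even u))" for u
  define \<alpha> where "\<alpha> u = (if u < 2 + 2 * (m + length cls) then \<gamma> u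
    else \<gamma> (clause_parent m cls (2 * (u div 2))) \<longleftrightarrow> even u)" for u
  have 0: "\<alpha> 0" using \<open>\<beta> 0\<close> by (simp add: \<alpha>_def \<gamma>_def)
  have \<gamma>neg: "\<gamma> (2 * w + 1) = (\<not> \<gamma> (2 * w))" for w
    using neg[of w] by (simp add: \<gamma>_def)
  have \<alpha>neg: "\<alpha> (2 * w + 1) = (\<not> \<alpha> (2 * w))" for w
  proof -
    have "2 * w + 1 < 2 + 2 * (m + length cls) \<longleftrightarrow> 2 * w < 2 + 2 * (m + length cls)" by presburger
    then show ?thesis using \<gamma>neg[of w] by (simp add: \<alpha>_def)
  qed
  have "clause_cost m cls \<alpha> k = 2" if k: "k < length cls" for k
  proof -
    obtain a b c where t: "cls ! k = (a, b, c)" by (cases "cls ! k") auto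
    have mem: "(a, b, c) \<in> set cls" using k t nth_mem by metis
    then have b: "a < 2 * (m + 1)" "b < 2 * (m + 1)" "c < 2 * (m + 1)"
      using bd by (auto simp: bounded_clauses_def)
    have \<alpha>\<beta>: "\<alpha> u = \<beta> u" if "u < 2 * (m + 1)" for u
    proof -
      have "u div 2 \<le> m" using that by presburger
      then show ?thesis using that by (simp add: \<alpha>_def \<gamma>_def)
    qed
    define s where "s = (\<lambda>r. \<alpha> (2 * (1 + m + length cls + 6 * k + r)))"
    define d where "d = \<alpha> (2 * (m + k + 1))"
    have d: "d = (\<beta> c \<and> \<not> \<beta> a)" using k t by (simp add: d_def \<alpha>_def \<gamma>_def dval_def)
    have s: "s r = \<alpha> (gadget (2 * (m + k + 1)) (cls ! k) ! (2 * r))" if r: "r < 6" for r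
    proof -
      have *: "2 * (1 + m + length cls + 6 * k + r) = 2 + 2 * (m + length cls) + (12 * k + 2 * r)" by simp
      have "s r = \<gamma> (clause_parent m cls (2 + 2 * (m + length cls) + (12 * k + 2 * r)))"
        unfolding s_def \<alpha>_def by (subst *)+ simp
      also have "\<dots> = \<gamma> (gadget (2 * (m + k + 1)) (cls ! k) ! (2 * r))"
        by (subst clause_parent_gadget) (use r in auto)
      also have "\<dots> = \<alpha> (gadget (2 * (m + k + 1)) (cls ! k) ! (2 * r))"
        using gadget_bound[OF bd k, of "2 * r"] r by (simp add: \<alpha>_def)
      finally show ?thesis .
    qed
    have dn: "\<alpha> (Suc (2 * (m + k + 1))) = (\<not> d)" using \<alpha>neg[of "m + k + 1"] by (simp add: d_def)
    have s': "s 0 = \<alpha> a" "s 1 = \<alpha> b" "s 2 = \<alpha> a" "s 3 = (\<not> d)" "s 4 = \<alpha> c" "s 5 = (\<not> d)"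
      using s[of 0] s[of 1] s[of 2] s[of 3] s[of 4] s[of 5] dn t by simp_all
    have "\<alpha> a \<or> \<alpha> b \<or> \<alpha> c" using sat[OF mem] \<alpha>\<beta> b by simp
    then show ?thesis
      unfolding clause_cost_eq[where \<alpha>=\<alpha> and m=m, OF k t 0 \<alpha>neg s_def d_def] s'
      using d \<alpha>\<beta>[OF b(1)] \<alpha>\<beta>[OF b(3)] by auto
  qed
  then show thesis using that 0 \<alpha>neg by blast
qed

text \<open>The threshold leaves exactly 2 for each clause, which is also the least cost of any
  clause. So equality must hold in every clause, and a violated one breaks it.\<close>

theorem min_cut_clauses:
  assumes bd: "bounded_clauses m cls"
  shows "(\<exists>S. fair_bisection {..<2 * num_labels m cls} (\<lambda>u. u div 2 + 1) S \<and>
      card (cut_edges (parent_tree.E (num_labels m cls) (clause_parent m cls)) S) \<le> 1 + m + 3 * length cls) \<longleftrightarrow>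
    satisfiable m cls"
proof -
  interpret parent_tree "num_labels m cls" "clause_parent m cls"
    by (rule parent_tree_clauses[OF bd])
  have "(\<exists>\<alpha>. \<alpha> 0 \<and> (\<forall>w<num_labels m cls. \<alpha> (2 * w + 1) = (\<not> \<alpha> (2 * w))) \<and>
      polarity_cost \<alpha> \<le> 1 + m + 3 * length cls) \<longleftrightarrow> satisfiable m cls"
  proof
    assume "\<exists>\<alpha>. \<alpha> 0 \<and> (\<forall>w<num_labels m cls. \<alpha> (2 * w + 1) = (\<not> \<alpha> (2 * w))) \<and>
      polarity_cost \<alpha> \<le> 1 + m + 3 * length cls"
    then obtain \<alpha> where \<alpha>: "\<alpha> 0" "\<And>w. w < num_labels m cls \<Longrightarrow> \<alpha> (2 * w + 1) = (\<not> \<alpha> (2 * w))"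
      and cost: "polarity_cost \<alpha> \<le> 1 + m + 3 * length cls" by blast
    have sum: "(\<Sum>k<length cls. clause_cost m cls \<alpha> k) \<le> 2 * length cls"
      using cost polarity_cost_clauses[of m cls \<alpha>, OF bd \<alpha>] by simp
    have "\<alpha> a \<or> \<alpha> b \<or> \<alpha> c" if t: "(a, b, c) \<in> set cls" for a b c
    proof (rule ccontr)
      assume no: "\<not> (\<alpha> a \<or> \<alpha> b \<or> \<alpha> c)"
      obtain j where j: "j < length cls" "cls ! j = (a, b, c)" using t by (metis in_set_conv_nth)
      have low: "2 \<le> clause_cost m cls \<alpha> k" if "k < length cls" for k
      proof -
        obtain a b c where "cls ! k = (a, b, c)" by (cases "cls ! k") auto
        from clause_cost_lower[where \<alpha>=\<alpha> and m=m, OF that this \<alpha>] show ?thesis by simp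
      qed
      have "(\<Sum>k<length cls. 2) < (\<Sum>k<length cls. clause_cost m cls \<alpha> k)"
      proof (rule sum_strict_mono_ex1)
        show "\<forall>k\<in>{..<length cls}. 2 \<le> clause_cost m cls \<alpha> k" using low by simp
        show "\<exists>k\<in>{..<length cls}. 2 < clause_cost m cls \<alpha> k"
          using clause_cost_lower[where \<alpha>=\<alpha> and m=m, OF j \<alpha>] no j(1) by (intro bexI[of _ j]) auto
      qed simp
      then show False using sum by simp
    qed
    moreover have "\<alpha> (2 * w + 1) = (\<not> \<alpha> (2 * w))" if "w \<le> m" for w
      using \<alpha>(2)[of w] that by (simp add: num_labels_def)
    ultimately show "satisfiable m cls" using \<alpha>(1) by (auto simp: satisfiable_def)
  next
    assume "satisfiable m cls"
    then obtain \<beta> where "\<beta> 0" "\<And>w. w \<le> m \<Longrightarrow> \<beta> (2 * w + 1) = (\<not> \<beta> (2 * w))"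
      "\<And>a b c. (a, b, c) \<in> set cls \<Longrightarrow> \<beta> a \<or> \<beta> b \<or> \<beta> c"
      unfolding satisfiable_def by fast
    then obtain \<alpha> where \<alpha>: "\<alpha> 0" "\<And>w. \<alpha> (2 * w + 1) = (\<not> \<alpha> (2 * w))"
      "\<And>k. k < length cls \<Longrightarrow> clause_cost m cls \<alpha> k = 2"
      using extend_assignment[OF bd] by metis
    have "polarity_cost \<alpha> = 1 + m + 3 * length cls"
      using polarity_cost_clauses[of m cls \<alpha>, OF bd \<alpha>(1,2)] \<alpha>(3) by simp
    then show "\<exists>\<alpha>. \<alpha> 0 \<and> (\<forall>w<num_labels m cls. \<alpha> (2 * w + 1) = (\<not> \<alpha> (2 * w))) \<and>
      polarity_cost \<alpha> \<le> 1 + m + 3 * length cls"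
      using \<alpha>(1,2) by (intro exI[of _ \<alpha>]) simp
  qed
  then show ?thesis using min_cut_iff by simp
qed

section \<open>The encoded instance\<close>

definition clause_graph :: "nat \<Rightarrow> clause list \<Rightarrow> labelled_graph" where
  "clause_graph m cls = (map (\<lambda>u. u div 2 + 1) [0..<2 * num_labels m cls],
     map (\<lambda>u. (u, clause_parent m cls u)) [1..<2 * num_labels m cls])"

text \<open>\<open>label\<close> agrees with u div 2 + 1 on the nodes only, as list access beyond
  the end is unspecified; hence each notion is compared on nodes. Unique decoding recovers the
  instance and the threshold from the word.\<close>

theorem threshold_clauses:
  assumes bd: "bounded_clauses m cls"
  shows "encode_graph (clause_graph m cls) @ encode_nat (1 + m + 3 * length cls) \<in>
      threshold_language encode_graph min_fair_bisection_recursive_trees \<longleftrightarrow>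
    satisfiable m cls"
proof -
  interpret parent_tree "num_labels m cls" "clause_parent m cls"
    by (rule parent_tree_clauses[OF bd])
  let ?g = "clause_graph m cls"
  let ?N = "num_labels m cls"
  have nodes: "nodes ?g = {..<2 * ?N}" by (simp add: nodes_def clause_graph_def)
  have edges: "edges ?g = E" by (auto simp: edges_def clause_graph_def E_def)
  have lab: "label ?g u = u div 2 + 1" if "u < 2 * ?N" for u
    using that by (simp add: label_def clause_graph_def)
  have fair: "fair_bisection (nodes ?g) (label ?g) S \<longleftrightarrow>
      fair_bisection {..<2 * ?N} (\<lambda>u. u div 2 + 1) S" for S
  proof (cases S)
    case (Pair A B)
    have "A \<union> B = {..<2 * ?N} \<Longrightarrow> inj_on (label ?g) A = inj_on (\<lambda>u. u div 2 + 1) A"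
      "A \<union> B = {..<2 * ?N} \<Longrightarrow> inj_on (label ?g) B = inj_on (\<lambda>u. u div 2 + 1) B"
      using lab by (auto intro!: inj_on_cong)
    then show ?thesis unfolding Pair fair_bisection_def nodes by auto
  qed
  have "path_to_closest_root {..<2 * ?N} E (label ?g) p \<longleftrightarrow>
      path_to_closest_root {..<2 * ?N} E (\<lambda>u. u div 2 + 1) p" for p
  proof -
    have "label ?g (last q) = last q div 2 + 1" if "graph_path {..<2 * ?N} E q" for q
    proof -
      have "last q \<in> {..<2 * ?N}" using that last_in_set[of q] unfolding graph_path_def by blast
      then show ?thesis using lab by simp
    qed
    then show ?thesis unfolding path_to_closest_root_def by (metis (no_types, lifting))
  qed
  moreover have "map (label ?g) p = map (\<lambda>u. u div 2 + 1) p"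
    if "path_to_closest_root {..<2 * ?N} E (\<lambda>u. u div 2 + 1) p" for p
    using that lab by (intro map_cong) (auto simp: path_to_closest_root_def graph_path_def)
  moreover have "{v \<in> {..<2 * ?N}. label ?g v = i} = {v \<in> {..<2 * ?N}. v div 2 + 1 = i}" for i
    using lab by auto
  moreover have "label ?g ` {..<2 * ?N} = (\<lambda>u. u div 2 + 1) ` {..<2 * ?N}"
    using lab by (intro image_cong) auto
  ultimately have "recursive_tree ?N (nodes ?g) (edges ?g) (label ?g)"
    using recursive_tree unfolding recursive_tree_def nodes edges by (simp del: map_eq_conv)
  moreover have "no_repeated_edge ?g"
    using inj_on_edge by (simp add: no_repeated_edge_def clause_graph_def distinct_map comp_def)
  ultimately have inst: "?g \<in> instances min_fair_bisection_recursive_trees"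
    by (auto simp: min_fair_bisection_recursive_trees_def)
  have "encode_graph ?g @ encode_nat (1 + m + 3 * length cls) \<in>
      threshold_language encode_graph min_fair_bisection_recursive_trees \<longleftrightarrow>
     (\<exists>S. fair_bisection (nodes ?g) (label ?g) S \<and> card (cut_edges (edges ?g) S) \<le> 1 + m + 3 * length cls)"
  proof -
    have "encode_graph ?g @ encode_nat k = encode_graph h @ encode_nat l \<longleftrightarrow> ?g = h \<and> k = l" for h k l
      using encode_graph_append_inject[of ?g "encode_nat k" h "encode_nat l"]
        encode_nat_append_inject[of k "[]" l "[]"] by auto
    then show ?thesis using inst unfolding threshold_language_def mem_Collect_eq
      by (auto simp: min_fair_bisection_recursive_trees_def)
  qed
  also have "\<dots> \<longleftrightarrow> satisfiable m cls"
    using min_cut_clauses[OF bd] fair edges by simp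
  finally show ?thesis .
qed

section \<open>Arithmetic expressions\<close>

datatype expr = Var nat | Const nat | Add expr expr | Mul expr expr

fun eval :: "(nat \<Rightarrow> nat) \<Rightarrow> expr \<Rightarrow> nat" where
  "eval env (Var v) = env v"
| "eval env (Const c) = c"
| "eval env (Add a b) = eval env a + eval env b"
| "eval env (Mul a b) = eval env a * eval env b"

fun vars :: "expr \<Rightarrow> nat set" where
  "vars (Var v) = {v}"
| "vars (Const c) = {}"
| "vars (Add a b) = vars a \<union> vars b"
| "vars (Mul a b) = vars a \<union> vars b"

lemma eval_cong: "(\<And>v. v \<in> vars e \<Longrightarrow> env v = env' v) \<Longrightarrow> eval env e = eval env' e"
  by (induction e) auto

text \<open>Horner's scheme. It makes the time bound of a machine an expression over which programs
  can loop.\<close>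

lemma poly_expr: "\<exists>e. vars e \<subseteq> {0} \<and> (\<forall>env. eval env e = poly p (env 0))" for p :: "nat poly"
proof (induction p)
  case 0
  then show ?case by (intro exI[of _ "Const 0"]) auto
next
  case (pCons a p)
  then obtain e where "vars e \<subseteq> {0}" "\<forall>env. eval env e = poly p (env 0)" by blast
  then show ?case by (intro exI[of _ "Add (Const a) (Mul (Var 0) e)"]) auto
qed

section \<open>Programs that list clauses\<close>

text \<open>The loop at nesting depth \<open>d\<close> binds variable \<open>d\<close>; variable 0 is the length of the input.\<close>

datatype clause_prog =
    Clause expr expr expr
  | CNil
  | CSeq clause_prog clause_prog
  | CFor expr clause_prog
  | CIf nat clause_prog clause_prog

fun clauses :: "bool list \<Rightarrow> nat \<Rightarrow> (nat \<Rightarrow> nat) \<Rightarrow> clause_prog \<Rightarrow> clause list" where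
  "clauses x d env (Clause a b c) = [(eval env a, eval env b, eval env c)]"
| "clauses x d env CNil = []"
| "clauses x d env (CSeq p q) = clauses x d env p @ clauses x d env q"
| "clauses x d env (CFor e p) = concat (map (\<lambda>i. clauses x (Suc d) (env(d := i)) p) [0..<eval env e])"
| "clauses x d env (CIf v p q) =
     (if env v < length x \<and> x ! env v then clauses x d env p else clauses x d env q)"

definition CList :: "clause_prog list \<Rightarrow> clause_prog" where
  "CList ps = foldr CSeq ps CNil"

text \<open>Statements about all clauses of a program simplify to nested bounded quantifiers. P is
  used both for literals being in range and for clauses holding under an assignment.\<close>

definition all_clauses ::
    "(clause \<Rightarrow> bool) \<Rightarrow> bool list \<Rightarrow> nat \<Rightarrow> (nat \<Rightarrow> nat) \<Rightarrow> clause_prog \<Rightarrow> bool" where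
  "all_clauses P x d env p \<longleftrightarrow> (\<forall>t \<in> set (clauses x d env p). P t)"

lemma all_clauses_simps [simp]:
  "all_clauses P x d env (Clause a b c) = P (eval env a, eval env b, eval env c)"
  "all_clauses P x d env CNil = True"
  "all_clauses P x d env (CSeq p q) = (all_clauses P x d env p \<and> all_clauses P x d env q)"
  "all_clauses P x d env (CFor e p) = (\<forall>i<eval env e. all_clauses P x (Suc d) (env(d := i)) p)"
  "all_clauses P x d env (CIf v p q) =
     (if env v < length x \<and> x ! env v then all_clauses P x d env p else all_clauses P x d env q)"
  by (auto simp: all_clauses_def)

lemma all_clauses_CList [simp]:
  "all_clauses P x d env (CList ps) = (\<forall>p\<in>set ps. all_clauses P x d env p)"
  by (induction ps) (auto simp: CList_def)

text \<open>
  Loop bounds depend on the length of the input only, which makes the number of clauses an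
  expression in it.
\<close>

fun wf_prog :: "nat \<Rightarrow> clause_prog \<Rightarrow> bool" where
  "wf_prog d (Clause a b c) \<longleftrightarrow> vars a \<union> vars b \<union> vars c \<subseteq> {..<d}"
| "wf_prog d CNil \<longleftrightarrow> True"
| "wf_prog d (CSeq p q) \<longleftrightarrow> wf_prog d p \<and> wf_prog d q"
| "wf_prog d (CFor e p) \<longleftrightarrow> vars e \<subseteq> {0} \<and> wf_prog (Suc d) p"
| "wf_prog d (CIf v p q) \<longleftrightarrow> v < d \<and> wf_prog d p \<and> wf_prog d q"

lemma wf_prog_CList [simp]: "wf_prog d (CList ps) = (\<forall>p\<in>set ps. wf_prog d p)"
  by (induction ps) (auto simp: CList_def)

text \<open>An expression rather than a number, since the printer has to write numbers computed from
  it. For a test the first branch stands for both, as \<open>balanced\<close> justifies.\<close>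

fun prog_count :: "clause_prog \<Rightarrow> expr" where
  "prog_count (Clause a b c) = Const 1"
| "prog_count CNil = Const 0"
| "prog_count (CSeq p q) = Add (prog_count p) (prog_count q)"
| "prog_count (CFor e p) = Mul e (prog_count p)"
| "prog_count (CIf v p q) = prog_count p"

fun balanced :: "clause_prog \<Rightarrow> bool" where
  "balanced (CSeq p q) \<longleftrightarrow> balanced p \<and> balanced q"
| "balanced (CFor e p) \<longleftrightarrow> balanced p"
| "balanced (CIf v p q) \<longleftrightarrow> balanced p \<and> balanced q \<and> (\<forall>env. eval env (prog_count p) = eval env (prog_count q))"
| "balanced _ \<longleftrightarrow> True"

lemma balanced_CList [simp]: "balanced (CList ps) = (\<forall>p\<in>set ps. balanced p)"
  by (induction ps) (auto simp: CList_def)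

lemma vars_prog_count: "wf_prog d p \<Longrightarrow> vars (prog_count p) \<subseteq> {0}"
  by (induction p arbitrary: d) auto

text \<open>Loop bounds mention variable 0 only, and loops bind variables d > 0, so all rounds of a
  loop list equally many clauses.\<close>

lemma length_clauses:
  "wf_prog d p \<Longrightarrow> balanced p \<Longrightarrow> 0 < d \<Longrightarrow> length (clauses x d env p) = eval env (prog_count p)"
proof (induction p arbitrary: d env)
  case (CFor e p)
  have "length (clauses x (Suc d) (env(d := i)) p) = eval env (prog_count p)" for i
  proof -
    have "length (clauses x (Suc d) (env(d := i)) p) = eval (env(d := i)) (prog_count p)"
      by (rule CFor.IH) (use CFor.prems in auto)
    also have "\<dots> = eval env (prog_count p)"
      by (rule eval_cong) (use vars_prog_count[of "Suc d" p] CFor.prems in auto)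
    finally show ?thesis .
  qed
  then show ?case by (simp add: length_concat comp_def sum_list_triv)
qed auto

section \<open>Rule machines\<close>

text \<open>
  A tape is written relative to its head, and the state is the symbol under the head of
  tape 0, so that a rule (symbol read, symbol written, head move for each tape) acts in the
  same way on all tapes. Moving the head right shifts the tape to the left.
\<close>

type_synonym rule = "(nat \<times> nat \<times> move) list"
type_synonym rconfig = "nat \<Rightarrow> int \<Rightarrow> nat"

text \<open>The displacement of the tape relative to its head, plus 1 to make it a natural number:
  the tableau adds it to a column, and expressions have no subtraction.\<close>

fun shift :: "move \<Rightarrow> nat" where
  "shift MoveLeft = 2"
| "shift Stay = 1"
| "shift MoveRight = 0"

definition enabled :: "rule \<Rightarrow> rconfig \<Rightarrow> bool" where
  "enabled \<tau> c \<longleftrightarrow> (\<forall>j<length \<tau>. c j 0 = fst (\<tau> ! j))"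

text \<open>The offset \<open>i'\<close> is the one, before the move, of the cell that the move
  brings to offset \<open>i\<close>.\<close>

definition apply_rule :: "rule \<Rightarrow> rconfig \<Rightarrow> rconfig" where
  "apply_rule \<tau> c j i =
     (if j < length \<tau> then
        (let i' = i + 1 - int (shift (snd (snd (\<tau> ! j)))) in
         if i' = 0 then fst (snd (\<tau> ! j)) else c j i')
      else c j i)"

definition rule_step :: "rule set \<Rightarrow> rconfig \<Rightarrow> rconfig \<Rightarrow> bool" where
  "rule_step R c c' \<longleftrightarrow> (\<exists>\<tau>\<in>R. enabled \<tau> c \<and> c' = apply_rule \<tau> c)"

definition rinit :: "bool list \<Rightarrow> rconfig" where
  "rinit x j = (if j = 1 then tape_word x else (\<lambda>_. 0))"

text \<open>Acceptance is tested after exactly t steps, so that a tableau with a fixed number of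
  rows can express it; the symbol at offset 0 of tape 0 is the state.\<close>

definition reaches :: "rule set \<Rightarrow> nat \<Rightarrow> bool list \<Rightarrow> nat \<Rightarrow> bool" where
  "reaches R acc x t \<longleftrightarrow> (\<exists>c. (rule_step R ^^ t) (rinit x) c \<and> c 0 0 = acc)"

section \<open>The tableau\<close>

text \<open>
  Row \<open>t\<close> of the grid describes the configuration after \<open>t\<close> steps, column \<open>p\<close> the cells at
  distance \<open>p - (T + 1)\<close> from the heads. Each grid point carries the variables
  \<open>cell j s\<close> (tape \<open>j\<close> has symbol \<open>s\<close>), \<open>fire l\<close> (rule \<open>l\<close> is applied) and \<open>later l\<close> (one of
  the rules \<open>l, l + 1, \<dots>\<close> is applied). A cell outside the grid needs more than \<open>T\<close> steps to
  reach a head.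
\<close>

locale tableau =
  fixes J S acc :: nat and RS :: "rule list" and T :: expr
  assumes J: "2 \<le> J" and S: "3 \<le> S" and acc: "acc < S"
    and RS: "\<And>\<tau>. \<tau> \<in> set RS \<Longrightarrow> length \<tau> = J"
      "\<And>\<tau> r w d. \<tau> \<in> set RS \<Longrightarrow> (r, w, d) \<in> set \<tau> \<Longrightarrow> w < S"
    and T: "vars T \<subseteq> {0}"
begin

abbreviation "L \<equiv> length RS"
text \<open>Variables per grid point: J * S for the cells, L for \<open>fire\<close> and L + 1 for
  \<open>later\<close>, whose last index L stands for the empty set of rules.\<close>

definition "K = J * S + 2 * L + 1"
definition "cell j s = j * S + s"
definition "fire l = J * S + l"
definition "later l = J * S + L + l"

text \<open>With n the input length, there are T + 1 columns to the left of the head and n + T + 1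
  to the right. The outermost column on each side is a target of copying but never a source.\<close>

definition "width = Add (Add T T) (Add (Var 0) (Const 3))"
definition "centre = Add T (Const 1)"
definition "num_vars = Mul (Mul (Add T (Const 1)) width) (Const K)"

text \<open>The 1 in c + 1 skips the root label, whose nodes are the constants.\<close>

definition pos :: "expr \<Rightarrow> expr \<Rightarrow> nat \<Rightarrow> expr" where
  "pos t p c = Mul (Const 2) (Add (Mul (Add (Mul t width) p) (Const K)) (Const (c + 1)))"

definition neg :: "expr \<Rightarrow> expr \<Rightarrow> nat \<Rightarrow> expr" where
  "neg t p c = Add (pos t p c) (Const 1)"

text \<open>A unit clause repeats its literal. The value 0 is the blank and, on tape 0, the initial
  state.\<close>

definition "init_cells p s = CList (map (\<lambda>j. let a = pos (Const 0) p (cell j (if j = 1 then s else 0))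
   in Clause a a a) [0..<J])"

definition "init_prog = CList
  [CFor (Add T (Const 1)) (init_cells (Var 1) 0),
   CFor (Var 0) (CIf 1 (init_cells (Add centre (Var 1)) 2) (init_cells (Add centre (Var 1)) 1)),
   CFor (Add T (Const 2)) (init_cells (Add (Add centre (Var 0)) (Var 1)) 0)]"

definition "succ_row t = Add t (Const 1)"

text \<open>That some rule fires would be a clause of length L, so it is cut into a chain:
  \<open>later 0\<close> holds, \<open>later l\<close> implies \<open>fire l\<close> or
  \<open>later (l + 1)\<close>, and \<open>later L\<close> fails. Several rules may fire; soundness
  picks one.\<close>

definition "choice_prog t = CList (
  (let a = pos t centre (later 0) in Clause a a a) #
  (let a = neg t centre (later L) in Clause a a a) #
  map (\<lambda>l. Clause (neg t centre (later l)) (pos t centre (fire l)) (pos t centre (later (l + 1)))) [0..<L])"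

text \<open>All symbols other than the one read are excluded. Demanding the read symbol positively
  would not suffice, because no clause makes the symbol of a cell unique.\<close>

definition "read_prog t l j = CList (map (\<lambda>s.
   let a = neg t centre (cell j s) in Clause (neg t centre (fire l)) a a)
   (filter (\<lambda>s. s \<noteq> fst (RS ! l ! j)) [0..<S]))"

definition "write_prog t l j = (case RS ! l ! j of (r, w, d) \<Rightarrow>
   let a = pos (succ_row t) (Add T (Const (shift d))) (cell j w) in Clause (neg t centre (fire l)) a a)"

text \<open>The source column is p + 1, which absorbs the 1 added in \<open>shift\<close>. The head
  column is left to \<open>write_prog\<close>.\<close>

definition "copy_prog t p l j = CList (map (\<lambda>s.
   Clause (neg t centre (fire l)) (neg t (Add p (Const 1)) (cell j s))
     (pos (succ_row t) (Add p (Const (shift (snd (snd (RS ! l ! j)))))) (cell j s))) [0..<S])"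

definition "for_tapes f = CList (concat (map (\<lambda>l. map (\<lambda>j. f l j) [0..<J]) [0..<L]))"

definition "step_prog = CFor T (CList
  [choice_prog (Var 1), for_tapes (read_prog (Var 1)), for_tapes (write_prog (Var 1)),
   CFor T (for_tapes (copy_prog (Var 1) (Var 2))),
   CFor (Add T (Var 0)) (for_tapes (copy_prog (Var 1) (Add centre (Var 2))))])"

definition "end_prog = CList (map (\<lambda>s. let a = neg T centre (cell 0 s) in Clause a a a)
   (filter (\<lambda>s. s \<noteq> acc) [0..<S]))"

definition "tableau_prog = CList [init_prog, step_prog, end_prog]"

lemma all_for_tapes [simp]:
  "all_clauses P x d env (for_tapes f) = (\<forall>l<L. \<forall>j<J. all_clauses P x d env (f l j))"
  by (auto simp: for_tapes_def)

lemma T_subset: "v \<in> vars T \<Longrightarrow> v = 0"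
  using T by auto

lemmas prog_defs = tableau_prog_def init_prog_def step_prog_def end_prog_def init_cells_def
  choice_prog_def read_prog_def write_prog_def copy_prog_def for_tapes_def pos_def neg_def
  width_def centre_def succ_row_def

lemma wf_tableau_prog: "wf_prog 1 tableau_prog"
  by (auto simp: prog_defs Let_def dest: T_subset split: prod.splits)

lemma count_CList: "eval env (prog_count (CList ps)) = (\<Sum>p\<leftarrow>ps. eval env (prog_count p))"
  by (induction ps) (auto simp: CList_def)

lemma balanced_tableau_prog: "balanced tableau_prog"
  by (auto simp: prog_defs Let_def count_CList comp_def split: prod.splits)

definition "steps x = eval (\<lambda>_. length x) T"
definition "cols x = 2 * steps x + length x + 3"
definition "mid x = steps x + 1"
definition "node x t p c = 2 * ((t * cols x + p) * K + (c + 1))"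
definition "symb x i j = (if j = 1 \<and> i < length x then if x ! i then 2 else 1 else (0::nat))"

lemma eval_T: "env 0 = length x \<Longrightarrow> eval env T = steps x"
  unfolding steps_def by (rule eval_cong) (use T in auto)

lemma eval_pos [simp]:
  "env 0 = length x \<Longrightarrow> eval env (pos t p c) = node x (eval env t) (eval env p) c"
  "env 0 = length x \<Longrightarrow> eval env (neg t p c) = Suc (node x (eval env t) (eval env p) c)"
  "env 0 = length x \<Longrightarrow> eval env centre = mid x"
  by (auto simp: pos_def neg_def width_def centre_def node_def cols_def eval_T mid_def)

lemma all_init_cells [simp]:
  assumes "env 0 = length x"
  shows "all_clauses P x d env (init_cells p s) \<longleftrightarrow>
    (\<forall>j<J. let a = node x 0 (eval env p) (cell j (if j = 1 then s else 0)) in P (a, a, a))"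
  using assms by (auto simp: init_cells_def Let_def)

lemma all_init_prog:
  assumes "env 0 = length x"
  shows "all_clauses P x 1 env init_prog \<longleftrightarrow>
    (\<forall>j<J. (\<forall>p<mid x. let a = node x 0 p (cell j 0) in P (a, a, a)) \<and>
      (\<forall>i<length x + (steps x + 2). let a = node x 0 (mid x + i) (cell j (symb x i j)) in P (a, a, a)))"
proof -
  have split: "(\<forall>i<a + b. Q i) \<longleftrightarrow> (\<forall>i<a. Q i) \<and> (\<forall>i<b. Q (a + i))" for a b :: nat and Q
    by (metis add_less_cancel_left le_add_diff_inverse nat_add_left_cancel_less not_less trans_less_add1)
  show ?thesis
    unfolding init_prog_def split[of "length x" "steps x + 2"]
    using assms by (simp add: eval_T mid_def symb_def Let_def add.assoc del: add_2_eq_Suc add_2_eq_Suc')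
      (auto split: if_splits)
qed

lemma all_choice_prog [simp]:
  assumes "env 0 = length x"
  shows "all_clauses P x d env (choice_prog t) \<longleftrightarrow>
    (let v = node x (eval env t) (mid x) in
      P (v (later 0), v (later 0), v (later 0)) \<and>
      P (Suc (v (later L)), Suc (v (later L)), Suc (v (later L))) \<and>
      (\<forall>l<L. P (Suc (v (later l)), v (fire l), v (later (Suc l)))))"
  using assms by (auto simp: choice_prog_def Let_def)

lemma all_read_prog [simp]:
  assumes "env 0 = length x"
  shows "all_clauses P x d env (read_prog t l j) \<longleftrightarrow>
    (\<forall>s<S. s \<noteq> fst (RS ! l ! j) \<longrightarrow> (let v = node x (eval env t) (mid x) in
      P (Suc (v (fire l)), Suc (v (cell j s)), Suc (v (cell j s)))))"
  using assms by (auto simp: read_prog_def Let_def)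

lemma all_write_prog [simp]:
  assumes "env 0 = length x"
  shows "all_clauses P x d env (write_prog t l j) \<longleftrightarrow>
    (case RS ! l ! j of (r, w, m) \<Rightarrow>
      let a = node x (Suc (eval env t)) (steps x + shift m) (cell j w) in
      P (Suc (node x (eval env t) (mid x) (fire l)), a, a))"
  using assms by (auto simp: write_prog_def Let_def succ_row_def eval_T split: prod.splits)

lemma all_copy_prog [simp]:
  assumes "env 0 = length x"
  shows "all_clauses P x d env (copy_prog t p l j) \<longleftrightarrow>
    (\<forall>s<S. P (Suc (node x (eval env t) (mid x) (fire l)),
       Suc (node x (eval env t) (Suc (eval env p)) (cell j s)),
       node x (Suc (eval env t)) (eval env p + shift (snd (snd (RS ! l ! j)))) (cell j s)))"
  using assms by (auto simp: copy_prog_def Let_def succ_row_def)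

lemma all_step_prog:
  assumes "env 0 = length x"
  shows "all_clauses P x 1 env step_prog \<longleftrightarrow>
    (\<forall>t<steps x. let v = node x t (mid x);
        copy = (\<lambda>p. \<forall>l<L. \<forall>j<J. \<forall>s<S. P (Suc (v (fire l)), Suc (node x t (Suc p) (cell j s)),
          node x (Suc t) (p + shift (snd (snd (RS ! l ! j)))) (cell j s)))
      in P (v (later 0), v (later 0), v (later 0)) \<and>
      P (Suc (v (later L)), Suc (v (later L)), Suc (v (later L))) \<and>
      (\<forall>l<L. P (Suc (v (later l)), v (fire l), v (later (Suc l)))) \<and>
      (\<forall>l<L. \<forall>j<J. \<forall>s<S. s \<noteq> fst (RS ! l ! j) \<longrightarrow>
        P (Suc (v (fire l)), Suc (v (cell j s)), Suc (v (cell j s)))) \<and>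
      (\<forall>l<L. \<forall>j<J. case RS ! l ! j of (r, w, m) \<Rightarrow>
        let a = node x (Suc t) (steps x + shift m) (cell j w) in P (Suc (v (fire l)), a, a)) \<and>
      (\<forall>p<steps x. copy p) \<and> (\<forall>p<steps x + length x. copy (mid x + p)))"
  using assms by (simp add: step_prog_def eval_T Let_def)

lemma all_end_prog:
  assumes "env 0 = length x"
  shows "all_clauses P x 1 env end_prog \<longleftrightarrow>
    (\<forall>s<S. s \<noteq> acc \<longrightarrow> (let a = Suc (node x (steps x) (mid x) (cell 0 s)) in P (a, a, a)))"
  using assms by (auto simp: end_prog_def Let_def eval_T)

definition "vars_used x = (steps x + 1) * cols x * K"

lemma eval_num_vars: "env 0 = length x \<Longrightarrow> eval env num_vars = vars_used x"
  by (simp add: num_vars_def vars_used_def eval_T width_def cols_def)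

lemma cell_less: "j < J \<Longrightarrow> s < S \<Longrightarrow> cell j s < J * S"
  using mult_le_mono1[of "Suc j" J S] by (simp add: cell_def)

lemma index_less [simp]:
  "j < J \<Longrightarrow> s < S \<Longrightarrow> cell j s < K"
  "l < L \<Longrightarrow> fire l < K"
  "l \<le> L \<Longrightarrow> later l < K"
  using cell_less[of j s] by (auto simp: K_def fire_def later_def)

lemma var_le:
  assumes "t \<le> steps x" "p < cols x" "c < K"
  shows "(t * cols x + p) * K + (c + 1) \<le> vars_used x"
proof -
  have "t * cols x \<le> steps x * cols x" using assms(1) by (rule mult_le_mono1)
  then have "t * cols x + p < (steps x + 1) * cols x"
    using assms(2) unfolding add_mult_distrib by linarith
  then have "(t * cols x + p + 1) * K \<le> vars_used x"
    unfolding vars_used_def by (intro mult_le_mono1) simp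
  then show ?thesis using assms(3) by (simp add: algebra_simps)
qed

lemma node_Suc_less:
  assumes "t \<le> steps x" "p < cols x" "c < K"
  shows "node x t p c < 2 * (vars_used x + 1)" "Suc (node x t p c) < 2 * (vars_used x + 1)"
  using var_le[OF assms] by (auto simp: node_def)

lemma shift_le: "shift m \<le> 2"
  by (cases m) auto

lemma RS_entry: "l < L \<Longrightarrow> j < J \<Longrightarrow> RS ! l ! j = (r, w, m) \<Longrightarrow> w < S"
  using RS by (metis nth_mem)

lemma bounded_tableau:
  assumes "env 0 = length x"
  shows "bounded_clauses (vars_used x) (clauses x 1 env tableau_prog)"
proof -
  let ?P = "\<lambda>(a, b, c). a < 2 * (vars_used x + 1) \<and> b < 2 * (vars_used x + 1) \<and> c < 2 * (vars_used x + 1)"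
  have symb: "symb x i j < S" for i j :: nat using S by (auto simp: symb_def)
  have i0: "node x 0 p (cell j s) < 2 * (vars_used x + 1)" if "p < cols x" "j < J" "s < S" for p j s
    using that by (intro node_Suc_less index_less) auto
  have mid: "mid x < cols x" by (simp add: mid_def cols_def)
  have "all_clauses ?P x 1 env init_prog"
    unfolding all_init_prog[of env x, OF assms] Let_def split
    using symb S i0 by (auto simp: mid_def cols_def)
  moreover have "all_clauses ?P x 1 env end_prog"
    unfolding all_end_prog[of env x, OF assms] Let_def split
    using node_Suc_less(2)[of "steps x" x "mid x"] mid J by auto
  moreover have "all_clauses ?P x 1 env step_prog"
  proof -
    have "p + shift m < cols x" if "p \<le> 2 * steps x + length x" for p m
      using that shift_le[of m] by (simp add: cols_def)
    then have sh: "node x (Suc t) (p + shift m) (cell j s) < 2 * (vars_used x + 1)"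
      if "p \<le> 2 * steps x + length x" "t < steps x" "s < S" "j < J" for p m t s j
      using that by (intro node_Suc_less index_less) auto
    have v: "Suc (node x t (mid x) c) < 2 * (vars_used x + 1)" "node x t (mid x) c < 2 * (vars_used x + 1)"
      if "t < steps x" "c < K" for t c
      using node_Suc_less[of t x "mid x" c] mid that by auto
    have s: "Suc (node x t (Suc p) (cell j s)) < 2 * (vars_used x + 1)"
      if "p \<le> 2 * steps x + length x" "t < steps x" "s < S" "j < J" for p t s j
      using that by (intro node_Suc_less index_less) (auto simp: cols_def)
    have mp: "mid x + p \<le> 2 * steps x + length x" if "p < steps x + length x" for p
      using that by (simp add: mid_def)
    show ?thesis
      unfolding all_step_prog[of env x, OF assms] Let_def split
      using v sh s mp RS_entry by (auto split: prod.splits)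
  qed
  ultimately show ?thesis
    by (simp add: tableau_prog_def bounded_clauses_def all_clauses_def CList_def ball_Un)
qed

section \<open>From a satisfying assignment to an accepting run\<close>

lemma apply_rule_mid:
  assumes "length \<tau> = J" "j < J" "\<tau> ! j = (r, w, m)"
  shows "apply_rule \<tau> c j (int q - int (mid x)) =
    (if int q + 1 - int (shift m) = int (mid x) then w else c j (int q + 1 - int (shift m) - int (mid x)))"
  using assms by (auto simp: apply_rule_def Let_def algebra_simps)

text \<open>A run is built from one firing rule per row, and the variable of the actual symbol of a
  cell is shown to be true, even if further symbols of that cell are marked true as well. The read
  and end clauses are negative, so they refute every wrong symbol at a head.\<close>

lemma tableau_sound:
  assumes env: "env 0 = length x"
    and sat: "satisfiable (vars_used x) (clauses x 1 env tableau_prog)"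
  shows "reaches (set RS) acc x (steps x)"
proof -
  obtain \<beta> where neg: "\<And>w. w \<le> vars_used x \<Longrightarrow> \<beta> (2 * w + 1) = (\<not> \<beta> (2 * w))"
    and cls: "\<forall>t\<in>set (clauses x 1 env tableau_prog). (\<lambda>(a, b, c). \<beta> a \<or> \<beta> b \<or> \<beta> c) t"
    using sat unfolding satisfiable_def by blast
  let ?P = "\<lambda>(a, b, c). \<beta> a \<or> \<beta> b \<or> \<beta> c"
  have all: "all_clauses ?P x 1 env init_prog" "all_clauses ?P x 1 env step_prog" "all_clauses ?P x 1 env end_prog"
    using cls by (auto simp: tableau_prog_def all_clauses_def CList_def)
  define X where "X t p c = \<beta> (node x t p c)" for t p c
  have Xneg: "\<beta> (Suc (node x t p c)) = (\<not> X t p c)" if "t \<le> steps x" "p < cols x" "c < K" for t p c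
  proof -
    have "node x t p c = 2 * ((t * cols x + p) * K + (c + 1))" by (simp add: node_def)
    moreover have "(t * cols x + p) * K + (c + 1) \<le> vars_used x"
      using that by (rule var_le)
    ultimately show ?thesis using neg[of "(t * cols x + p) * K + (c + 1)"] by (simp add: X_def)
  qed
  have mid: "mid x < cols x" by (simp add: mid_def cols_def)
  note step = all(2)[unfolded all_step_prog[of env x, OF env] Let_def split, rule_format]
  have step_read: "\<beta> (Suc (node x t (mid x) (fire l))) \<or> \<beta> (Suc (node x t (mid x) (cell j s)))"
    if "t < steps x" "l < L" "j < J" "s < S" "s \<noteq> fst (RS ! l ! j)" for t l j s
    using step[OF that(1)] that(2-) by simp
  have step_write: "\<beta> (Suc (node x t (mid x) (fire l))) \<or> \<beta> (node x (Suc t) (steps x + shift m) (cell j w))"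
    if "t < steps x" "l < L" "j < J" "RS ! l ! j = (r, w, m)" for t l j r w m
  proof -
    have "\<forall>l<L. \<forall>j<J. case RS ! l ! j of (r, w, m) \<Rightarrow>
        \<beta> (Suc (node x t (mid x) (fire l))) \<or> \<beta> (node x (Suc t) (steps x + shift m) (cell j w))"
      using step[OF that(1)] by simp
    then show ?thesis using that(2-) by fastforce
  qed
  have step_copy: "\<beta> (Suc (node x t (mid x) (fire l))) \<or> \<beta> (Suc (node x t (Suc p) (cell j s))) \<or>
      \<beta> (node x (Suc t) (p + shift (snd (snd (RS ! l ! j)))) (cell j s))"
    if "t < steps x" "l < L" "j < J" "s < S" "p < steps x \<or> (\<exists>p'<steps x + length x. p = mid x + p')"
    for t l j s p
    using that(5)
  proof
    assume "p < steps x"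
    then show ?thesis using step[OF that(1)] that(2-4) by simp
  next
    assume "\<exists>p'<steps x + length x. p = mid x + p'"
    then obtain p' where "p' < steps x + length x" "p = mid x + p'" by blast
    then show ?thesis using step[OF that(1)] that(2-4) by simp
  qed
  have "\<exists>l<L. X t (mid x) (fire l)" if t: "t < steps x" for t
  proof (rule ccontr)
    assume no: "\<not> (\<exists>l<L. X t (mid x) (fire l))"
    have "X t (mid x) (later l)" if "l \<le> L" for l
      using that
    proof (induction l)
      case 0
      then show ?case using step[OF t] by (simp add: X_def)
    next
      case (Suc l)
      then have "X t (mid x) (fire l) \<or> X t (mid x) (later (Suc l))"
      proof -
        have "\<beta> (Suc (node x t (mid x) (later l))) \<or> X t (mid x) (fire l) \<or> X t (mid x) (later (Suc l))"
          using step[OF t] Suc.prems unfolding X_def by simp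
        then show ?thesis using Xneg[of t "mid x" "later l"] t mid Suc by auto
      qed
      then show ?case using no Suc.prems by auto
    qed
    then show False using step[OF t] Xneg[of t "mid x" "later L"] t mid by auto
  qed
  then obtain idx where idx: "\<And>t. t < steps x \<Longrightarrow> idx t < L" "\<And>t. t < steps x \<Longrightarrow> X t (mid x) (fire (idx t))"
    by metis
  \<comment> \<open>The chosen rules are applied without asking whether they are enabled; this
    follows later, once the cells have been tracked.\<close>
  define cf where "cf = rec_nat (rinit x) (\<lambda>t c. apply_rule (RS ! idx t) c)"
  have cf: "cf 0 = rinit x" "\<And>t. cf (Suc t) = apply_rule (RS ! idx t) (cf t)" by (auto simp: cf_def)
  have symb: "cf t j i < S" if "t \<le> steps x" "j < J" for t j i
    using that
  proof (induction t arbitrary: i)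
    case 0
    then show ?case using S by (auto simp: cf rinit_def tape_word_def)
  next
    case (Suc t)
    then have "idx t < L" using idx by simp
    then show ?case using Suc RS_entry[OF \<open>idx t < L\<close> \<open>j < J\<close>]
      by (cases "RS ! idx t ! j") (auto simp: cf apply_rule_def Let_def)
  qed
  \<comment> \<open>A cell at distance r from the head comes from distance at most r + 1 in the
    previous row, so row t is correct within radius T - t. At t = T this is just the head column,
    which the end clauses inspect.\<close>
  have cells: "X t p (cell j (cf t j (int p - int (mid x))))"
    if "t \<le> steps x" "j < J" "mid x \<le> p + (steps x - t)" "p \<le> mid x + (steps x - t)" for t j p
    using that
  proof (induction t arbitrary: p)
    case 0
    note init = all(1)[unfolded all_init_prog[of env x, OF env] Let_def split, rule_format, OF \<open>j < J\<close>]
    show ?case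
    proof (cases "p < mid x")
      case True
      then have "cf 0 j (int p - int (mid x)) = 0" by (simp add: cf rinit_def tape_word_def)
      then show ?thesis using init True by (simp add: X_def)
    next
      case False
      then obtain i where p: "p = mid x + i" by (metis le_Suc_ex not_less)
      have "cf 0 j (int p - int (mid x)) = symb x i j"
        by (simp add: p cf rinit_def tape_word_def symb_def)
      moreover have "i < length x + (steps x + 2)" using 0 p by simp
      ultimately show ?thesis using init p by (simp add: X_def)
    qed
  next
    case (Suc t)
    then have t: "t < steps x" by simp
    obtain r w m where e: "RS ! idx t ! j = (r, w, m)" by (cases "RS ! idx t ! j")
    have len: "length (RS ! idx t) = J" using RS(1) idx(1)[OF t] by simp
    note fire = idx(2)[OF t] Xneg[of t "mid x" "fire (idx t)"]
    have sh: "shift m \<le> 2" by (rule shift_le)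
    show ?case
    proof (cases "p + 1 = mid x + shift m")
      case True
      then have "X (Suc t) p (cell j w)"
      proof -
        have "\<beta> (Suc (node x t (mid x) (fire (idx t)))) \<or> X (Suc t) (steps x + shift m) (cell j w)"
          unfolding X_def by (rule step_write[OF t idx(1)[OF t] \<open>j < J\<close> e])
        moreover have "steps x + shift m = p" using True by (simp add: mid_def)
        ultimately show ?thesis using fire t mid idx(1)[OF t] by simp
      qed
      then show ?thesis
        using apply_rule_mid[OF len \<open>j < J\<close> e, of "cf t" p x] True
        by (simp add: cf)
    next
      case False
      \<comment> \<open>Column q of row t moves to column p. The window keeps p \<ge> 2, so the
        subtraction is exact, and q is not the head column, so a copy clause applies.\<close>
      define q where "q = p + 1 - shift m"
      have q: "p + 1 = q + shift m" "q \<noteq> mid x" using Suc.prems sh t False by (auto simp: q_def mid_def)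
      have val: "cf (Suc t) j (int p - int (mid x)) = cf t j (int q - int (mid x))"
      proof -
        have "int p + 1 - int (shift m) = int q" using q(1) by simp
        then show ?thesis using apply_rule_mid[OF len \<open>j < J\<close> e, of "cf t" p x] q(2) by (simp add: cf)
      qed
      have q2: "mid x \<le> q + (steps x - t)" "q \<le> mid x + (steps x - t)"
        using Suc.prems q(1) sh t by auto
      have IH: "X t q (cell j (cf t j (int q - int (mid x))))"
        by (rule Suc.IH) (use t \<open>j < J\<close> q2 in auto)
      define s where "s = cf t j (int q - int (mid x))"
      have s: "s < S" using symb[of t j] t \<open>j < J\<close> by (simp add: s_def)
      have q1: "1 \<le> q" using q2 by (simp add: mid_def)
      then obtain q' where q': "q = Suc q'" by (cases q) auto
      have tgt: "q' + shift m = p" using q(1) q' by simp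
      have "q' < steps x \<or> (\<exists>p'<steps x + length x. q' = mid x + p')"
      proof (cases "q' < steps x")
        case False
        then have "mid x \<le> q'" using q(2) q' by (simp add: mid_def)
        then obtain p' where "q' = mid x + p'" by (metis le_Suc_ex)
        then show ?thesis using q2 q' by (intro disjI2 exI[of _ p']) auto
      qed simp
      moreover have "q < cols x" using q2 by (simp add: cols_def mid_def)
      moreover have "\<beta> (Suc (node x t (mid x) (fire (idx t)))) \<or> \<beta> (Suc (node x t (Suc q') (cell j s))) \<or>
          \<beta> (node x (Suc t) (q' + shift (snd (snd (RS ! idx t ! j)))) (cell j s))"
        by (rule step_copy[OF t idx(1)[OF t] \<open>j < J\<close> s calculation(1)])
      ultimately have "X (Suc t) p (cell j s)"
        using fire idx(1)[OF t] t mid IH s_def Xneg[of t q "cell j s"] \<open>j < J\<close> s q' e tgt by (auto simp: X_def)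
      then show ?thesis by (simp add: val s_def)
    qed
  qed
  have at_head: "X t (mid x) (cell j (cf t j 0))" if "t \<le> steps x" "j < J" for t j
    using cells[of t j "mid x"] that by simp
  have enabled: "enabled (RS ! idx t) (cf t)" if t: "t < steps x" for t
  proof -
    have "cf t j 0 = fst (RS ! idx t ! j)" if j: "j < J" for j
    proof (rule ccontr)
      assume ne: "cf t j 0 \<noteq> fst (RS ! idx t ! j)"
      have "cf t j 0 < S" using symb t j by simp
      then have "\<beta> (Suc (node x t (mid x) (fire (idx t)))) \<or> \<beta> (Suc (node x t (mid x) (cell j (cf t j 0))))"
        using step_read[OF t idx(1)[OF t] j] ne by simp
      then show False
        using Xneg[of t "mid x" "fire (idx t)"] Xneg[of t "mid x" "cell j (cf t j 0)"]
          idx[OF t] at_head[of t j] t j mid \<open>cf t j 0 < S\<close> by simp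
    qed
    then show ?thesis using RS(1) idx(1)[OF t] by (simp add: enabled_def)
  qed
  have "cf (steps x) 0 0 = acc"
  proof (rule ccontr)
    assume "cf (steps x) 0 0 \<noteq> acc"
    moreover have "cf (steps x) 0 0 < S" using symb J by simp
    ultimately have "\<beta> (Suc (node x (steps x) (mid x) (cell 0 (cf (steps x) 0 0))))"
      using all(3)[unfolded all_end_prog[of env x, OF env] Let_def split] by blast
    then show False
      using Xneg[of "steps x" "mid x" "cell 0 (cf (steps x) 0 0)"] at_head[of "steps x" 0] mid J
        \<open>cf (steps x) 0 0 < S\<close> by simp
  qed
  moreover have "(rule_step (set RS) ^^ steps x) (rinit x) (cf (steps x))"
    unfolding relpowp_fun_conv using cf enabled idx(1)
    by (intro exI[of _ cf]) (auto simp: rule_step_def intro!: bexI[OF _ nth_mem])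
  ultimately show ?thesis by (auto simp: reaches_def)
qed

section \<open>From an accepting run to a satisfying assignment\<close>

lemma node_decode:
  assumes "p < cols x" "c < K"
  shows "(node x t p c div 2 - 1) mod K = c" "(node x t p c div 2 - 1) div K mod cols x = p"
    "(node x t p c div 2 - 1) div K div cols x = t" "even (node x t p c)" "2 \<le> node x t p c"
proof -
  have "node x t p c div 2 - 1 = (t * cols x + p) * K + c" by (simp add: node_def)
  then show "(node x t p c div 2 - 1) mod K = c" "(node x t p c div 2 - 1) div K mod cols x = p"
    "(node x t p c div 2 - 1) div K div cols x = t"
    using assms by auto
qed (simp_all add: node_def)

lemma tableau_complete:
  assumes env: "env 0 = length x" and "reaches (set RS) acc x (steps x)"
  shows "satisfiable (vars_used x) (clauses x 1 env tableau_prog)"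
proof -
  obtain cf where cf0: "cf 0 = rinit x" and cfT: "cf (steps x) 0 0 = acc"
    and "\<And>t. t < steps x \<Longrightarrow> rule_step (set RS) (cf t) (cf (Suc t))"
    using assms(2) unfolding reaches_def relpowp_fun_conv by auto
  then have "\<exists>l<L. enabled (RS ! l) (cf t) \<and> cf (Suc t) = apply_rule (RS ! l) (cf t)" if "t < steps x" for t
    using that unfolding rule_step_def by (metis in_set_conv_nth)
  then obtain idx where idx: "\<And>t. t < steps x \<Longrightarrow> idx t < L"
    "\<And>t. t < steps x \<Longrightarrow> enabled (RS ! idx t) (cf t)"
    "\<And>t. t < steps x \<Longrightarrow> cf (Suc t) = apply_rule (RS ! idx t) (cf t)" by metis
  \<comment> \<open>\<open>later l\<close> becomes l \<le> \<open>idx t\<close>, so the chain of the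
    choice clauses stops right after the rule that fires. Cells are true to the run at every offset,
    also outside the window used for soundness.\<close>
  define val where "val t p c \<longleftrightarrow>
    (if c < J * S then cf t (c div S) (int p - int (mid x)) = c mod S
     else if c < J * S + L then c - J * S = idx t else c - J * S - L \<le> idx t)" for t p c
  \<comment> \<open>Nodes are decoded by division: u div 2 - 1 undoes the offset reserved for the
    roots, and the parity of u tells a literal from its negation.\<close>
  define \<beta> where "\<beta> u \<longleftrightarrow> (if u < 2 then u = 0
    else let v = u div 2 - 1 in val (v div K div cols x) (v div K mod cols x) (v mod K) = even u)" for u
  have \<beta>: "\<beta> (node x t p c) = val t p c" "\<beta> (Suc (node x t p c)) = (\<not> val t p c)"
    if "p < cols x" "c < K" for t p c
  proof -
    have "Suc (node x t p c) div 2 = node x t p c div 2" using node_decode(4)[OF that] by simp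
    then show "\<beta> (node x t p c) = val t p c" "\<beta> (Suc (node x t p c)) = (\<not> val t p c)"
      using node_decode[OF that, of t] by (simp_all add: \<beta>_def Let_def)
  qed
  have \<beta>neg: "\<beta> (2 * w + 1) = (\<not> \<beta> (2 * w))" for w
    by (cases w) (auto simp: \<beta>_def Let_def)
  have cell: "val t p (cell j s) \<longleftrightarrow> cf t j (int p - int (mid x)) = s" if "j < J" "s < S" for t p j s
    using cell_less[OF that] that by (simp add: val_def) (simp add: cell_def)
  have fire: "val t p (fire l) \<longleftrightarrow> l = idx t" if "l < L" for t p l
    using that by (simp add: val_def fire_def)
  have later: "val t p (later l) \<longleftrightarrow> l \<le> idx t" if "l \<le> L" for t p l
    using that by (simp add: val_def later_def)
  have mid: "mid x < cols x" by (simp add: mid_def cols_def)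
  have symb: "symb x i j < S" for i j :: nat using S by (auto simp: symb_def)
  let ?P = "\<lambda>(a, b, c). \<beta> a \<or> \<beta> b \<or> \<beta> c"
  have "all_clauses ?P x 1 env init_prog"
  proof -
    have "\<beta> (node x 0 p (cell j 0))" if "p < mid x" "j < J" for p j
      using that S \<beta>(1)[of p "cell j 0" 0] cell[of j 0 0 p] mid
      by (auto simp: cf0 rinit_def tape_word_def)
    moreover have "\<beta> (node x 0 (mid x + i) (cell j (symb x i j)))"
      if "i < length x + (steps x + 2)" "j < J" for i j
    proof -
      have "mid x + i < cols x" using that by (simp add: mid_def cols_def)
      then show ?thesis
        using that symb[of i j] \<beta>(1)[of "mid x + i" "cell j (symb x i j)" 0] cell[of j "symb x i j" 0 "mid x + i"]
        by (simp add: cf0 rinit_def tape_word_def) (simp add: symb_def)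
    qed
    ultimately show ?thesis unfolding all_init_prog[of env x, OF env] Let_def by simp
  qed
  moreover have "all_clauses ?P x 1 env end_prog"
    unfolding all_end_prog[of env x, OF env] Let_def
    using \<beta>(2)[of "mid x" _ "steps x"] cell[of 0 _ "steps x" "mid x"] cfT mid J by auto
  moreover have "all_clauses ?P x 1 env step_prog"
  proof -
    have "\<beta> (node x t (mid x) (later 0))" if "t < steps x" for t
      using \<beta>(1)[OF mid, of "later 0" t] later[of 0] by simp
    moreover have "\<beta> (Suc (node x t (mid x) (later L)))" if "t < steps x" for t
      using \<beta>(2)[OF mid, of "later L" t] later[of L] idx(1)[OF that] by simp
    moreover have "\<beta> (Suc (node x t (mid x) (later l))) \<or> \<beta> (node x t (mid x) (fire l)) \<or>
        \<beta> (node x t (mid x) (later (Suc l)))" if "t < steps x" "l < L" for t l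
      using \<beta>(2)[OF mid, of "later l" t] \<beta>(1)[OF mid, of "later (Suc l)" t] \<beta>(1)[OF mid, of "fire l" t]
        later[of l] later[of "Suc l"] fire[of l] that by auto
    moreover have "\<beta> (Suc (node x t (mid x) (fire l))) \<or> \<beta> (Suc (node x t (mid x) (cell j s)))"
      if t: "t < steps x" and "l < L" "j < J" "s < S" "s \<noteq> fst (RS ! l ! j)" for t l j s
    proof -
      have "l = idx t \<Longrightarrow> cf t j 0 \<noteq> s"
        using idx(2)[OF t] RS(1)[of "RS ! l"] that by (auto simp: enabled_def)
      then show ?thesis
        using \<beta>(2)[OF mid, of "fire l" t] \<beta>(2)[OF mid, of "cell j s" t] fire[of l] cell[of j s] that by simp
    qed
    moreover have "\<beta> (Suc (node x t (mid x) (fire l))) \<or> \<beta> (node x (Suc t) (steps x + shift m) (cell j w))"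
      if t: "t < steps x" and "l < L" "j < J" "RS ! l ! j = (r, w, m)" for t l j r w m
    proof -
      have "w < S" using that by (intro RS_entry)
      have "l = idx t \<Longrightarrow> cf (Suc t) j (int (steps x + shift m) - int (mid x)) = w"
        using idx(3)[OF t] apply_rule_mid[of "RS ! l" j r w m "cf t" "steps x + shift m" x] RS(1)[of "RS ! l"] that
        by (simp add: mid_def)
      moreover have "steps x + shift m < cols x" using shift_le[of m] by (simp add: cols_def)
      ultimately show ?thesis
        using \<beta>(2)[OF mid, of "fire l" t] \<beta>(1)[of "steps x + shift m" "cell j w" "Suc t"]
          fire[of l] cell[of j w] that \<open>w < S\<close> by auto
    qed
    \<comment> \<open>The copy clauses on both sides of the head are instances; excluding the head
      column keeps the written symbol apart.\<close>
    moreover have copy: "\<beta> (Suc (node x t (mid x) (fire l))) \<or> \<beta> (Suc (node x t (Suc p) (cell j s))) \<or>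
        \<beta> (node x (Suc t) (p + shift (snd (snd (RS ! l ! j)))) (cell j s))"
      if t: "t < steps x" and "l < L" "j < J" "s < S" "p \<le> 2 * steps x + length x" "Suc p \<noteq> mid x" for t l j s p
    proof -
      obtain r w m where e: "RS ! l ! j = (r, w, m)" by (cases "RS ! l ! j")
      have "l = idx t \<Longrightarrow> cf (Suc t) j (int (p + shift m) - int (mid x)) = cf t j (int (Suc p) - int (mid x))"
        using idx(3)[OF t] apply_rule_mid[of "RS ! l" j r w m "cf t" "p + shift m" x] RS(1)[of "RS ! l"] that e
        by (simp add: algebra_simps)
      moreover have "p + shift m < cols x" "Suc p < cols x" using shift_le[of m] that by (auto simp: cols_def)
      ultimately show ?thesis
        using \<beta>(2)[OF mid, of "fire l" t] \<beta>(1)[of "p + shift m" "cell j s" "Suc t"] \<beta>(2)[of "Suc p" "cell j s" t]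
          fire[of l] cell[of j s] that e by auto
    qed
    moreover have "\<beta> (Suc (node x t (mid x) (fire l))) \<or> \<beta> (Suc (node x t (Suc p) (cell j s))) \<or>
        \<beta> (node x (Suc t) (p + shift (snd (snd (RS ! l ! j)))) (cell j s))"
      if "t < steps x" "l < L" "j < J" "s < S" "p < steps x" for t l j s p
      using that by (intro copy) (auto simp: mid_def)
    moreover have "\<beta> (Suc (node x t (mid x) (fire l))) \<or> \<beta> (Suc (node x t (Suc (mid x + p)) (cell j s))) \<or>
        \<beta> (node x (Suc t) (mid x + p + shift (snd (snd (RS ! l ! j)))) (cell j s))"
      if "t < steps x" "l < L" "j < J" "s < S" "p < steps x + length x" for t l j s p
      using that by (intro copy) (auto simp: mid_def)
    ultimately show ?thesis
      unfolding all_step_prog[of env x, OF env] Let_def split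
      by (simp split: prod.splits)
  qed
  ultimately have "\<forall>t\<in>set (clauses x 1 env tableau_prog). ?P t"
    by (auto simp: tableau_prog_def all_clauses_def CList_def)
  moreover have "\<beta> 0" by (simp add: \<beta>_def)
  ultimately show ?thesis using \<beta>neg unfolding satisfiable_def by (intro exI[of _ \<beta>]) auto
qed

end

section \<open>Turing machines as rule machines\<close>

text \<open>The state is a symbol on a tape whose head never moves, so a state change is a
  write.\<close>

fun trans_rule :: "nat \<times> nat list \<times> nat \<times> (nat \<times> move) list \<Rightarrow> rule" where
  "trans_rule (q, rs, q', as) = (q, q', Stay) # zip rs as"

fun rconf :: "config \<Rightarrow> rconfig" where
  "rconf (q, ts) j i =
     (if j = 0 then if i = 0 then q else 0
      else if j \<le> length ts then fst (ts ! (j - 1)) (i + snd (ts ! (j - 1))) else 0)"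

lemma rconf_init: "0 < k \<Longrightarrow> rconf (init_config k x) = rinit x"
  by (intro ext) (auto simp: init_config_def rinit_def nth_Cons split: nat.splits)

lemma read_tape_eq: "read_tape t = fst t (snd t)"
  by (cases t) simp

lemma move_head_shift: "move_head d h = h + 1 - int (shift d)"
  by (cases d) auto

lemma act_tape_eq: "act_tape a t = ((fst t)(snd t := fst a), snd t + 1 - int (shift (snd a)))"
  by (cases a; cases t) (auto simp: move_head_shift)

lemma enabled_trans_rule:
  assumes "length ts = k" "length rs = k" "length as = k"
  shows "enabled (trans_rule (q, rs, q', as)) (rconf (q0, ts)) \<longleftrightarrow> q0 = q \<and> map read_tape ts = rs"
proof -
  have "enabled (trans_rule (q, rs, q', as)) (rconf (q0, ts)) \<longleftrightarrow>
      q0 = q \<and> (\<forall>j<k. fst (ts ! j) (snd (ts ! j)) = rs ! j)"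
    using assms by (auto simp: enabled_def less_Suc_eq_0_disj)
  then show ?thesis using assms by (auto simp: list_eq_iff_nth_eq read_tape_eq)
qed

lemma apply_trans_rule:
  assumes "length ts = k" "length rs = k" "length as = k"
  shows "apply_rule (trans_rule (q, rs, q', as)) (rconf (q0, ts)) = rconf (q', map2 act_tape as ts)"
proof (intro ext)
  fix j i
  consider "j = 0" | j' where "j = Suc j'" "j' < k" | "j > k" by (metis less_Suc_eq_0_disj not_less_eq)
  then show "apply_rule (trans_rule (q, rs, q', as)) (rconf (q0, ts)) j i = rconf (q', map2 act_tape as ts) j i"
  proof cases
    case 2
    then show ?thesis using assms by (auto simp: apply_rule_def Let_def act_tape_eq algebra_simps)
  qed (use assms in \<open>auto simp: apply_rule_def\<close>)
qed

definition wf_trans :: "nat \<Rightarrow> tm \<Rightarrow> bool" where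
  "wf_trans k M \<longleftrightarrow> (\<forall>(q, rs, q', as) \<in> M. length rs = k \<and> length as = k)"

lemma wf_transD: "wf_trans k M \<Longrightarrow> (q, rs, q', as) \<in> M \<Longrightarrow> length rs = k \<and> length as = k"
  unfolding wf_trans_def by (drule (1) bspec) simp

lemma wf_transI:
  assumes "\<And>q rs q' as. (q, rs, q', as) \<in> M \<Longrightarrow> length rs = k \<and> length as = k"
  shows "wf_trans k M"
  unfolding wf_trans_def
proof
  fix t assume "t \<in> M"
  then show "case t of (q, rs, q', as) \<Rightarrow> length rs = k \<and> length as = k"
    using assms by (cases t) simp
qed

lemma tm_step_length: "wf_trans k M \<Longrightarrow> tm_step M c c' \<Longrightarrow> length (snd c) = k \<and> length (snd c') = k"
  by (fastforce simp: wf_trans_def tm_step_def)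

lemma rule_step_rconf:
  assumes "wf_trans k M" "length (snd c) = k"
  shows "rule_step (trans_rule ` M) (rconf c) d \<longleftrightarrow> (\<exists>c'. tm_step M c c' \<and> d = rconf c')"
proof -
  obtain q ts where c: "c = (q, ts)" "length ts = k" using assms(2) by (cases c) auto
  show ?thesis
  proof
    assume "rule_step (trans_rule ` M) (rconf c) d"
    then obtain q1 rs q' as where t: "(q1, rs, q', as) \<in> M" "enabled (trans_rule (q1, rs, q', as)) (rconf c)"
      "d = apply_rule (trans_rule (q1, rs, q', as)) (rconf c)" by (force simp: rule_step_def)
    then have len: "length rs = k" "length as = k" using assms(1) by (auto simp: wf_trans_def)
    then have "tm_step M c (q', map2 act_tape as ts)"
      using t enabled_trans_rule[OF c(2) len] c by (auto simp: tm_step_def)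
    then show "\<exists>c'. tm_step M c c' \<and> d = rconf c'"
      using t(3) apply_trans_rule[OF c(2) len] c by auto
  next
    assume "\<exists>c'. tm_step M c c' \<and> d = rconf c'"
    then obtain q' as where t: "(q, map read_tape ts, q', as) \<in> M" "d = rconf (q', map2 act_tape as ts)"
      using c by (force simp: tm_step_def)
    then have len: "length (map read_tape ts) = k" "length as = k" using assms(1) by (auto simp: wf_trans_def)
    show "rule_step (trans_rule ` M) (rconf c) d"
      unfolding rule_step_def
      by (rule bexI[of _ "trans_rule (q, map read_tape ts, q', as)"])
        (use t enabled_trans_rule[OF c(2) len] apply_trans_rule[OF c(2) len] c in \<open>auto simp del: trans_rule.simps\<close>)
  qed
qed

text \<open>\<open>rconf\<close> forgets the absolute head positions and is not injective, so runs
  are matched up to a choice of \<open>c'\<close>. Reachable configurations keep k tapes, as the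
  one-step lemma requires.\<close>

lemma rule_steps_rconf:
  assumes "wf_trans k M" "length (snd c) = k"
  shows "(rule_step (trans_rule ` M) ^^ n) (rconf c) d \<longleftrightarrow> (\<exists>c'. (tm_step M ^^ n) c c' \<and> d = rconf c')"
proof -
  have len: "length (snd c') = k" if "(tm_step M ^^ n) c c'" for n c'
  proof (cases n)
    case (Suc m)
    then have "(tm_step M ^^ Suc m) c c'" using that by simp
    then obtain c1 where "tm_step M c1 c'" by (rule relpowp_Suc_E)
    then show ?thesis using tm_step_length[OF assms(1)] by blast
  qed (use that assms(2) in simp)
  show ?thesis
  proof (induction n arbitrary: d)
    case (Suc n)
    have "(rule_step (trans_rule ` M) ^^ Suc n) (rconf c) d \<longleftrightarrow>
        (\<exists>c1. (tm_step M ^^ n) c c1 \<and> rule_step (trans_rule ` M) (rconf c1) d)"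
      unfolding relpowp.simps relcompp_apply Suc by blast
    also have "\<dots> \<longleftrightarrow> (\<exists>c'. (tm_step M ^^ Suc n) c c' \<and> d = rconf c')"
      unfolding relpowp.simps relcompp_apply using rule_step_rconf[OF assms(1) len] by blast
    finally show ?case .
  qed auto
qed

lemma tm_step_mono: "M \<subseteq> M' \<Longrightarrow> tm_step M c c' \<Longrightarrow> tm_step M' c c'"
  by (auto simp: tm_step_def)

lemma tm_steps_mono: "M \<subseteq> M' \<Longrightarrow> (tm_step M ^^ n) c c' \<Longrightarrow> (tm_step M' ^^ n) c c'"
  using relpowp_mono[of "tm_step M" "tm_step M'"] tm_step_mono by blast

lemma halted_iff: "halted M c \<longleftrightarrow> (\<forall>q' as. (fst c, map read_tape (snd c), q', as) \<notin> M)"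
  by (auto simp: halted_def tm_step_def)

section \<open>Acceptance at a fixed time\<close>

definition stay :: "nat list \<Rightarrow> (nat \<times> move) list" where
  "stay rs = map (\<lambda>r. (r, Stay)) rs"

lemma act_stay: "map2 act_tape (stay (map read_tape ts)) ts = ts"
  by (rule nth_equalityI) (auto simp: stay_def act_tape_eq read_tape_eq)

text \<open>The machine that waits in the fresh state \<open>B\<close> once \<open>M\<close> has accepted.\<close>

definition wait_machine :: "nat \<Rightarrow> nat \<Rightarrow> tm \<Rightarrow> tm" where
  "wait_machine k B M = M \<union>
     (\<lambda>rs. (1, rs, B, stay rs)) ` {rs. set rs \<subseteq> {..<B} \<and> length rs = k \<and> (\<forall>q' as. (1, rs, q', as) \<notin> M)} \<union>
     (\<lambda>rs. (B, rs, B, stay rs)) ` {rs. set rs \<subseteq> {..<B} \<and> length rs = k}"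

lemma wait_machineD:
  assumes "(q, rs, q', as) \<in> wait_machine k B M"
  shows "(q, rs, q', as) \<in> M \<or>
    (q = 1 \<or> q = B) \<and> q' = B \<and> set rs \<subseteq> {..<B} \<and> length rs = k \<and> as = stay rs"
  using assms unfolding wait_machine_def by blast

definition bounded_tm :: "nat \<Rightarrow> tm \<Rightarrow> bool" where
  "bounded_tm B M \<longleftrightarrow> (\<forall>(q, rs, q', as) \<in> M. q < B \<and> q' < B \<and> set rs \<subseteq> {..<B} \<and> fst ` set as \<subseteq> {..<B})"

lemma bounded_tmD:
  assumes "bounded_tm B M" "(q, rs, q', as) \<in> M"
  shows "q < B \<and> q' < B \<and> set rs \<subseteq> {..<B} \<and> fst ` set as \<subseteq> {..<B}"
  using bspec[OF assms(1)[unfolded bounded_tm_def] assms(2)] by simp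

lemma bounded_tmI:
  assumes "\<And>q rs q' as. (q, rs, q', as) \<in> M \<Longrightarrow>
    q < B \<and> q' < B \<and> set rs \<subseteq> {..<B} \<and> fst ` set as \<subseteq> {..<B}"
  shows "bounded_tm B M"
  unfolding bounded_tm_def
proof
  fix t assume "t \<in> M"
  then show "case t of (q, rs, q', as) \<Rightarrow> q < B \<and> q' < B \<and> set rs \<subseteq> {..<B} \<and> fst ` set as \<subseteq> {..<B}"
    using assms by (cases t) simp
qed

text \<open>Waiting transitions exist only for words over {..<B}, which keeps the machine finite;
  this invariant makes them applicable.\<close>

definition bounded_config :: "nat \<Rightarrow> nat \<Rightarrow> config \<Rightarrow> bool" where
  "bounded_config k B c \<longleftrightarrow> length (snd c) = k \<and> fst c < B \<and> (\<forall>t \<in> set (snd c). \<forall>i. fst t i < B)"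

lemma bounded_config_step:
  assumes "wf_trans k M" "bounded_tm B M" "bounded_config k B c" "tm_step M c c'"
  shows "bounded_config k B c'"
proof -
  obtain as where as: "(fst c, map read_tape (snd c), fst c', as) \<in> M" "snd c' = map2 act_tape as (snd c)"
    using assms(4) by (auto simp: tm_step_def)
  then have b: "fst c' < B" "\<And>a. a \<in> set as \<Longrightarrow> fst a < B" using assms(2) by (fastforce simp: bounded_tm_def)+
  have "fst (act_tape a t) i < B" if "a \<in> set as" "t \<in> set (snd c)" for a t i
    using that b(2)[of a] assms(3) by (auto simp: bounded_config_def act_tape_eq)
  moreover have "\<exists>a\<in>set as. \<exists>t\<in>set (snd c). u = act_tape a t" if "u \<in> set (snd c')" for u
    using that as(2) by (auto dest: set_zip_leftD set_zip_rightD)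
  ultimately show ?thesis using b(1) tm_step_length[OF assms(1,4)] by (fastforce simp: bounded_config_def)
qed

lemma bounded_init: "0 < k \<Longrightarrow> 3 \<le> B \<Longrightarrow> bounded_config k B (init_config k x)"
  by (auto simp: bounded_config_def init_config_def tape_word_def)

lemma bounded_reads: "bounded_config k B c \<Longrightarrow> set (map read_tape (snd c)) \<subseteq> {..<B} \<and> length (map read_tape (snd c)) = k"
  by (fastforce simp: bounded_config_def)

text \<open>A run accepting after m \<le> n steps enters B in one step and waits there for n - m
  more, so acceptance shows at time n + 1 exactly. Conversely, a step that M cannot make starts in B
  or in an accepting halted configuration.\<close>

lemma wait_machine_accepts:
  assumes wf: "wf_trans k M" and "0 < k" and B: "3 \<le> B" "bounded_tm B M"
    and bound: "\<And>m c. (tm_step M ^^ m) (init_config k x) c \<Longrightarrow> m \<le> n"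
  shows "(\<exists>m c. (tm_step M ^^ m) (init_config k x) c \<and> halted M c \<and> fst c = 1) \<longleftrightarrow>
    (\<exists>c. (tm_step (wait_machine k B M) ^^ Suc n) (init_config k x) c \<and> fst c = B)"
    (is "?acc \<longleftrightarrow> ?wait")
proof
  let ?W = "wait_machine k B M"
  have inv: "bounded_config k B c" if "(tm_step M ^^ m) (init_config k x) c" for m c
    using that
  proof (induction m arbitrary: c)
    case (Suc m)
    then obtain c1 where "(tm_step M ^^ m) (init_config k x) c1" "tm_step M c1 c" by auto
    then show ?case using Suc.IH bounded_config_step[OF wf B(2)] by blast
  qed (use bounded_init[OF \<open>0 < k\<close> B(1)] in simp)
  {
    assume ?acc
    then obtain m c where c: "(tm_step M ^^ m) (init_config k x) c" "halted M c" "fst c = 1" by blast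
    have b: "bounded_config k B c" by (rule inv[OF c(1)])
    obtain ts where ts: "c = (1, ts)" using c(3) by (cases c) auto
    have reads: "set (map read_tape ts) \<subseteq> {..<B}" "length (map read_tape ts) = k"
      using bounded_reads[OF b] ts by auto
    have 1: "tm_step ?W c (B, ts)"
    proof -
      have "(1, map read_tape ts, B, stay (map read_tape ts)) \<in> ?W"
        unfolding wait_machine_def using reads c(2) ts
        by (intro UnI1 UnI2 image_eqI[of _ _ "map read_tape ts"]) (auto simp: halted_iff)
      then show ?thesis using ts by (auto simp: tm_step_def act_stay)
    qed
    have "tm_step ?W (B, ts) (B, ts)"
    proof -
      have "(B, map read_tape ts, B, stay (map read_tape ts)) \<in> ?W"
        unfolding wait_machine_def using reads by (intro UnI2 image_eqI[of _ _ "map read_tape ts"]) auto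
      then show ?thesis by (auto simp: tm_step_def act_stay)
    qed
    then have "(tm_step ?W ^^ i) (B, ts) (B, ts)" for i by (induction i) auto
    moreover have "(tm_step ?W ^^ m) (init_config k x) c"
      by (rule tm_steps_mono[OF _ c(1)]) (auto simp: wait_machine_def)
    ultimately have "(tm_step ?W ^^ (Suc m + (n - m))) (init_config k x) (B, ts)"
      using 1 unfolding relpowp_add by auto
    moreover have "Suc m + (n - m) = Suc n" using bound[OF c(1)] by simp
    ultimately show ?wait by (metis fst_conv)
  }
  {
    assume ?wait
    then obtain c where c: "(tm_step ?W ^^ Suc n) (init_config k x) c" "fst c = B" by blast
    \<comment> \<open>A run either still follows M or has passed through an accepting configuration
      of M.\<close>
    have "(tm_step ?W ^^ m) (init_config k x) c \<Longrightarrow>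
        (fst c = B \<and> ?acc) \<or> (tm_step M ^^ m) (init_config k x) c" for m c
    proof (induction m arbitrary: c)
      case (Suc m)
      then obtain c1 where c1: "(tm_step ?W ^^ m) (init_config k x) c1" "tm_step ?W c1 c" by auto
      show ?case
      proof (cases "fst c1 = B")
        case True
        then have "\<not> (tm_step M ^^ m) (init_config k x) c1" using inv[of m c1] by (auto simp: bounded_config_def)
        then have ?acc using Suc.IH[OF c1(1)] by blast
        moreover have "fst c = B"
        proof -
          obtain as where "(B, map read_tape (snd c1), fst c, as) \<in> ?W" using c1(2) True by (auto simp: tm_step_def)
          moreover have "(B, map read_tape (snd c1), fst c, as) \<notin> M" using B(2) by (auto simp: bounded_tm_def)
          ultimately show ?thesis using B(1) by (auto simp: wait_machine_def)
        qed
        ultimately show ?thesis by blast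
      next
        case False
        then have M: "(tm_step M ^^ m) (init_config k x) c1" using Suc.IH[OF c1(1)] by blast
        show ?thesis
        proof (cases "tm_step M c1 c")
          case True
          then show ?thesis using M by auto
        next
          case nM: False
          then have "fst c1 = 1 \<and> fst c = B \<and> halted M c1"
            using c1(2) False by (auto simp: tm_step_def wait_machine_def halted_iff)
          then show ?thesis using M by blast
        qed
      qed
    qed simp
    from this[OF c(1)] show ?acc using c(2) inv[of "Suc n" c] by (auto simp: bounded_config_def)
  }
qed

lemma bounded_tm_mono:
  assumes "bounded_tm B M" "B \<le> B'"
  shows "bounded_tm B' M"
proof (rule bounded_tmI)
  fix q rs q' as assume "(q, rs, q', as) \<in> M"
  moreover have "{..<B} \<subseteq> {..<B'}" using assms(2) by auto
  ultimately show "q < B' \<and> q' < B' \<and> set rs \<subseteq> {..<B'} \<and> fst ` set as \<subseteq> {..<B'}"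
    using bounded_tmD[OF assms(1)] assms(2) by (meson order_less_le_trans subset_trans)
qed

lemma bounded_tm_exists: "finite M \<Longrightarrow> \<exists>B. bounded_tm B M"
proof (induction M rule: finite_induct)
  case (insert t M)
  then obtain B where B: "bounded_tm B M" by blast
  obtain q rs q' as where t: "t = (q, rs, q', as)" by (cases t)
  have "finite ({q, q'} \<union> set rs \<union> fst ` set as)" by simp
  then obtain B' where B': "\<forall>s \<in> {q, q'} \<union> set rs \<union> fst ` set as. s < B'"
    using finite_nat_set_iff_bounded by meson
  have "bounded_tm (max B B') M" by (rule bounded_tm_mono[OF B]) simp
  moreover have "bounded_tm (max B B') {t}"
  proof -
    have "q < B'" "q' < B'" "set rs \<subseteq> {..<B'}" "fst ` set as \<subseteq> {..<B'}" using B' by auto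
    then have "bounded_tm B' {t}" by (simp add: bounded_tm_def t)
    then show ?thesis by (rule bounded_tm_mono) simp
  qed
  ultimately show ?case by (auto simp: bounded_tm_def)
qed (auto simp: bounded_tm_def)

text \<open>One more tape holds the state, B is the accepting symbol, and one more step leads into
  B: J = k + 1, S = B + 1 and time p + 1.\<close>

theorem in_NP_rule_machine:
  assumes "in_NP A"
  obtains J S acc RS and p :: "nat poly" where
    "2 \<le> J" "3 \<le> S" "acc < S" "\<And>\<tau>. \<tau> \<in> set RS \<Longrightarrow> length \<tau> = J"
    "\<And>\<tau> r w d. \<tau> \<in> set RS \<Longrightarrow> (r, w, d) \<in> set \<tau> \<Longrightarrow> w < S"
    "\<And>x. x \<in> A \<longleftrightarrow> reaches (set RS) acc x (poly p (length x))"
proof -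
  obtain k M and p :: "nat poly" where wf: "wf_tm k M"
    and bound: "\<And>x m c. (tm_step M ^^ m) (init_config k x) c \<Longrightarrow> m \<le> poly p (length x)"
    and A: "\<And>x. x \<in> A \<longleftrightarrow> (\<exists>m c. (tm_step M ^^ m) (init_config k x) c \<and> halted M c \<and> fst c = 1)"
    using assms unfolding in_NP_def by blast
  have k: "0 < k" "finite M" "wf_trans k M" using wf by (auto simp: wf_tm_def wf_trans_def)
  obtain B where B: "3 \<le> B" "bounded_tm B M"
    using bounded_tm_exists[OF k(2)] bounded_tm_mono by (meson nat_le_linear)
  let ?W = "wait_machine k B M"
  have words: "finite {rs. set rs \<subseteq> {..<B} \<and> length rs = k}" by (rule finite_lists_length_eq) simp
  have "finite {rs. set rs \<subseteq> {..<B} \<and> length rs = k \<and> (\<forall>q' as. (1, rs, q', as) \<notin> M)}"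
    by (rule finite_subset[OF _ words]) blast
  then have "finite ?W" unfolding wait_machine_def by (intro finite_UnI finite_imageI k(2) words)
  then have "\<exists>RS. set RS = trans_rule ` ?W" by (intro finite_list finite_imageI)
  then obtain RS where RS: "set RS = trans_rule ` ?W" ..
  have wfW: "wf_trans k ?W"
  proof (rule wf_transI)
    fix q rs q' as assume "(q, rs, q', as) \<in> ?W"
    from wait_machineD[OF this] show "length rs = k \<and> length as = k"
      using wf_transD[OF k(3)] by (auto simp: stay_def)
  qed
  have bW: "bounded_tm (Suc B) ?W"
  proof (rule bounded_tmI)
    fix q rs q' as assume "(q, rs, q', as) \<in> ?W"
    from wait_machineD[OF this]
    show "q < Suc B \<and> q' < Suc B \<and> set rs \<subseteq> {..<Suc B} \<and> fst ` set as \<subseteq> {..<Suc B}"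
    proof
      assume "(q, rs, q', as) \<in> M"
      then show ?thesis using bounded_tmD[OF bounded_tm_mono[OF B(2)], of "Suc B"] by simp
    next
      assume "(q = 1 \<or> q = B) \<and> q' = B \<and> set rs \<subseteq> {..<B} \<and> length rs = k \<and> as = stay rs"
      moreover from this have "fst ` set as = set rs" by (simp add: stay_def image_image)
      moreover have "{..<B} \<subseteq> {..<Suc B}" "1 < Suc B" using B(1) by auto
      ultimately show ?thesis by auto
    qed
  qed
  show thesis
  proof (rule that[of "Suc k" "Suc B" B RS "p + 1"])
    fix \<tau> assume "\<tau> \<in> set RS"
    then obtain q rs q' as where t: "(q, rs, q', as) \<in> ?W" "\<tau> = trans_rule (q, rs, q', as)"
      using RS by force
    then show "length \<tau> = Suc k" using wf_transD[OF wfW t(1)] by simp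
    fix r w d assume "(r, w, d) \<in> set \<tau>"
    then have "w = q' \<or> (w, d) \<in> set as" using t(2) by (auto dest: set_zip_rightD)
    moreover have "q' < Suc B" "fst ` set as \<subseteq> {..<Suc B}" using bounded_tmD[OF bW t(1)] by auto
    ultimately show "w < Suc B" by auto
  next
    fix x :: "bool list"
    let ?n = "poly p (length x)"
    have len: "length (snd (init_config k x)) = k" using k(1) by (simp add: init_config_def)
    have "x \<in> A \<longleftrightarrow> (\<exists>c. (tm_step ?W ^^ Suc ?n) (init_config k x) c \<and> fst c = B)"
      unfolding A by (rule wait_machine_accepts[OF k(3,1) B bound])
    also have "\<dots> \<longleftrightarrow> (\<exists>d. (rule_step (trans_rule ` ?W) ^^ Suc ?n) (rinit x) d \<and> d 0 0 = B)"
    proof -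
      have "rconf c 0 0 = fst c" for c by (cases c) simp
      then show ?thesis
        using rule_steps_rconf[OF wfW len, of "Suc ?n"] rconf_init[OF k(1), of x] by metis
    qed
    finally show "x \<in> A \<longleftrightarrow> reaches (set RS) B x (poly (p + 1) (length x))"
      by (simp add: reaches_def RS)
  qed (use k B in auto)
qed

section \<open>Counter programs\<close>

text \<open>A state consists of the output so far, the position of the input head, and the registers.\<close>

datatype com =
    Skip
  | Inc nat
  | Dec nat
  | Out bool
  | InLeft
  | InRight
  | Seq com com
  | While nat com
  | IfIn com com

type_synonym state = "bool list \<times> nat \<times> (nat \<Rightarrow> nat)"

text \<open>Step counts are those of the compiled machine: each primitive command and each test is
  one transition. \<open>Dec\<close> at 0 and \<open>InLeft\<close> at the left end have no
  derivation, so nothing is claimed about their code.\<close>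

inductive exec :: "bool list \<Rightarrow> com \<Rightarrow> state \<Rightarrow> nat \<Rightarrow> state \<Rightarrow> bool" for x where
  Skip: "exec x Skip s 1 s"
| Inc: "exec x (Inc v) (w, i, R) 1 (w, i, R(v := Suc (R v)))"
| Dec: "0 < R v \<Longrightarrow> exec x (Dec v) (w, i, R) 1 (w, i, R(v := R v - 1))"
| Out: "exec x (Out b) (w, i, R) 1 (w @ [b], i, R)"
| InRight: "exec x InRight (w, i, R) 1 (w, Suc i, R)"
| InLeft: "exec x InLeft (w, Suc i, R) 1 (w, i, R)"
| Seq: "exec x c s m s1 \<Longrightarrow> exec x c' s1 n s2 \<Longrightarrow> exec x (Seq c c') s (m + n) s2"
| While_end: "R v = 0 \<Longrightarrow> exec x (While v c) (w, i, R) 1 (w, i, R)"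
| While_loop: "0 < R v \<Longrightarrow> exec x c (w, i, R) m s1 \<Longrightarrow> exec x (While v c) s1 n s2 \<Longrightarrow>
    exec x (While v c) (w, i, R) (1 + (m + n)) s2"
| IfIn_True: "i < length x \<and> x ! i \<Longrightarrow> exec x c (w, i, R) m s1 \<Longrightarrow>
    exec x (IfIn c c') (w, i, R) (1 + m) s1"
| IfIn_False: "\<not> (i < length x \<and> x ! i) \<Longrightarrow> exec x c' (w, i, R) m s1 \<Longrightarrow>
    exec x (IfIn c c') (w, i, R) (1 + m) s1"

fun num_regs :: "com \<Rightarrow> nat" where
  "num_regs (Inc v) = Suc v"
| "num_regs (Dec v) = Suc v"
| "num_regs (Seq c c') = max (num_regs c) (num_regs c')"
| "num_regs (While v c) = max (Suc v) (num_regs c)"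
| "num_regs (IfIn c c') = max (num_regs c) (num_regs c')"
| "num_regs _ = 0"

section \<open>Compilation to Turing machines\<close>

text \<open>
  Tape 0 is the output, tape 1 the input, and tape \<open>v + 2\<close> holds register \<open>v\<close> as the distance
  of its head from a mark.
\<close>

definition mark :: "int \<Rightarrow> nat" where
  "mark i = (if i = 0 then 1 else 0)"

fun tapes :: "nat \<Rightarrow> bool list \<Rightarrow> state \<Rightarrow> tape list" where
  "tapes K x (w, i, R) = (tape_word w, int (length w)) # (tape_word x, int i) #
     map (\<lambda>v. (mark, int (R v))) [0..<K]"

definition transitions ::
    "nat \<Rightarrow> nat \<Rightarrow> nat \<Rightarrow> (nat list \<Rightarrow> bool) \<Rightarrow> (nat list \<Rightarrow> nat \<Rightarrow> nat \<times> move) \<Rightarrow> tm" where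
  "transitions k a b P f =
     (\<lambda>rs. (a, rs, b, map (f rs) [0..<k])) ` {rs. set rs \<subseteq> {..<3} \<and> length rs = k \<and> P rs}"

definition moves :: "(nat \<Rightarrow> move) \<Rightarrow> nat list \<Rightarrow> nat \<Rightarrow> nat \<times> move" where
  "moves d rs i = (rs ! i, d i)"

definition write_bit :: "bool \<Rightarrow> nat list \<Rightarrow> nat \<Rightarrow> nat \<times> move" where
  "write_bit b rs i = (if i = 0 then (if b then 2 else 1, MoveRight) else (rs ! i, Stay))"

abbreviation "no_move \<equiv> (\<lambda>i :: nat. Stay)"

fun code_size :: "com \<Rightarrow> nat" where
  "code_size (Seq c c') = code_size c + code_size c'"
| "code_size (While v c) = Suc (code_size c)"
| "code_size (IfIn c c') = Suc (code_size c + code_size c')"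
| "code_size _ = 1"

text \<open>The code of a command is entered in state \<open>a\<close> and left in state \<open>b\<close>.\<close>

fun code :: "nat \<Rightarrow> com \<Rightarrow> nat \<Rightarrow> nat \<Rightarrow> tm" where
  "code k Skip a b = transitions k a b (\<lambda>_. True) (moves no_move)"
| "code k (Inc v) a b = transitions k a b (\<lambda>_. True) (moves (no_move(v + 2 := MoveRight)))"
| "code k (Dec v) a b = transitions k a b (\<lambda>_. True) (moves (no_move(v + 2 := MoveLeft)))"
| "code k (Out w) a b = transitions k a b (\<lambda>_. True) (write_bit w)"
| "code k InRight a b = transitions k a b (\<lambda>_. True) (moves (no_move(1 := MoveRight)))"
| "code k InLeft a b = transitions k a b (\<lambda>_. True) (moves (no_move(1 := MoveLeft)))"
| "code k (Seq c c') a b = code k c a (a + code_size c) \<union> code k c' (a + code_size c) b"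
| "code k (While v c) a b =
     transitions k a (Suc a) (\<lambda>rs. rs ! (v + 2) = 0) (moves no_move) \<union>
     transitions k a b (\<lambda>rs. rs ! (v + 2) \<noteq> 0) (moves no_move) \<union> code k c (Suc a) a"
| "code k (IfIn c c') a b =
     transitions k a (Suc a) (\<lambda>rs. rs ! 1 = 2) (moves no_move) \<union>
     transitions k a (Suc a + code_size c) (\<lambda>rs. rs ! 1 \<noteq> 2) (moves no_move) \<union>
     code k c (Suc a) b \<union> code k c' (Suc a + code_size c) b"

lemma tm_step_transitions:
  assumes "transitions k a b P f \<subseteq> M" "length ts = k" "\<And>t. t \<in> set ts \<Longrightarrow> read_tape t < 3"
    and "P (map read_tape ts)" "length ts' = k"
    and "\<And>i. i < k \<Longrightarrow> ts' ! i = act_tape (f (map read_tape ts) i) (ts ! i)"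
  shows "tm_step M (a, ts) (b, ts')"
proof -
  have "(a, map read_tape ts, b, map (f (map read_tape ts)) [0..<k]) \<in> M"
    using assms(1-4) by (force simp: transitions_def)
  moreover have "ts' = map2 act_tape (map (f (map read_tape ts)) [0..<k]) ts"
    using assms(2,5,6) by (intro nth_equalityI) auto
  ultimately show ?thesis unfolding tm_step_def by auto
qed

lemma length_tapes [simp]: "length (tapes K x s) = K + 2"
  by (cases s) simp

lemma tapes_nth [simp]:
  "tapes K x (w, i, R) ! 0 = (tape_word w, int (length w))"
  "tapes K x (w, i, R) ! Suc 0 = (tape_word x, int i)"
  "v < K \<Longrightarrow> tapes K x (w, i, R) ! Suc (Suc v) = (mark, int (R v))"
  by simp_all

lemma tape_word_less: "tape_word x i < 3"
  by (simp add: tape_word_def)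

lemma read_tapes: "t \<in> set (tapes K x s) \<Longrightarrow> read_tape t < 3"
  by (cases s) (auto simp: tape_word_less mark_def)

lemma all_tapes: "(\<forall>i<K + 2. Q i) \<longleftrightarrow> Q 0 \<and> Q (Suc 0) \<and> (\<forall>v<K. Q (Suc (Suc v)))"
  by (auto simp: less_Suc_eq_0_disj)

lemma act_moves: "act_tape (moves d (map read_tape ts) i) (ts ! i) = (fst (ts ! i), move_head (d i) (snd (ts ! i)))"
  if "i < length ts"
  using that by (cases "ts ! i") (auto simp: moves_def)

lemma tape_word_snoc:
  "(tape_word w)(int (length w) := (if b then 2 else 1)) = tape_word (w @ [b])"
  by (auto simp: tape_word_def fun_eq_iff nth_append)

lemma tm_step_tapes:
  assumes "transitions (K + 2) a b P f \<subseteq> M" "P (map read_tape (tapes K x s))"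
    and "\<And>i. i = 0 \<or> i = Suc 0 \<or> (\<exists>v<K. i = Suc (Suc v)) \<Longrightarrow>
      tapes K x s' ! i = act_tape (f (map read_tape (tapes K x s)) i) (tapes K x s ! i)"
  shows "tm_step M (a, tapes K x s) (b, tapes K x s')"
proof (rule tm_step_transitions[OF assms(1)])
  have "\<forall>i<K + 2. tapes K x s' ! i = act_tape (f (map read_tape (tapes K x s)) i) (tapes K x s ! i)"
    unfolding all_tapes using assms(3) by blast
  then show "tapes K x s' ! i = act_tape (f (map read_tape (tapes K x s)) i) (tapes K x s ! i)"
    if "i < K + 2" for i using that by blast
qed (use assms(2) read_tapes in auto)

lemma tm_step_moves:
  assumes "transitions (K + 2) a b P (moves d) \<subseteq> M" "P (map read_tape (tapes K x s))"
    and "\<And>i. i = 0 \<or> i = Suc 0 \<or> (\<exists>v<K. i = Suc (Suc v)) \<Longrightarrow>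
      tapes K x s' ! i = (fst (tapes K x s ! i), move_head (d i) (snd (tapes K x s ! i)))"
  shows "tm_step M (a, tapes K x s) (b, tapes K x s')"
proof (rule tm_step_tapes[OF assms(1,2)])
  fix i assume i: "i = 0 \<or> i = Suc 0 \<or> (\<exists>v<K. i = Suc (Suc v))"
  then have "i < length (tapes K x s)" by auto
  then show "tapes K x s' ! i = act_tape (moves d (map read_tape (tapes K x s)) i) (tapes K x s ! i)"
    by (simp add: act_moves assms(3)[OF i])
qed

lemma tm_step_no_move:
  assumes "transitions (K + 2) a b P (moves no_move) \<subseteq> M" "P (map read_tape (tapes K x s))"
  shows "tm_step M (a, tapes K x s) (b, tapes K x s)"
  by (rule tm_step_moves[OF assms]) simp

text \<open>M is any machine containing the code, so the induction applies to fragments inside a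
  larger machine.\<close>

theorem exec_code:
  assumes "exec x c s n s'" "num_regs c \<le> K" "code (K + 2) c a b \<subseteq> M"
  shows "(tm_step M ^^ n) (a, tapes K x s) (b, tapes K x s')"
  using assms
proof (induction arbitrary: a b rule: exec.induct)
  case (Skip s)
  then have "tm_step M (a, tapes K x s) (b, tapes K x s)"
    by (intro tm_step_no_move[where P="\<lambda>_. True"]) auto
  then show ?case unfolding relpowp_1 .
next
  case (Inc v w i R)
  then have "tm_step M (a, tapes K x (w, i, R)) (b, tapes K x (w, i, R(v := Suc (R v))))"
    by (intro tm_step_moves[where P="\<lambda>_. True" and d="no_move(v + 2 := MoveRight)"])
      (auto split: if_splits simp del: tapes.simps)
  then show ?case unfolding relpowp_1 .
next
  case (Dec R v w i)
  then have "tm_step M (a, tapes K x (w, i, R)) (b, tapes K x (w, i, R(v := R v - 1)))"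
    by (intro tm_step_moves[where P="\<lambda>_. True" and d="no_move(v + 2 := MoveLeft)"])
      (auto split: if_splits simp del: tapes.simps)
  then show ?case unfolding relpowp_1 .
next
  case (Out u w i R)
  then have "tm_step M (a, tapes K x (w, i, R)) (b, tapes K x (w @ [u], i, R))"
    by (intro tm_step_tapes[where P="\<lambda>_. True" and f="write_bit u"])
      (auto simp: write_bit_def tape_word_snoc[symmetric] simp del: tapes.simps)
  then show ?case unfolding relpowp_1 .
next
  case (InRight w i R)
  then have "tm_step M (a, tapes K x (w, i, R)) (b, tapes K x (w, Suc i, R))"
    by (intro tm_step_moves[where P="\<lambda>_. True" and d="no_move(1 := MoveRight)"])
      (auto split: if_splits simp del: tapes.simps)
  then show ?case unfolding relpowp_1 .
next
  case (InLeft w i R)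
  then have "tm_step M (a, tapes K x (w, Suc i, R)) (b, tapes K x (w, i, R))"
    by (intro tm_step_moves[where P="\<lambda>_. True" and d="no_move(1 := MoveLeft)"])
      (auto split: if_splits simp del: tapes.simps)
  then show ?case unfolding relpowp_1 .
next
  case (Seq c s m s1 c' n s2)
  then have "(tm_step M ^^ m) (a, tapes K x s) (a + code_size c, tapes K x s1)"
    "(tm_step M ^^ n) (a + code_size c, tapes K x s1) (b, tapes K x s2)" by auto
  then show ?case unfolding relpowp_add by blast
next
  case (While_end R v c w i)
  \<comment> \<open>The head reads the mark iff the register is 0; all other cells are blank, so a
    loop goes on while it reads 0.\<close>
  then have "tm_step M (a, tapes K x (w, i, R)) (b, tapes K x (w, i, R))"
    by (intro tm_step_no_move[where P="\<lambda>rs. rs ! (v + 2) \<noteq> 0"]) (auto simp: mark_def simp del: tapes.simps)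
  then show ?case unfolding relpowp_1 .
next
  case (While_loop R v c w i m s1 n s2)
  then have "tm_step M (a, tapes K x (w, i, R)) (Suc a, tapes K x (w, i, R))"
    by (intro tm_step_no_move[where P="\<lambda>rs. rs ! (v + 2) = 0"]) (auto simp: mark_def simp del: tapes.simps)
  moreover have "(tm_step M ^^ m) (Suc a, tapes K x (w, i, R)) (a, tapes K x s1)"
    by (rule While_loop.IH(1)) (use While_loop.prems in auto)
  moreover have "(tm_step M ^^ n) (a, tapes K x s1) (b, tapes K x s2)"
    by (rule While_loop.IH(2)) (use While_loop.prems in auto)
  ultimately show ?case unfolding relpowp_add relpowp_1 by blast
next
  case (IfIn_True i c w R m s1 c')
  then have "tm_step M (a, tapes K x (w, i, R)) (Suc a, tapes K x (w, i, R))"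
    by (intro tm_step_no_move[where P="\<lambda>rs. rs ! 1 = 2"]) (auto simp: tape_word_def simp del: tapes.simps)
  moreover have "(tm_step M ^^ m) (Suc a, tapes K x (w, i, R)) (b, tapes K x s1)"
    by (rule IfIn_True.IH) (use IfIn_True.prems in auto)
  ultimately show ?case unfolding relpowp_add relpowp_1 by blast
next
  case (IfIn_False i c' w R m s1 c)
  then have "tm_step M (a, tapes K x (w, i, R)) (Suc a + code_size c, tapes K x (w, i, R))"
    by (intro tm_step_no_move[where P="\<lambda>rs. rs ! 1 \<noteq> 2"]) (auto simp: tape_word_def simp del: tapes.simps)
  moreover have "(tm_step M ^^ m) (Suc a + code_size c, tapes K x (w, i, R)) (b, tapes K x s1)"
    by (rule IfIn_False.IH) (use IfIn_False.prems in auto)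
  ultimately show ?case unfolding relpowp_add relpowp_1 by blast
qed

lemma fst_transitions: "fst ` transitions k a b P f \<subseteq> {a}"
  by (auto simp: transitions_def)

text \<open>Fragments have disjoint intervals of source states, which gives determinism; the exit of
  the whole program lies beyond its interval, which gives halting.\<close>

lemma fst_code: "fst ` code k c a b \<subseteq> {a..<a + code_size c}"
proof (induction c arbitrary: a b)
  case (Seq c c')
  have "fst ` code k c a (a + code_size c) \<subseteq> {a..<a + code_size c}"
    "fst ` code k c' (a + code_size c) b \<subseteq> {a + code_size c..<a + code_size c + code_size c'}"
    by (rule Seq)+
  then show ?case by (fastforce simp: image_Un)
next
  case (While v c)
  have "fst ` code k c (Suc a) a \<subseteq> {Suc a..<Suc a + code_size c}" by (rule While)
  then show ?case using fst_transitions by (fastforce simp: image_Un)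
next
  case (IfIn c c')
  have "fst ` code k c (Suc a) b \<subseteq> {Suc a..<Suc a + code_size c}"
    "fst ` code k c' (Suc a + code_size c) b \<subseteq> {Suc a + code_size c..<Suc a + code_size c + code_size c'}"
    by (rule IfIn)+
  then show ?case using fst_transitions by (fastforce simp: image_Un)
qed (use fst_transitions in \<open>fastforce+\<close>)

lemma deterministic_Un:
  assumes "deterministic A" "deterministic B" "fst ` A \<inter> fst ` B = {}"
  shows "deterministic (A \<union> B)"
proof -
  have no: False if "(q, u) \<in> A" "(q, v) \<in> B" for q u v using that assms(3) by force
  show ?thesis
    unfolding deterministic_def
  proof (intro allI impI)
    fix q rs q1 as1 q2 as2
    assume "(q, rs, q1, as1) \<in> A \<union> B \<and> (q, rs, q2, as2) \<in> A \<union> B"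
    then have "(q, rs, q1, as1) \<in> A \<and> (q, rs, q2, as2) \<in> A \<or> (q, rs, q1, as1) \<in> B \<and> (q, rs, q2, as2) \<in> B"
      using no by blast
    then show "q1 = q2 \<and> as1 = as2" using assms(1,2) unfolding deterministic_def by blast
  qed
qed

lemma deterministic_transitions: "deterministic (transitions k a b P f)"
  by (auto simp: deterministic_def transitions_def)

lemma deterministic_branch:
  "(\<And>rs. \<not> (P rs \<and> Q rs)) \<Longrightarrow> deterministic (transitions k a b P f \<union> transitions k a c Q g)"
  by (auto simp: deterministic_def transitions_def)

lemma deterministic_code: "deterministic (code k c a b)"
proof (induction c arbitrary: a b)
  case (Seq c c')
  have "fst ` code k c a (a + code_size c) \<inter> fst ` code k c' (a + code_size c) b = {}"
    using fst_code[of k c a "a + code_size c"] fst_code[of k c' "a + code_size c" b] by fastforce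
  then show ?case using Seq by (simp add: deterministic_Un)
next
  case (While v c)
  have "fst ` (transitions k a (Suc a) P f \<union> transitions k a b Q g) \<inter> fst ` code k c (Suc a) a = {}" for P f Q g
    using fst_code[of k c "Suc a" a] fst_transitions[of k a _ P f] fst_transitions[of k a _ Q g]
    by (fastforce simp: image_Un)
  then show ?case
    unfolding code.simps by (intro deterministic_Un[OF deterministic_branch] While) auto
next
  case (IfIn c c')
  have "fst ` (transitions k a (Suc a) P f \<union> transitions k a (Suc a + code_size c) Q g) \<inter> fst ` code k c (Suc a) b = {}"
    "fst ` (transitions k a (Suc a) P f \<union> transitions k a (Suc a + code_size c) Q g \<union> code k c (Suc a) b) \<inter>
      fst ` code k c' (Suc a + code_size c) b = {}" for P f Q g
    using fst_code[of k c "Suc a" b] fst_code[of k c' "Suc a + code_size c" b]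
      fst_transitions[of k a _ P f] fst_transitions[of k a _ Q g]
    by (fastforce simp: image_Un)+
  then show ?case
    unfolding code.simps by (intro deterministic_Un[OF deterministic_Un[OF deterministic_branch]] IfIn) auto
qed (auto simp: deterministic_transitions)

lemma finite_transitions: "finite (transitions k a b P f)"
proof -
  have "finite {rs :: nat list. set rs \<subseteq> {..<3} \<and> length rs = k}" by (rule finite_lists_length_eq) simp
  then have "finite {rs :: nat list. set rs \<subseteq> {..<3} \<and> length rs = k \<and> P rs}"
    by (rule rev_finite_subset) blast
  then show ?thesis by (simp add: transitions_def)
qed

lemma finite_code: "finite (code k c a b)"
  by (induction c arbitrary: a b) (auto simp: finite_transitions)

lemma lengths_transitions: "(q, rs, q', as) \<in> transitions k a b P f \<Longrightarrow> length rs = k \<and> length as = k"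
  by (auto simp: transitions_def)

lemma lengths_code: "(q, rs, q', as) \<in> code k c a b \<Longrightarrow> length rs = k \<and> length as = k"
  by (induction c arbitrary: a b) (auto dest: lengths_transitions)

section \<open>The initial phase\<close>

text \<open>Marks the register tapes and moves the input to tape 1, counting it in register 0.\<close>

definition copy_bit :: "nat list \<Rightarrow> nat \<Rightarrow> nat \<times> move" where
  "copy_bit rs i = (if i = 0 then 0 else if i = 1 then rs ! 0 else rs ! i, if i \<le> 2 then MoveRight else Stay)"

definition inputs :: "move \<Rightarrow> nat \<Rightarrow> move" where
  "inputs d i = (if i \<le> 1 then d else Stay)"

text \<open>State 0 writes the marks, state 1 copies, and state 2 runs the first two heads back to
  the blank at position -1 and one cell forward. Compiled code starts in state 3.\<close>

definition prologue :: "nat \<Rightarrow> tm" where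
  "prologue k =
     transitions k 0 1 (\<lambda>_. True) (\<lambda>rs i. (if 2 \<le> i then 1 else rs ! i, Stay)) \<union>
     (transitions k 1 1 (\<lambda>rs. rs ! 0 \<noteq> 0) copy_bit \<union>
      transitions k 1 2 (\<lambda>rs. rs ! 0 = 0) (moves (inputs MoveLeft))) \<union>
     (transitions k 2 2 (\<lambda>rs. rs ! 1 \<noteq> 0) (moves (inputs MoveLeft)) \<union>
      transitions k 2 3 (\<lambda>rs. rs ! 1 = 0) (moves (inputs MoveRight)))"

definition copy_tapes :: "nat \<Rightarrow> bool list \<Rightarrow> nat \<Rightarrow> int \<Rightarrow> tape list" where
  "copy_tapes K x j h = ((\<lambda>i. if i < int j then 0 else tape_word x i), h) # (tape_word (take j x), h) #
     map (\<lambda>v. (mark, if v = 0 then int j else 0)) [0..<K]"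

lemma length_copy_tapes [simp]: "length (copy_tapes K x j h) = K + 2"
  by (simp add: copy_tapes_def)

lemma read_copy_tapes: "t \<in> set (copy_tapes K x j h) \<Longrightarrow> read_tape t < 3"
  by (auto simp: copy_tapes_def tape_word_less mark_def)

lemma copy_tapes_nth [simp]:
  "copy_tapes K x j h ! 0 = ((\<lambda>i. if i < int j then 0 else tape_word x i), h)"
  "copy_tapes K x j h ! Suc 0 = (tape_word (take j x), h)"
  "v < K \<Longrightarrow> copy_tapes K x j h ! Suc (Suc v) = (mark, if v = 0 then int j else 0)"
  by (simp_all add: copy_tapes_def)

lemma prologue_mark:
  assumes "prologue (K + 2) \<subseteq> M"
  shows "tm_step M (init_config (K + 2) x) (1, copy_tapes K x 0 0)"
proof -
  let ?ts = "(tape_word x, 0) # replicate (K + 1) (\<lambda>_. 0, 0)"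
  have "tm_step M (0, ?ts) (1, copy_tapes K x 0 0)"
  proof (rule tm_step_transitions)
    show "transitions (K + 2) 0 1 (\<lambda>_. True) (\<lambda>rs i. (if 2 \<le> i then 1 else rs ! i, Stay)) \<subseteq> M"
      using assms by (auto simp: prologue_def)
    show "read_tape t < 3" if "t \<in> set ?ts" for t
      using that by (auto simp: tape_word_less)
    show "copy_tapes K x 0 0 ! i =
        act_tape (if 2 \<le> i then 1 else map read_tape ?ts ! i, Stay) (?ts ! i)" if "i < K + 2" for i
    proof -
      have "\<forall>i<K + 2. copy_tapes K x 0 0 ! i =
        act_tape (if 2 \<le> i then 1 else map read_tape ?ts ! i, Stay) (?ts ! i)"
        unfolding all_tapes by (auto simp: fun_eq_iff tape_word_def mark_def simp del: replicate_Suc)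
      then show ?thesis using that by blast
    qed
  qed auto
  then show ?thesis by (simp add: init_config_def)
qed

lemma prologue_copy:
  assumes "prologue (K + 2) \<subseteq> M" "j < length x"
  shows "tm_step M (1, copy_tapes K x j (int j)) (1, copy_tapes K x (Suc j) (int (Suc j)))"
proof (rule tm_step_transitions)
  show "transitions (K + 2) 1 1 (\<lambda>rs. rs ! 0 \<noteq> 0) copy_bit \<subseteq> M"
    using assms by (auto simp: prologue_def)
  have "(tape_word (take j x))(int j := tape_word x (int j)) = tape_word (take (Suc j) x)"
    using assms(2) by (auto simp: fun_eq_iff tape_word_def nth_take)
  then have "\<forall>i<K + 2. copy_tapes K x (Suc j) (int (Suc j)) ! i =
      act_tape (copy_bit (map read_tape (copy_tapes K x j (int j))) i) (copy_tapes K x j (int j) ! i)"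
    unfolding all_tapes by (auto simp: copy_bit_def)
  then show "copy_tapes K x (Suc j) (int (Suc j)) ! i =
      act_tape (copy_bit (map read_tape (copy_tapes K x j (int j))) i) (copy_tapes K x j (int j) ! i)"
    if "i < K + 2" for i using that by blast
qed (use assms(2) read_copy_tapes in \<open>auto simp: tape_word_def\<close>)

lemma prologue_move:
  assumes "transitions (K + 2) a b P (moves (inputs d)) \<subseteq> M" "P (map read_tape (copy_tapes K x j h))"
  shows "tm_step M (a, copy_tapes K x j h) (b, copy_tapes K x j (move_head d h))"
proof (rule tm_step_transitions[OF assms(1)])
  have "\<forall>i<K + 2. copy_tapes K x j (move_head d h) ! i =
      (fst (copy_tapes K x j h ! i), move_head (inputs d i) (snd (copy_tapes K x j h ! i)))"
    unfolding all_tapes by (auto simp: inputs_def)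
  then show "copy_tapes K x j (move_head d h) ! i =
      act_tape (moves (inputs d) (map read_tape (copy_tapes K x j h)) i) (copy_tapes K x j h ! i)"
    if "i < K + 2" for i using that by (simp add: act_moves)
qed (use assms(2) read_copy_tapes in auto)

lemma prologue_steps:
  assumes M: "prologue (Suc K + 2) \<subseteq> M"
  shows "(tm_step M ^^ (2 * length x + 3)) (init_config (Suc K + 2) x)
    (3, tapes (Suc K) x ([], 0, (\<lambda>_. 0)(0 := length x)))"
proof -
  let ?c = "copy_tapes (Suc K) x" and ?n = "length x"
  have "(tm_step M ^^ j) (1, ?c 0 0) (1, ?c j (int j))" if "j \<le> ?n" for j
    using that
  proof (induction j)
    case (Suc j)
    then show ?case using prologue_copy[OF M, of j x] by auto
  qed simp
  then have copy: "(tm_step M ^^ ?n) (1, ?c 0 0) (1, ?c ?n (int ?n))" by simp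
  have turn: "tm_step M (1, ?c ?n (int ?n)) (2, ?c ?n (int ?n - 1))"
    using prologue_move[of "Suc K" 1 2 "\<lambda>rs. rs ! 0 = 0" MoveLeft M x ?n "int ?n"] M
    by (auto simp: prologue_def tape_word_def)
  have "(tm_step M ^^ j) (2, ?c ?n (int ?n - 1)) (2, ?c ?n (int ?n - 1 - int j))" if "j \<le> ?n" for j
    using that
  proof (induction j)
    case (Suc j)
    have "tm_step M (2, ?c ?n (int ?n - 1 - int j)) (2, ?c ?n (move_head MoveLeft (int ?n - 1 - int j)))"
      by (rule prologue_move[where P="\<lambda>rs. rs ! 1 \<noteq> 0"])
        (use M Suc.prems in \<open>auto simp: prologue_def tape_word_def\<close>)
    then show ?case using Suc by (auto simp: algebra_simps)
  qed simp
  from this[of ?n] have return: "(tm_step M ^^ ?n) (2, ?c ?n (int ?n - 1)) (2, ?c ?n (- 1))" by simp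
  have home: "tm_step M (2, ?c ?n (- 1)) (3, ?c ?n 0)"
    using prologue_move[of "Suc K" 2 3 "\<lambda>rs. rs ! 1 = 0" MoveRight M x ?n "- 1"] M
    by (auto simp: prologue_def tape_word_def)
  have "?c ?n 0 = tapes (Suc K) x ([], 0, (\<lambda>_. 0)(0 := ?n))"
    by (auto simp: copy_tapes_def fun_eq_iff tape_word_def)
  \<comment> \<open>Marking, copying, turning, returning, and stepping onto the first cell.\<close>
  moreover have "(tm_step M ^^ (1 + (?n + (1 + (?n + 1))))) (init_config (Suc K + 2) x) (3, ?c ?n 0)"
    unfolding relpowp_add relpowp_1 using prologue_mark[OF M, of x] copy turn return home by blast
  moreover have "1 + (?n + (1 + (?n + 1))) = 2 * ?n + 3" by simp
  ultimately show ?thesis by metis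
qed

text \<open>The polynomial [:3, 2:] is the length of the initial phase. The exit state has no
  transitions, so the machine halts there with the output on its first tape.\<close>

theorem exec_poly_time:
  fixes q :: "nat poly"
  assumes "\<And>x. \<exists>n i R. n \<le> poly q (length x) \<and> exec x c ([], 0, (\<lambda>_. 0)(0 := length x)) n (f x, i, R)"
  shows "poly_time_computable f"
proof -
  let ?K = "Suc (num_regs c)" and ?b = "3 + code_size c"
  let ?C = "code (?K + 2) c 3 ?b"
  let ?M = "prologue (?K + 2) \<union> ?C"
  have fst_p: "fst ` prologue k \<subseteq> {0, 1, 2}" for k
    unfolding prologue_def image_Un by (intro Un_least order_trans[OF fst_transitions]) auto
  have "deterministic (prologue k)" for k
    unfolding prologue_def
    by (intro deterministic_Un deterministic_branch deterministic_transitions)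
      (auto simp: transitions_def)
  then have "deterministic ?M"
    using deterministic_code fst_p[of "?K + 2"] fst_code[of "?K + 2" c 3 ?b]
    by (intro deterministic_Un) fastforce+
  moreover have "wf_tm (?K + 2) ?M"
    using lengths_code[of _ _ _ _ "?K + 2" c 3 ?b] lengths_transitions
    by (fastforce simp: wf_tm_def finite_code prologue_def finite_transitions)
  moreover have "\<exists>m c'. m \<le> poly ([:3, 2:] + q) (length x) \<and>
      (tm_step ?M ^^ m) (init_config (?K + 2) x) c' \<and> halted ?M c' \<and> fst (hd (snd c')) = tape_word (f x)" for x
  proof -
    obtain n i R where n: "n \<le> poly q (length x)" and ex: "exec x c ([], 0, (\<lambda>_. 0)(0 := length x)) n (f x, i, R)"
      using assms by blast
    have "(tm_step ?M ^^ n) (3, tapes ?K x ([], 0, (\<lambda>_. 0)(0 := length x))) (?b, tapes ?K x (f x, i, R))"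
      by (rule exec_code[OF ex]) auto
    moreover have "(tm_step ?M ^^ (2 * length x + 3)) (init_config (?K + 2) x)
        (3, tapes ?K x ([], 0, (\<lambda>_. 0)(0 := length x)))"
      by (rule prologue_steps) auto
    ultimately have "(tm_step ?M ^^ (2 * length x + 3 + n)) (init_config (?K + 2) x) (?b, tapes ?K x (f x, i, R))"
      unfolding relpowp_add by blast
    moreover have "halted ?M (?b, tapes ?K x (f x, i, R))"
      unfolding halted_iff using fst_p[of "?K + 2"] fst_code[of "?K + 2" c 3 ?b] by force
    ultimately show ?thesis using n
      by (intro exI[of _ "2 * length x + 3 + n"] exI[of _ "(?b, tapes ?K x (f x, i, R))"]) auto
  qed
  ultimately show ?thesis unfolding poly_time_computable_def by blast
qed

section \<open>Repeating a command\<close>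

text \<open>Even registers hold the variables of expressions, odd ones are temporary.\<close>

definition regs :: "(nat \<Rightarrow> nat) \<Rightarrow> (nat \<Rightarrow> nat) \<Rightarrow> nat \<Rightarrow> nat" where
  "regs env tmp r = (if even r then env (r div 2) else tmp (r div 2))"

lemma regs_simps [simp]:
  "regs env tmp (2 * v) = env v"
  "regs env tmp (Suc (2 * l)) = tmp l"
  "regs env tmp (Suc (Suc (Suc (2 * l)))) = tmp (Suc l)"
  "(regs env tmp)(2 * v := k) = regs (env(v := k)) tmp"
  "(regs env tmp)(Suc (2 * l) := k) = regs env (tmp(l := k))"
  by (auto simp: regs_def fun_eq_iff elim!: evenE oddE)

text \<open>The command may use the temporary registers from \<open>l\<close> on if they are 0, and leaves them 0.\<close>

definition computes :: "bool list \<Rightarrow> nat \<Rightarrow> com \<Rightarrow> nat \<Rightarrow> state \<Rightarrow> state \<Rightarrow> bool" where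
  "computes x l c m = (\<lambda>(w, i, env) (w', i', env'). \<forall>tmp. (\<forall>j\<ge>l. tmp j = 0) \<longrightarrow>
     (\<exists>n\<le>m. exec x c (w, i, regs env tmp) n (w', i', regs env' tmp)))"

lemma computesI:
  assumes "\<And>tmp. (\<And>j. l \<le> j \<Longrightarrow> tmp j = 0) \<Longrightarrow>
    \<exists>n\<le>m. exec x c (w, i, regs env tmp) n (w', i', regs env' tmp)"
  shows "computes x l c m (w, i, env) (w', i', env')"
  using assms unfolding computes_def by auto

lemma computesD:
  assumes "computes x l c m (w, i, env) (w', i', env')" "\<And>j. l \<le> j \<Longrightarrow> tmp j = 0"
  obtains n where "n \<le> m" "exec x c (w, i, regs env tmp) n (w', i', regs env' tmp)"
  using assms unfolding computes_def by auto

lemma computes_weaken: "computes x l c m s s' \<Longrightarrow> m \<le> m' \<Longrightarrow> computes x l c m' s s'"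
  unfolding computes_def split_beta by (meson order_trans)

lemma computes_Seq:
  assumes "computes x l c m s s1" "computes x l c' n s1 s2"
  shows "computes x l (Seq c c') (m + n) s s2"
proof -
  obtain w i env w1 i1 env1 w2 i2 env2
    where s: "s = (w, i, env)" "s1 = (w1, i1, env1)" "s2 = (w2, i2, env2)" by (cases s; cases s1; cases s2)
  show ?thesis
    unfolding s
  proof (rule computesI)
    fix tmp :: "nat \<Rightarrow> nat" assume z: "\<And>j. l \<le> j \<Longrightarrow> tmp j = 0"
    obtain m' where "m' \<le> m" "exec x c (w, i, regs env tmp) m' (w1, i1, regs env1 tmp)"
      by (rule computesD[OF assms(1)[unfolded s] z])
    moreover obtain n' where "n' \<le> n" "exec x c' (w1, i1, regs env1 tmp) n' (w2, i2, regs env2 tmp)"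
      by (rule computesD[OF assms(2)[unfolded s] z])
    ultimately show "\<exists>k\<le>m + n. exec x (Seq c c') (w, i, regs env tmp) k (w2, i2, regs env2 tmp)"
      by (intro exI[of _ "m' + n'"]) (auto intro: exec.Seq)
  qed
qed

text \<open>Updates are equations in the premises, so that the rules fit any way of writing the
  states. For \<open>Dec\<close> the equation is read backwards, which implies that the register is
  positive.\<close>

lemma exec_regs:
  "env' = env(v := Suc (env v)) \<Longrightarrow> exec x (Inc (2 * v)) (w, i, regs env tmp) 1 (w, i, regs env' tmp)"
  "tmp' = tmp(l := Suc (tmp l)) \<Longrightarrow> exec x (Inc (Suc (2 * l))) (w, i, regs env tmp) 1 (w, i, regs env tmp')"
  "env = env'(v := Suc (env' v)) \<Longrightarrow> exec x (Dec (2 * v)) (w, i, regs env tmp) 1 (w, i, regs env' tmp)"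
  "tmp = tmp'(l := Suc (tmp' l)) \<Longrightarrow> exec x (Dec (Suc (2 * l))) (w, i, regs env tmp) 1 (w, i, regs env tmp')"
  using exec.Inc[of x "2 * v" w i "regs env tmp"] exec.Inc[of x "Suc (2 * l)" w i "regs env tmp"]
    exec.Dec[of "regs env tmp" "2 * v" x w i] exec.Dec[of "regs env tmp" "Suc (2 * l)" x w i]
  by (simp_all del: One_nat_def)

lemma exec_While:
  assumes "\<And>i. i < N \<Longrightarrow> 0 < snd (snd (st i)) v \<and> (\<exists>n\<le>b. exec x c (st i) n (st (Suc i)))"
    and "snd (snd (st N)) v = 0"
  shows "\<exists>n\<le>N * (b + 1) + 1. exec x (While v c) (st 0) n (st N)"
  using assms
proof (induction N arbitrary: st)
  case 0
  obtain w i R where st: "st 0 = (w, i, R)" by (cases "st 0")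
  then have "exec x (While v c) (st 0) 1 (st 0)" using 0 While_end[of R v x c w i] by simp
  then show ?case by auto
next
  case (Suc N)
  obtain w i R where st: "st 0 = (w, i, R)" by (cases "st 0")
  have "\<exists>n\<le>N * (b + 1) + 1. exec x (While v c) (st (Suc 0)) n (st (Suc N))"
    by (rule Suc.IH[of "\<lambda>i. st (Suc i)"]) (use Suc.prems in auto)
  then obtain n where n: "n \<le> N * (b + 1) + 1" "exec x (While v c) (st (Suc 0)) n (st (Suc N))" by blast
  obtain m where m: "m \<le> b" "exec x c (st 0) m (st (Suc 0))" using Suc.prems(1)[of 0] by auto
  have "exec x (While v c) (st 0) (1 + (m + n)) (st (Suc N))"
    using While_loop[of R v x c w i m "st (Suc 0)" n "st (Suc N)"] m(2) n(2) Suc.prems(1)[of 0] st by simp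
  then show ?case using m(1) n(1) by (intro exI[of _ "1 + (m + n)"]) auto
qed

abbreviation "var_reg v \<equiv> 2 * v"
abbreviation "tmp_reg l \<equiv> Suc (2 * l)"

text \<open>A counter is read by emptying it. Its value goes to two temporaries; one is poured back,
  the other remains to drive a loop.\<close>

definition copy_var :: "nat \<Rightarrow> nat \<Rightarrow> com" where
  "copy_var v l = Seq
     (While (var_reg v) (Seq (Dec (var_reg v)) (Seq (Inc (tmp_reg l)) (Inc (tmp_reg (Suc l))))))
     (While (tmp_reg (Suc l)) (Seq (Dec (tmp_reg (Suc l))) (Inc (var_reg v))))"

text \<open>The value of the expression is never computed: a sum is run in two parts and a product
  as nested repetitions. The command takes the first free temporary as argument, since it runs while
  outer counters are in use.\<close>

fun repeat :: "expr \<Rightarrow> nat \<Rightarrow> (nat \<Rightarrow> com) \<Rightarrow> com" where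
  "repeat (Var v) l c =
     Seq (copy_var v l) (While (tmp_reg l) (Seq (Dec (tmp_reg l)) (c (Suc l))))"
| "repeat (Const n) l c = (Seq (c l) ^^ n) Skip"
| "repeat (Add a b) l c = Seq (repeat a l c) (repeat b l c)"
| "repeat (Mul a b) l c = repeat a l (\<lambda>l. repeat b l c)"

text \<open>For a variable of value N: 7N + 2 steps to copy it and N(m + 2) + 1 for the loop, a
  round being a test, a decrement and the command.\<close>

fun repeat_time :: "(nat \<Rightarrow> nat) \<Rightarrow> expr \<Rightarrow> nat \<Rightarrow> nat" where
  "repeat_time env (Var v) m = 7 * env v + env v * (m + 2) + 3"
| "repeat_time env (Const n) m = n * m + 1"
| "repeat_time env (Add a b) m = repeat_time env a m + repeat_time env b m"
| "repeat_time env (Mul a b) m = repeat_time env a (repeat_time env b m)"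

lemma exec_copy_var:
  assumes "\<And>j. l \<le> j \<Longrightarrow> tmp j = 0"
  shows "\<exists>n\<le>7 * env v + 2. exec x (copy_var v l) (w, i, regs env tmp) n (w, i, regs env (tmp(l := env v)))"
proof -
  define N where "N = env v"
  let ?body = "Seq (Dec (var_reg v)) (Seq (Inc (tmp_reg l)) (Inc (tmp_reg (Suc l))))"
  let ?back = "Seq (Dec (tmp_reg (Suc l))) (Inc (var_reg v))"
  define st where "st j = (w, i, regs (env(v := N - j)) (tmp(l := j, Suc l := j)))" for j
  define st' where "st' j = (w, i, regs (env(v := j)) (tmp(l := N, Suc l := N - j)))" for j
  have z: "tmp l = 0" "tmp (Suc l) = 0" using assms by auto
  have "\<exists>n\<le>3. exec x ?body (st j) n (st (Suc j))" if "j < N" for j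
  proof -
    have "exec x ?body (st j) (1 + (1 + 1)) (st (Suc j))"
      unfolding st_def
      by (rule exec.Seq[OF exec_regs(3)[where env'="env(v := N - Suc j)"] exec.Seq[OF exec_regs(2)[OF refl] exec_regs(2)]])
        (use that in \<open>auto simp: fun_eq_iff\<close>)
    then show ?thesis by (intro exI[of _ "1 + (1 + 1)"]) auto
  qed
  then have "\<exists>n\<le>N * (3 + 1) + 1. exec x (While (var_reg v) ?body) (st 0) n (st N)"
    by (intro exec_While) (auto simp: st_def)
  then obtain n1 where n1: "n1 \<le> N * (3 + 1) + 1" "exec x (While (var_reg v) ?body) (st 0) n1 (st N)" by blast
  have "\<exists>n\<le>2. exec x ?back (st' j) n (st' (Suc j))" if "j < N" for j
  proof -
    have "exec x ?back (st' j) (1 + 1) (st' (Suc j))"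
      unfolding st'_def
      by (rule exec.Seq[OF exec_regs(4)[where tmp'="tmp(l := N, Suc l := N - Suc j)"] exec_regs(1)]) (use that in \<open>auto simp: fun_eq_iff\<close>)
    then show ?thesis by (intro exI[of _ "1 + 1"]) auto
  qed
  then have "\<exists>n\<le>N * (2 + 1) + 1. exec x (While (tmp_reg (Suc l)) ?back) (st' 0) n (st' N)"
    by (intro exec_While) (auto simp: st'_def)
  then obtain n2 where n2: "n2 \<le> N * (2 + 1) + 1" "exec x (While (tmp_reg (Suc l)) ?back) (st' 0) n2 (st' N)"
    by blast
  have "st 0 = (w, i, regs env tmp)" "st N = st' 0" "st' N = (w, i, regs env (tmp(l := N)))"
    using z by (auto simp: st_def st'_def N_def intro!: arg_cong2[where f=regs])
  then show ?thesis
    using exec.Seq[OF n1(2), of "While (tmp_reg (Suc l)) ?back" n2 "st' N"] n1(1) n2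
    unfolding copy_var_def N_def[symmetric] by (intro exI[of _ "n1 + n2"]) auto
qed

text \<open>The variables of e are read again between repetitions, for a second summand or an inner
  factor, so they must keep their values along the sequence of states; other variables may
  change.\<close>

lemma computes_repeat:
  assumes "\<And>j l'. j < eval env0 e \<Longrightarrow> l \<le> l' \<Longrightarrow> computes x l' (c l') m (s j) (s (Suc j))"
    and "\<And>j v. j \<le> eval env0 e \<Longrightarrow> v \<in> vars e \<Longrightarrow> snd (snd (s j)) v = env0 v"
  shows "computes x l (repeat e l c) (repeat_time env0 e m) (s 0) (s (eval env0 e))"
  using assms
proof (induction e arbitrary: l c m s)
  case (Var v)
  define N where "N = env0 v"
  have body: "computes x (Suc l) (c (Suc l)) m (s j) (s (Suc j))" if "j < N" for j
    using Var.prems(1)[of j "Suc l"] that by (simp add: N_def)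
  obtain w i env where s0: "s 0 = (w, i, env)" by (cases "s 0")
  have env: "env v = N" using Var.prems(2)[of 0 v] s0 by (simp add: N_def)
  obtain w' i' env' where sN: "s N = (w', i', env')" by (cases "s N")
  have "computes x l (repeat (Var v) l c) (repeat_time env0 (Var v) m) (w, i, env) (w', i', env')"
  proof (rule computesI)
    fix tmp :: "nat \<Rightarrow> nat" assume z: "\<And>j. l \<le> j \<Longrightarrow> tmp j = 0"
    obtain n1 where n1: "n1 \<le> 7 * N + 2"
      "exec x (copy_var v l) (w, i, regs env tmp) n1 (w, i, regs env (tmp(l := N)))"
      using exec_copy_var[of l tmp env v x w i] z env by auto
    let ?body = "Seq (Dec (tmp_reg l)) (c (Suc l))"
    define st where "st j = (fst (s j), fst (snd (s j)), regs (snd (snd (s j))) (tmp(l := N - j)))" for j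
    have "\<exists>n\<le>1 + m. exec x ?body (st j) n (st (Suc j))" if j: "j < N" for j
    proof -
      obtain w1 i1 env1 w2 i2 env2 where eq: "s j = (w1, i1, env1)" "s (Suc j) = (w2, i2, env2)"
        by (cases "s j"; cases "s (Suc j)")
      obtain n where "n \<le> m" "exec x (c (Suc l)) (w1, i1, regs env1 (tmp(l := N - Suc j))) n
          (w2, i2, regs env2 (tmp(l := N - Suc j)))"
        by (rule computesD[OF body[OF j, unfolded eq], of "tmp(l := N - Suc j)"]) (use z in auto)
      moreover have "exec x (Dec (tmp_reg l)) (w1, i1, regs env1 (tmp(l := N - j))) 1
          (w1, i1, regs env1 (tmp(l := N - Suc j)))"
        by (rule exec_regs) (use j in \<open>auto simp: fun_eq_iff\<close>)
      ultimately show ?thesis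
        using eq by (intro exI[of _ "1 + n"]) (auto simp: st_def intro: exec.Seq[of x _ _ 1, simplified])
    qed
    then have "\<exists>n\<le>N * (1 + m + 1) + 1. exec x (While (tmp_reg l) ?body) (st 0) n (st N)"
      by (intro exec_While) (auto simp: st_def)
    then obtain n2 where n2: "n2 \<le> N * (1 + m + 1) + 1" "exec x (While (tmp_reg l) ?body) (st 0) n2 (st N)"
      by blast
    have "tmp(l := 0) = tmp" using z[of l] by auto
    then have "st 0 = (w, i, regs env (tmp(l := N)))" "st N = (w', i', regs env' tmp)"
      using s0 sN by (auto simp: st_def)
    then show "\<exists>n\<le>repeat_time env0 (Var v) m. exec x (repeat (Var v) l c) (w, i, regs env tmp) n (w', i', regs env' tmp)"
      using exec.Seq[OF n1(2), of "While (tmp_reg l) ?body" n2 "st N"] n1(1) n2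
      unfolding N_def by (intro exI[of _ "n1 + n2"]) (auto simp: algebra_simps)
  qed
  then show ?case using s0 sN by (simp add: N_def)
next
  case (Const n)
  have "computes x l ((Seq (c l) ^^ j) Skip) (j * m + 1) (s (n - j)) (s n)" if "j \<le> n" for j
    using that
  proof (induction j)
    case 0
    obtain w i env where "s n = (w, i, env)" by (cases "s n")
    then show ?case by (auto intro!: computesI exI[of _ 1] exec.Skip[simplified])
  next
    case (Suc j)
    have "computes x l (c l) m (s (n - Suc j)) (s (Suc (n - Suc j)))"
      using Const.prems(1)[of "n - Suc j" l] Suc.prems by simp
    moreover have "Suc (n - Suc j) = n - j" using Suc.prems by simp
    ultimately have "computes x l (Seq (c l) ((Seq (c l) ^^ j) Skip)) (m + (j * m + 1)) (s (n - Suc j)) (s n)"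
      using Suc computes_Seq by (metis Suc_leD)
    then show ?case by (simp add: add.assoc)
  qed
  from this[of n] show ?case by simp
next
  case (Add a b)
  have "computes x l (repeat a l c) (repeat_time env0 a m) (s 0) (s (eval env0 a))"
    by (rule Add.IH(1)) (use Add.prems in auto)
  moreover have "computes x l (repeat b l c) (repeat_time env0 b m) (s (eval env0 a + 0)) (s (eval env0 a + eval env0 b))"
    by (rule Add.IH(2)) (use Add.prems in auto)
  ultimately show ?case by (simp add: computes_Seq)
next
  case (Mul a b)
  \<comment> \<open>A round of the outer factor runs through a block of \<open>eval env0 b\<close>
    states.\<close>
  let ?s = "\<lambda>i. s (i * eval env0 b)"
  have "computes x l (repeat a l (\<lambda>l. repeat b l c)) (repeat_time env0 a (repeat_time env0 b m)) (?s 0) (?s (eval env0 a))"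
  proof (rule Mul.IH(1))
    fix i l' assume i: "i < eval env0 a" and l': "l \<le> l'"
    have le: "i * eval env0 b + j \<le> eval env0 a * eval env0 b" if "j \<le> eval env0 b" for j
      using mult_le_mono1[of "Suc i" "eval env0 a" "eval env0 b"] i that by simp
    have "computes x l' (repeat b l' c) (repeat_time env0 b m) (s (i * eval env0 b + 0)) (s (i * eval env0 b + eval env0 b))"
    proof (rule Mul.IH(2))
      fix j l'' assume "j < eval env0 b" "l' \<le> l''"
      then show "computes x l'' (c l'') m (s (i * eval env0 b + j)) (s (i * eval env0 b + Suc j))"
        using Mul.prems(1)[of "i * eval env0 b + j" l''] le[of "Suc j"] l' by simp
    next
      fix j v assume "j \<le> eval env0 b" "v \<in> vars b"
      then show "snd (snd (s (i * eval env0 b + j))) v = env0 v"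
        using Mul.prems(2)[of "i * eval env0 b + j" v] le[of j] by simp
    qed
    then show "computes x l' (repeat b l' c) (repeat_time env0 b m) (?s i) (?s (Suc i))" by (simp add: add.commute)
  next
    fix j v assume "j \<le> eval env0 a" "v \<in> vars a"
    then show "snd (snd (?s j)) v = env0 v" using Mul.prems(2)[of "j * eval env0 b" v] by simp
  qed
  then show ?case by simp
qed

section \<open>Programs that print a word\<close>

datatype printer =
    Bit bool
  | PNil
  | PSeq printer printer
  | PFor expr printer
  | PIf nat printer printer

fun printed :: "bool list \<Rightarrow> nat \<Rightarrow> (nat \<Rightarrow> nat) \<Rightarrow> printer \<Rightarrow> bool list" where
  "printed x d env (Bit b) = [b]"
| "printed x d env PNil = []"
| "printed x d env (PSeq p q) = printed x d env p @ printed x d env q"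
| "printed x d env (PFor e p) = concat (map (\<lambda>i. printed x (Suc d) (env(d := i)) p) [0..<eval env e])"
| "printed x d env (PIf v p q) =
     (if env v < length x \<and> x ! env v then printed x d env p else printed x d env q)"

fun wf_printer :: "nat \<Rightarrow> printer \<Rightarrow> bool" where
  "wf_printer d (PSeq p q) \<longleftrightarrow> wf_printer d p \<and> wf_printer d q"
| "wf_printer d (PFor e p) \<longleftrightarrow> vars e \<subseteq> {..<d} \<and> wf_printer (Suc d) p"
| "wf_printer d (PIf v p q) \<longleftrightarrow> wf_printer d p \<and> wf_printer d q"
| "wf_printer d _ \<longleftrightarrow> True"

text \<open>The loop variable counts up while a temporary counts down; it is reset at the end, so
  each visit finds it 0. A test moves the input head to the bit, and either branch moves it
  back.\<close>

fun print_code :: "nat \<Rightarrow> nat \<Rightarrow> printer \<Rightarrow> com" where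
  "print_code d l (Bit b) = Out b"
| "print_code d l PNil = Skip"
| "print_code d l (PSeq p q) = Seq (print_code d l p) (print_code d l q)"
| "print_code d l (PFor e p) = Seq
     (repeat e l (\<lambda>l. Seq (print_code (Suc d) l p) (Inc (var_reg d))))
     (While (var_reg d) (Dec (var_reg d)))"
| "print_code d l (PIf v p q) = Seq (repeat (Var v) l (\<lambda>_. InRight))
     (IfIn (Seq (repeat (Var v) l (\<lambda>_. InLeft)) (print_code d l p))
       (Seq (repeat (Var v) l (\<lambda>_. InLeft)) (print_code d l q)))"

lemma eval_poly_bound: "\<exists>q :: nat poly. \<forall>env N. (\<forall>v. env v \<le> N) \<longrightarrow> eval env e \<le> poly q N"
proof (induction e)
  case (Var v)
  then show ?case by (intro exI[of _ "[:0, 1:]"]) auto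
next
  case (Const c)
  then show ?case by (intro exI[of _ "[:c:]"]) auto
next
  case (Add a b)
  then obtain p q :: "nat poly" where "\<forall>env N. (\<forall>v. env v \<le> N) \<longrightarrow> eval env a \<le> poly p N"
    "\<forall>env N. (\<forall>v. env v \<le> N) \<longrightarrow> eval env b \<le> poly q N" by blast
  then show ?case by (intro exI[of _ "p + q"]) (auto intro: add_mono)
next
  case (Mul a b)
  then obtain p q :: "nat poly" where "\<forall>env N. (\<forall>v. env v \<le> N) \<longrightarrow> eval env a \<le> poly p N"
    "\<forall>env N. (\<forall>v. env v \<le> N) \<longrightarrow> eval env b \<le> poly q N" by blast
  then show ?case by (intro exI[of _ "p * q"]) (auto intro: mult_mono)
qed

text \<open>Linearity in the time m of the command survives nesting: for a product, the bound for b
  replaces m in the bound for a.\<close>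

lemma repeat_time_poly_bound:
  "\<exists>q :: nat poly. \<forall>env N m. (\<forall>v. env v \<le> N) \<longrightarrow> repeat_time env e m \<le> poly q N * (m + 1)"
proof (induction e)
  case (Var v)
  have bound: "7 * (k :: nat) + k * (m + 2) + 3 \<le> (3 + 9 * N) * (m + 1)" if "k \<le> N" for k m N
  proof -
    have "7 * k + k * (m + 2) + 3 \<le> (3 + 9 * k) * (m + 1)" by (simp add: algebra_simps)
    also have "\<dots> \<le> (3 + 9 * N) * (m + 1)" using that by (intro mult_le_mono1) simp
    finally show ?thesis .
  qed
  have "poly [:3, 9:] N = 3 + 9 * N" for N :: nat by simp
  then show ?case
    using bound unfolding repeat_time.simps by (intro exI[of _ "[:3, 9:]"]) metis
next
  case (Const c)
  then show ?case by (intro exI[of _ "[:c + 1:]"]) auto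
next
  case (Add a b)
  then obtain p q :: "nat poly" where
    p: "\<And>env N m. (\<forall>v. env v \<le> N) \<Longrightarrow> repeat_time env a m \<le> poly p N * (m + 1)" and
    q: "\<And>env N m. (\<forall>v. env v \<le> N) \<Longrightarrow> repeat_time env b m \<le> poly q N * (m + 1)" by blast
  show ?case
    using add_mono[OF p q] by (intro exI[of _ "p + q"]) (auto simp: algebra_simps)
next
  case (Mul a b)
  then obtain p q :: "nat poly" where
    p: "\<And>env N m. (\<forall>v. env v \<le> N) \<Longrightarrow> repeat_time env a m \<le> poly p N * (m + 1)" and
    q: "\<And>env N m. (\<forall>v. env v \<le> N) \<Longrightarrow> repeat_time env b m \<le> poly q N * (m + 1)" by blast
  have "repeat_time env a (repeat_time env b m) \<le> poly (p * (q + 1)) N * (m + 1)" if "\<forall>v. env v \<le> N" for env N m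
  proof -
    have "repeat_time env a (repeat_time env b m) \<le> poly p N * (repeat_time env b m + 1)"
      by (rule p[OF that])
    also have "\<dots> \<le> poly p N * ((poly q N + 1) * (m + 1))"
      using q[OF that, of m] by (intro mult_le_mono2) simp
    finally show ?thesis by (simp add: algebra_simps)
  qed
  then show ?case by (intro exI[of _ "p * (q + 1)"]) auto
qed

text \<open>One polynomial must serve all values of the loop variables, so it is taken at a common
  bound N of all variables. The counter of a loop may exceed N, and its body is bounded at N plus
  the bound on the number of rounds.\<close>

theorem computes_print_code:
  assumes "wf_printer d p"
  shows "\<exists>q :: nat poly. \<forall>x l env N w. (\<forall>v. env v \<le> N) \<longrightarrow> (\<forall>v\<ge>d. env v = 0) \<longrightarrow>
    computes x l (print_code d l p) (poly q N) (w, 0, env) (w @ printed x d env p, 0, env)"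
  using assms
proof (induction p arbitrary: d)
  case (Bit b)
  show ?case
    by (intro exI[of _ 1] allI impI computesI) (auto intro!: exI[of _ 1] exec.Out[simplified])
next
  case PNil
  show ?case
    by (intro exI[of _ 1] allI impI computesI) (auto intro!: exI[of _ 1] exec.Skip[simplified])
next
  case (PSeq p1 p2)
  then obtain q1 q2 :: "nat poly" where
    q1: "\<And>x l env N w. (\<forall>v. env v \<le> N) \<Longrightarrow> (\<forall>v\<ge>d. env v = 0) \<Longrightarrow>
      computes x l (print_code d l p1) (poly q1 N) (w, 0, env) (w @ printed x d env p1, 0, env)" and
    q2: "\<And>x l env N w. (\<forall>v. env v \<le> N) \<Longrightarrow> (\<forall>v\<ge>d. env v = 0) \<Longrightarrow>
      computes x l (print_code d l p2) (poly q2 N) (w, 0, env) (w @ printed x d env p2, 0, env)"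
    by simp metis
  show ?case
    using computes_Seq[OF q1 q2] by (intro exI[of _ "q1 + q2"]) auto
next
  case (PFor e p)
  then obtain q where q: "\<And>x l env N w. (\<forall>v. env v \<le> N) \<Longrightarrow> (\<forall>v\<ge>Suc d. env v = 0) \<Longrightarrow>
      computes x l (print_code (Suc d) l p) (poly q N) (w, 0, env) (w @ printed x (Suc d) env p, 0, env)"
    by simp metis
  obtain pe :: "nat poly" where pe: "\<And>env N. (\<forall>v. env v \<le> N) \<Longrightarrow> eval env e \<le> poly pe N"
    using eval_poly_bound by blast
  obtain pr :: "nat poly" where
    pr: "\<And>env N m. (\<forall>v. env v \<le> N) \<Longrightarrow> repeat_time env e m \<le> poly pr N * (m + 1)"
    using repeat_time_poly_bound by blast
  \<comment> \<open>The body at the enlarged bound, plus 1 for the increment of the loop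
    variable.\<close>
  let ?m = "pcompose q ([:0, 1:] + pe) + 1"
  show ?case
  proof (intro exI[of _ "pr * (?m + 1) + (2 * pe + 1)"] allI impI)
    fix x w :: "bool list" and l N :: nat and env :: "nat \<Rightarrow> nat"
    assume N: "\<forall>v. env v \<le> N" and z: "\<forall>v\<ge>d. env v = 0"
    let ?n = "eval env e"
    let ?s = "\<lambda>i. (w @ concat (map (\<lambda>i. printed x (Suc d) (env(d := i)) p) [0..<i]), 0, env(d := i)) :: state"
    let ?body = "\<lambda>l. Seq (print_code (Suc d) l p) (Inc (var_reg d))"
    have body: "computes x l' (?body l') (poly ?m N) (?s i) (?s (Suc i))" if i: "i < ?n" for i l'
    proof -
      have "\<forall>v. (env(d := i)) v \<le> N + poly pe N" using N i pe[OF N] by (auto intro: trans_le_add1)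
      then have "computes x l' (print_code (Suc d) l' p) (poly q (N + poly pe N)) (?s i)
          (fst (?s (Suc i)), 0, env(d := i))"
        using q[of "env(d := i)" "N + poly pe N" x l' "fst (?s i)"] z by simp
      moreover have "computes x l' (Inc (var_reg d)) 1 (fst (?s (Suc i)), 0, env(d := i)) (?s (Suc i))"
        by (auto intro!: computesI exI[of _ 1] exec_regs[simplified])
      ultimately show ?thesis using computes_Seq by (fastforce simp: poly_pcompose)
    qed
    have "d \<notin> vars e" using PFor.prems by auto
    then have "computes x l (repeat e l ?body) (repeat_time env e (poly ?m N)) (?s 0) (?s ?n)"
      by (intro computes_repeat[where s="?s"] body) auto
    moreover have "repeat_time env e (poly ?m N) \<le> poly (pr * (?m + 1)) N"
      using pr[OF N, of "poly ?m N"] by simp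
    ultimately have loop: "computes x l (repeat e l ?body) (poly (pr * (?m + 1)) N) (?s 0) (?s ?n)"
      by (rule computes_weaken)
    define u where "u = w @ concat (map (\<lambda>i. printed x (Suc d) (env(d := i)) p) [0..<?n])"
    have "computes x l (While (var_reg d) (Dec (var_reg d))) (poly (2 * pe + 1) N) (u, 0, env(d := ?n)) (u, 0, env)"
    proof (rule computesI)
      fix tmp :: "nat \<Rightarrow> nat"
      define st where "st j = (u, 0 :: nat, regs (env(d := ?n - j)) tmp)" for j
      have "\<exists>n\<le>?n * (1 + 1) + 1. exec x (While (var_reg d) (Dec (var_reg d))) (st 0) n (st ?n)"
      proof (rule exec_While[where st=st])
        fix j assume j: "j < ?n"
        have "exec x (Dec (var_reg d)) (st j) 1 (st (Suc j))"
          unfolding st_def by (rule exec_regs(3)) (use j in \<open>auto simp: fun_eq_iff\<close>)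
        then show "0 < snd (snd (st j)) (var_reg d) \<and> (\<exists>n\<le>1. exec x (Dec (var_reg d)) (st j) n (st (Suc j)))"
          using j by (auto simp: st_def)
      qed (simp add: st_def)
      moreover have "env(d := 0) = env" using z by auto
      then have "st 0 = (u, 0, regs (env(d := ?n)) tmp)" "st ?n = (u, 0, regs env tmp)" by (simp_all add: st_def)
      moreover have "?n * (1 + 1) + 1 \<le> poly (2 * pe + 1) N" using pe[OF N] by simp
      ultimately show "\<exists>n\<le>poly (2 * pe + 1) N. exec x (While (var_reg d) (Dec (var_reg d)))
          (u, 0, regs (env(d := ?n)) tmp) n (u, 0, regs env tmp)"
        by (metis order_trans)
    qed
    with loop have "computes x l (print_code d l (PFor e p)) (poly (pr * (?m + 1)) N + poly (2 * pe + 1) N)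
        (?s 0) (u, 0, env)"
      unfolding print_code.simps u_def by (rule computes_Seq)
    moreover have "?s 0 = (w, 0, env)" using z by auto
    ultimately show "computes x l (print_code d l (PFor e p)) (poly (pr * (?m + 1) + (2 * pe + 1)) N) (w, 0, env)
        (w @ printed x d env (PFor e p), 0, env)"
      unfolding u_def printed.simps poly_add by (simp only:)
  qed
next
  case (PIf v p1 p2)
  then obtain q1 q2 :: "nat poly" where
    q1: "\<And>x l env N w. (\<forall>v. env v \<le> N) \<Longrightarrow> (\<forall>v\<ge>d. env v = 0) \<Longrightarrow>
      computes x l (print_code d l p1) (poly q1 N) (w, 0, env) (w @ printed x d env p1, 0, env)" and
    q2: "\<And>x l env N w. (\<forall>v. env v \<le> N) \<Longrightarrow> (\<forall>v\<ge>d. env v = 0) \<Longrightarrow>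
      computes x l (print_code d l p2) (poly q2 N) (w, 0, env) (w @ printed x d env p2, 0, env)"
    by simp metis
  \<comment> \<open>Moving the head by N cells takes 7N + N(1 + 2) + 3 steps.\<close>
  let ?t = "[:3, 10:] :: nat poly"
  show ?case
  proof (intro exI[of _ "?t + (1 + (?t + (q1 + q2)))"] allI impI)
    fix x w :: "bool list" and l N :: nat and env :: "nat \<Rightarrow> nat"
    assume N: "\<forall>v. env v \<le> N" and z: "\<forall>v\<ge>d. env v = 0"
    have t: "repeat_time env (Var v) 1 \<le> poly ?t N" using N[rule_format, of v] by simp
    have "computes x l (repeat (Var v) l (\<lambda>_. InRight)) (repeat_time env (Var v) 1) (w, 0, env) (w, env v, env)"
    proof -
      have "computes x l' InRight 1 (w, i, env) (w, Suc i, env)" for i l'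
        by (auto intro!: computesI exI[of _ 1] exec.InRight[simplified])
      then show ?thesis
        using computes_repeat[of env "Var v" l x "\<lambda>_. InRight" 1 "\<lambda>i. (w, i, env)"] by auto
    qed
    then have right: "computes x l (repeat (Var v) l (\<lambda>_. InRight)) (poly ?t N) (w, 0, env) (w, env v, env)"
      using t by (rule computes_weaken)
    have "computes x l (repeat (Var v) l (\<lambda>_. InLeft)) (repeat_time env (Var v) 1) (w, env v - 0, env) (w, env v - env v, env)"
    proof -
      have "computes x l' InLeft 1 (w, env v - i, env) (w, env v - Suc i, env)" if "i < env v" for i l'
      proof -
        have "env v - i = Suc (env v - Suc i)" using that by simp
        then show ?thesis by (auto intro!: computesI exI[of _ 1] exec.InLeft[simplified])
      qed
      then show ?thesis
        using computes_repeat[of env "Var v" l x "\<lambda>_. InLeft" 1 "\<lambda>i. (w, env v - i, env)"] by auto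
    qed
    then have left: "computes x l (repeat (Var v) l (\<lambda>_. InLeft)) (poly ?t N) (w, env v, env) (w, 0, env)"
      using t by (auto intro: computes_weaken)
    let ?c = "\<lambda>p. Seq (repeat (Var v) l (\<lambda>_. InLeft)) (print_code d l p)"
    have c1: "computes x l (?c p1) (poly (?t + (q1 + q2)) N) (w, env v, env) (w @ printed x d env p1, 0, env)"
      by (rule computes_weaken[OF computes_Seq[OF left q1[OF N z]]]) simp
    have c2: "computes x l (?c p2) (poly (?t + (q1 + q2)) N) (w, env v, env) (w @ printed x d env p2, 0, env)"
      by (rule computes_weaken[OF computes_Seq[OF left q2[OF N z]]]) simp
    have "computes x l (IfIn (?c p1) (?c p2)) (poly (1 + (?t + (q1 + q2))) N) (w, env v, env)
        (w @ printed x d env (PIf v p1 p2), 0, env)"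
    proof (rule computesI)
      fix tmp :: "nat \<Rightarrow> nat" assume tz: "\<And>j. l \<le> j \<Longrightarrow> tmp j = 0"
      show "\<exists>n\<le>poly (1 + (?t + (q1 + q2))) N. exec x (IfIn (?c p1) (?c p2)) (w, env v, regs env tmp) n
          (w @ printed x d env (PIf v p1 p2), 0, regs env tmp)"
      proof (cases "env v < length x \<and> x ! env v")
        case True
        obtain n where "n \<le> poly (?t + (q1 + q2)) N"
          "exec x (?c p1) (w, env v, regs env tmp) n (w @ printed x d env p1, 0, regs env tmp)"
          by (rule computesD[OF c1 tz])
        then show ?thesis using True IfIn_True by (intro exI[of _ "1 + n"]) (auto simp del: One_nat_def)
      next
        case False
        obtain n where "n \<le> poly (?t + (q1 + q2)) N"
          "exec x (?c p2) (w, env v, regs env tmp) n (w @ printed x d env p2, 0, regs env tmp)"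
          by (rule computesD[OF c2 tz])
        then show ?thesis using False IfIn_False by (intro exI[of _ "1 + n"]) (auto simp del: One_nat_def)
      qed
    qed
    from computes_Seq[OF right this]
    show "computes x l (print_code d l (PIf v p1 p2)) (poly (?t + (1 + (?t + (q1 + q2)))) N) (w, 0, env)
        (w @ printed x d env (PIf v p1 p2), 0, env)" by simp
  qed
qed

theorem printer_poly_time:
  assumes "wf_printer 1 p"
  shows "poly_time_computable (\<lambda>x. printed x 1 ((\<lambda>_. 0)(0 := length x)) p)"
proof -
  obtain q :: "nat poly" where q: "\<And>x l env N w. (\<forall>v. env v \<le> N) \<Longrightarrow> (\<forall>v\<ge>1. env v = 0) \<Longrightarrow>
    computes x l (print_code 1 l p) (poly q N) (w, 0, env) (w @ printed x 1 env p, 0, env)"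
    using computes_print_code[OF assms] by metis
  show ?thesis
  proof (rule exec_poly_time[where c="print_code 1 0 p" and q=q])
    fix x :: "bool list"
    let ?env = "(\<lambda>_. 0)(0 := length x)"
    \<comment> \<open>Variable 0 is register 0, where the initial phase has put the input
      length.\<close>
    have "regs ?env (\<lambda>_. 0) = ?env" by (auto simp: regs_def fun_eq_iff)
    then show "\<exists>n i R. n \<le> poly q (length x) \<and>
        exec x (print_code 1 0 p) ([], 0, ?env) n (printed x 1 ?env p, i, R)"
      using computesD[OF q[of ?env "length x" x 0 "[]"], of "\<lambda>_. 0"] by fastforce
  qed
qed

section \<open>Printing the tree\<close>

definition PList :: "printer list \<Rightarrow> printer" where
  "PList ps = foldr PSeq ps PNil"

lemma printed_PList [simp]: "printed x d env (PList ps) = concat (map (printed x d env) ps)"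
  by (induction ps) (auto simp: PList_def)

lemma wf_PList [simp]: "wf_printer d (PList ps) = (\<forall>p\<in>set ps. wf_printer d p)"
  by (induction ps) (auto simp: PList_def)

definition unary :: "expr \<Rightarrow> printer" where
  "unary e = PSeq (PFor e (Bit True)) (Bit False)"

lemma printed_unary [simp]: "printed x d env (unary e) = encode_nat (eval env e)"
  by (simp add: unary_def encode_nat_def map_replicate_const)

lemma wf_unary [simp]: "wf_printer d (unary e) \<longleftrightarrow> vars e \<subseteq> {..<d}"
  by (simp add: unary_def)

definition edge :: "expr \<Rightarrow> expr \<Rightarrow> printer" where
  "edge a b = PSeq (unary a) (unary b)"

lemma edge_simps [simp]:
  "printed x d env (edge a b) = encode_nat (eval env a) @ encode_nat (eval env b)"
  "wf_printer d (edge a b) \<longleftrightarrow> vars a \<subseteq> {..<d} \<and> vars b \<subseteq> {..<d}"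
  by (simp_all add: edge_def)

definition gadget_exprs :: "expr \<Rightarrow> expr \<Rightarrow> expr \<Rightarrow> expr \<Rightarrow> expr list" where
  "gadget_exprs D a b c =
     [a, b, b, D, a, D, Add D (Const 1), c, c, Const 1, Add D (Const 1), Const 1]"

lemma length_gadget_exprs [simp]: "length (gadget_exprs D a b c) = 12"
  by (simp add: gadget_exprs_def)

lemma eval_gadget_exprs:
  "map (eval env) (gadget_exprs D a b c) = gadget (eval env D) (eval env a, eval env b, eval env c)"
  by (simp add: gadget_exprs_def)

text \<open>The clause number \<open>k\<close> is passed as an expression in the variables of the enclosing loops.\<close>

fun print_gadgets :: "expr \<Rightarrow> expr \<Rightarrow> nat \<Rightarrow> expr \<Rightarrow> clause_prog \<Rightarrow> printer" where
  "print_gadgets m q d k (Clause a b c) = PList (map2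
     (\<lambda>r. edge (Add (Add (Const 2) (Mul (Const 2) (Add m q))) (Add (Mul (Const 12) k) (Const r))))
     [0..<12] (gadget_exprs (Mul (Const 2) (Add (Add m k) (Const 1))) a b c))"
| "print_gadgets m q d k CNil = PNil"
| "print_gadgets m q d k (CSeq p p') =
     PSeq (print_gadgets m q d k p) (print_gadgets m q d (Add k (prog_count p)) p')"
| "print_gadgets m q d k (CFor e p) =
     PFor e (print_gadgets m q (Suc d) (Add k (Mul (Var d) (prog_count p))) p)"
| "print_gadgets m q d k (CIf v p p') = PIf v (print_gadgets m q d k p) (print_gadgets m q d k p')"

fun encode_edge :: "nat \<times> nat \<Rightarrow> bool list" where
  "encode_edge (u, v) = encode_nat u @ encode_nat v"

definition gadget_word :: "nat \<Rightarrow> nat \<Rightarrow> nat \<Rightarrow> clause \<Rightarrow> bool list" where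
  "gadget_word m q k t = concat (map (\<lambda>r. encode_edge
     (2 + 2 * (m + q) + (12 * k + r), gadget (2 * (m + k + 1)) t ! r)) [0..<12])"

fun gadget_words :: "nat \<Rightarrow> nat \<Rightarrow> nat \<Rightarrow> clause list \<Rightarrow> bool list" where
  "gadget_words m q k [] = []"
| "gadget_words m q k (t # ts) = gadget_word m q k t @ gadget_words m q (Suc k) ts"

lemma gadget_words_append:
  "gadget_words m q k (xs @ ys) = gadget_words m q k xs @ gadget_words m q (k + length xs) ys"
  by (induction xs arbitrary: k) auto

text \<open>Equal lengths make the index of the first clause of round i linear in i, which is the
  expression that \<open>print_gadgets\<close> passes on.\<close>

lemma gadget_words_concat:
  "(\<And>i. i < n \<Longrightarrow> length (f i) = l) \<Longrightarrow> gadget_words m q k (concat (map f [0..<n])) =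
     concat (map (\<lambda>i. gadget_words m q (k + i * l) (f i)) [0..<n])"
proof (induction n)
  case (Suc n)
  have "length (concat (map f [0..<n])) = n * l"
    using Suc.prems by (induction n) auto
  then show ?case using Suc by (simp add: gadget_words_append)
qed simp

lemma printed_gadgets:
  assumes "wf_prog d p" "balanced p" "0 < d" "vars m \<subseteq> {0}" "vars q \<subseteq> {0}" "vars k \<subseteq> {..<d}"
  shows "printed x d env (print_gadgets m q d k p) =
    gadget_words (eval env m) (eval env q) (eval env k) (clauses x d env p)"
  using assms
proof (induction p arbitrary: d k env)
  case (Clause a b c)
  let ?es = "gadget_exprs (Mul (Const 2) (Add (Add m k) (Const 1))) a b c"
  have "map (printed x d env) (map2
     (\<lambda>r. edge (Add (Add (Const 2) (Mul (Const 2) (Add m q))) (Add (Mul (Const 12) k) (Const r)))) [0..<12] ?es) =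
    map (\<lambda>r. encode_edge (2 + 2 * (eval env m + eval env q) + (12 * eval env k + r), map (eval env) ?es ! r)) [0..<12]"
    by (rule nth_equalityI) auto
  then show ?case
    by (simp only: print_gadgets.simps printed_PList clauses.simps gadget_words.simps gadget_word_def
        eval_gadget_exprs append_Nil2 eval.simps)
next
  case (CSeq p1 p2)
  have "vars (prog_count p1) \<subseteq> {..<d}" using vars_prog_count[of d p1] CSeq.prems by auto
  then show ?case using CSeq by (simp add: gadget_words_append length_clauses)
next
  case (CFor e p)
  have pc: "vars (prog_count p) \<subseteq> {0}" using vars_prog_count[of "Suc d" p] CFor.prems by simp
  have same: "eval (env(d := i)) f = eval env f" if "vars f \<subseteq> {..<d}" for f i
    by (rule eval_cong) (use that in auto)
  have sub: "vars f \<subseteq> {..<d}" if "vars f \<subseteq> {0}" for f using that CFor.prems(3) by auto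
  have "printed x (Suc d) (env(d := i)) (print_gadgets m q (Suc d) (Add k (Mul (Var d) (prog_count p))) p) =
    gadget_words (eval env m) (eval env q) (eval env k + i * eval env (prog_count p)) (clauses x (Suc d) (env(d := i)) p)"
    for i
  proof -
    have "vars (Add k (Mul (Var d) (prog_count p))) \<subseteq> {..<Suc d}" using CFor.prems(6) sub[OF pc] by auto
    then show ?thesis
      using CFor.IH[of "Suc d" "Add k (Mul (Var d) (prog_count p))" "env(d := i)"] CFor.prems
        same[OF sub] same[of k i] pc by (simp del: fun_upd_apply add: fun_upd_same)
  qed
  moreover have "length (clauses x (Suc d) (env(d := i)) p) = eval env (prog_count p)" for i
    using length_clauses[of "Suc d" p x "env(d := i)"] same[OF sub[OF pc]] CFor.prems by simp
  ultimately show ?case by (simp add: gadget_words_concat)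
qed auto

lemma wf_print_gadgets:
  assumes "wf_prog d p" "0 < d" "vars m \<subseteq> {0}" "vars q \<subseteq> {0}" "vars k \<subseteq> {..<d}"
  shows "wf_printer d (print_gadgets m q d k p)"
  using assms
proof (induction p arbitrary: d k)
  case (Clause a b c)
  let ?es = "gadget_exprs (Mul (Const 2) (Add (Add m k) (Const 1))) a b c"
  have "vars e \<subseteq> {..<d}" if "e \<in> set ?es" for e
    using that Clause.prems by (auto simp: gadget_exprs_def)
  then have "vars e \<subseteq> {..<d}" if "(r, e) \<in> set (zip [0..<12] ?es)" for r e
    using that by (meson set_zip_rightD)
  moreover have "vars m \<subseteq> {..<d}" "vars q \<subseteq> {..<d}" using Clause.prems by auto
  ultimately show ?case using Clause.prems(5) by auto
next
  case (CSeq p1 p2)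
  have "vars (prog_count p1) \<subseteq> {..<d}" using vars_prog_count[of d p1] CSeq.prems by auto
  then show ?case using CSeq by simp
next
  case (CFor e p)
  have "vars (prog_count p) \<subseteq> {..<Suc d}" using vars_prog_count[of "Suc d" p] CFor.prems by auto
  moreover have "vars k \<subseteq> {..<Suc d}" "vars e \<subseteq> {..<d}" using CFor.prems by auto
  ultimately show ?case using CFor by simp
qed auto

text \<open>The order is that of \<open>encode_graph\<close>, followed by the threshold. A tree on
  2n nodes has 2n - 1 edges; without subtraction this is 1 + 2(m + q) + 12q.\<close>

definition tree_printer :: "expr \<Rightarrow> clause_prog \<Rightarrow> printer" where
  "tree_printer m p =
     (let q = prog_count p; n = Add (Const 1) (Add m (Mul (Const 7) q));
        l = unary (Add (Var 1) (Const 1)) in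
      PList [unary (Mul (Const 2) n), PFor n (PSeq l l),
        unary (Add (Const 1) (Add (Mul (Const 2) (Add m q)) (Mul (Const 12) q))),
        edge (Const 1) (Const 0),
        PFor (Mul (Const 2) (Add m q)) (edge (Add (Var 1) (Const 2)) (Const 0)),
        print_gadgets m q 1 (Const 0) p,
        unary (Add (Const 1) (Add m (Mul (Const 3) q)))])"

lemma concat_labels:
  "concat (map (\<lambda>u. encode_nat (u div 2 + 1)) [0..<2 * n]) =
     concat (map (\<lambda>w. encode_nat (w + 1) @ encode_nat (w + 1)) [0..<n])"
  by (induction n) auto

lemma concat_gadgets:
  assumes "k \<le> length cls"
  shows "concat (map (\<lambda>u. encode_edge (u, clause_parent m cls u))
      [2 + 2 * (m + length cls)..<2 + 2 * (m + length cls) + 12 * k]) =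
    gadget_words m (length cls) 0 (take k cls)"
  using assms
proof (induction k)
  case (Suc k)
  let ?b = "2 + 2 * (m + length cls)" and ?f = "\<lambda>u. encode_edge (u, clause_parent m cls u)"
  have "[?b..<?b + 12 * Suc k] = [?b..<?b + 12 * k] @ map (\<lambda>r. ?b + (12 * k + r)) [0..<12]"
  proof -
    have "[?b..<?b + 12 * Suc k] = [?b..<?b + 12 * k] @ [?b + 12 * k..<?b + 12 * k + 12]"
      using upt_add_eq_append[of ?b "?b + 12 * k" 12] by (simp add: add.assoc)
    moreover have "[?b + 12 * k..<?b + 12 * k + 12] = map (\<lambda>r. ?b + (12 * k + r)) [0..<12]"
      by (rule nth_equalityI) auto
    ultimately show ?thesis by simp
  qed
  moreover have "concat (map ?f (map (\<lambda>r. ?b + (12 * k + r)) [0..<12])) = gadget_word m (length cls) k (cls ! k)"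
  proof -
    have "map ?f (map (\<lambda>r. ?b + (12 * k + r)) [0..<12]) =
        map (\<lambda>r. encode_edge (?b + (12 * k + r), gadget (2 * (m + k + 1)) (cls ! k) ! r)) [0..<12]"
      unfolding map_map comp_def by (intro map_cong refl) (simp only: set_upt atLeastLessThan_iff clause_parent_gadget)
    then show ?thesis by (simp only: gadget_word_def)
  qed
  moreover have "take (Suc k) cls = take k cls @ [cls ! k]" using Suc.prems by (simp add: take_Suc_conv_app_nth)
  ultimately show ?case
    using Suc by (simp only: map_append concat_append gadget_words_append) simp
qed simp

lemma printed_tree:
  assumes p: "wf_prog 1 p" "balanced p" "vars m \<subseteq> {0}" and cls_def: "cls = clauses x 1 env p"
  shows "printed x 1 env (tree_printer m p) =
    encode_graph (clause_graph (eval env m) cls) @ encode_nat (1 + eval env m + 3 * length cls)"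
proof -
  let ?m = "eval env m" and ?q = "length cls"
  have q: "eval env (prog_count p) = ?q" using length_clauses[OF p(1,2), of x env] by (simp add: cls_def)
  have N: "1 + (?m + 7 * ?q) = num_labels ?m cls" by (simp add: num_labels_def)
  have "[1..<2 * num_labels ?m cls] = 1 # [2..<2 + 2 * (?m + ?q)] @
      [2 + 2 * (?m + ?q)..<2 + 2 * (?m + ?q) + 12 * ?q]"
  proof -
    have "2 * num_labels ?m cls = 2 + 2 * (?m + ?q) + 12 * ?q" by (simp add: num_labels_def)
    moreover have "[1..<2 * num_labels ?m cls] = 1 # [Suc 1..<2 * num_labels ?m cls]"
      by (rule upt_conv_Cons) (simp add: num_labels_def)
    moreover have "[2..<2 + 2 * (?m + ?q) + 12 * ?q] =
        [2..<2 + 2 * (?m + ?q)] @ [2 + 2 * (?m + ?q)..<2 + 2 * (?m + ?q) + 12 * ?q]"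
      by (rule upt_add_eq_append) simp
    ultimately show ?thesis by (simp only: Suc_1)
  qed
  moreover have "map (\<lambda>u. encode_edge (u, clause_parent ?m cls u)) [2..<2 + 2 * (?m + ?q)] =
      map (\<lambda>u. encode_edge (u + 2, 0)) [0..<2 * (?m + ?q)]"
  proof -
    have "[2..<2 + 2 * (?m + ?q)] = map (\<lambda>u. u + 2) [0..<2 * (?m + ?q)]"
      by (simp only: map_add_upt add.commute)
    then show ?thesis by (simp add: clause_parent_def)
  qed
  moreover have "clause_parent ?m cls 1 = 0" by (simp add: clause_parent_def)
  ultimately have edges: "concat (map (\<lambda>u. encode_edge (u, clause_parent ?m cls u)) [1..<2 * num_labels ?m cls]) =
      encode_edge (1, 0) @ concat (map (\<lambda>u. encode_edge (u + 2, 0)) [0..<2 * (?m + ?q)]) @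
      gadget_words ?m ?q 0 cls"
    using concat_gadgets[of ?q cls ?m] by simp
  have "vars (prog_count p) \<subseteq> {0}" by (rule vars_prog_count[OF p(1)])
  then have gadgets: "printed x 1 env (print_gadgets m (prog_count p) 1 (Const 0) p) = gadget_words ?m ?q 0 cls"
    using printed_gadgets[OF p(1,2) _ p(3), of "prog_count p" "Const 0" x env] by (simp add: q cls_def)
  have graph: "encode_graph (clause_graph ?m cls) =
      encode_nat (2 * num_labels ?m cls) @
      concat (map (\<lambda>w. encode_nat (w + 1) @ encode_nat (w + 1)) [0..<num_labels ?m cls]) @
      encode_nat (1 + (2 * (?m + ?q) + 12 * ?q)) @
      concat (map (\<lambda>u. encode_edge (u, clause_parent ?m cls u)) [1..<2 * num_labels ?m cls])"
  proof -
    have "2 * num_labels ?m cls - 1 = 1 + (2 * (?m + ?q) + 12 * ?q)" by (simp add: num_labels_def)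
    moreover have "(\<lambda>(u, v). encode_nat u @ encode_nat v) = encode_edge" by (auto simp: fun_eq_iff)
    ultimately show ?thesis
      by (simp add: encode_graph_def encode_list_def clause_graph_def comp_def concat_labels[simplified])
  qed
  show ?thesis
    unfolding graph edges tree_printer_def Let_def printed_PList
    using gadgets q N by (simp add: eval.simps)
qed

lemma wf_tree_printer:
  assumes "wf_prog 1 p" "vars m \<subseteq> {0}"
  shows "wf_printer 1 (tree_printer m p)"
proof -
  have "vars (prog_count p) \<subseteq> {0}" by (rule vars_prog_count[OF assms(1)])
  then show ?thesis
    using assms wf_print_gadgets[OF assms(1) _ assms(2), of "prog_count p" "Const 0"]
    by (auto simp: tree_printer_def Let_def)
qed

theorem mainTheorem8:
  shows "NP_hard_minimisation encode_graph min_fair_bisection_recursive_trees"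
  unfolding NP_hard_minimisation_def NP_hard_def
proof (intro allI impI)
  fix A assume "in_NP A"
  then obtain J S acc RS and p :: "nat poly" where machine:
    "2 \<le> J" "3 \<le> S" "acc < S" "\<And>\<tau>. \<tau> \<in> set RS \<Longrightarrow> length \<tau> = J"
    "\<And>\<tau> r w d. \<tau> \<in> set RS \<Longrightarrow> (r, w, d) \<in> set \<tau> \<Longrightarrow> w < S"
    and A: "\<And>x. x \<in> A \<longleftrightarrow> reaches (set RS) acc x (poly p (length x))"
    by (rule in_NP_rule_machine) (rule that, assumption+)
  obtain T where Te: "vars T \<subseteq> {0}" "\<And>env. eval env T = poly p (env 0)"
    using poly_expr by blast
  interpret tableau J S acc RS T
    by unfold_locales (use machine Te(1) in auto)
  have vars_num: "vars num_vars \<subseteq> {0}"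
    using Te(1) by (simp add: num_vars_def width_def)
  let ?env = "\<lambda>x :: bool list. (\<lambda>_. 0)(0 := length x)"
  let ?f = "\<lambda>x. printed x 1 (?env x) (tree_printer num_vars tableau_prog)"
  have "poly_time_computable ?f"
    by (rule printer_poly_time[OF wf_tree_printer[OF wf_tableau_prog vars_num]])
  moreover have "x \<in> A \<longleftrightarrow> ?f x \<in> threshold_language encode_graph min_fair_bisection_recursive_trees" for x
  proof -
    have env: "?env x 0 = length x" by simp
    have "x \<in> A \<longleftrightarrow> reaches (set RS) acc x (steps x)" by (simp add: A steps_def Te(2))
    also have "\<dots> \<longleftrightarrow> satisfiable (vars_used x) (clauses x 1 (?env x) tableau_prog)"
      using tableau_sound[of "?env x" x, OF env] tableau_complete[of "?env x" x, OF env] by blast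
    also have "\<dots> \<longleftrightarrow> ?f x \<in> threshold_language encode_graph min_fair_bisection_recursive_trees"
      unfolding printed_tree[OF wf_tableau_prog balanced_tableau_prog vars_num refl] eval_num_vars[of "?env x" x, OF env]
      using threshold_clauses[OF bounded_tableau[of "?env x" x, OF env]] by simp
    finally show ?thesis .
  qed
  ultimately show "poly_reducible A (threshold_language encode_graph min_fair_bisection_recursive_trees)"
    unfolding poly_reducible_def by blast
qed

end
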